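(* Let $\Gamma_1$ be an infinite countable group and $\Gamma_2$ a finite group with a common subgroup $\Sigma<\Gamma_1,\Gamma_2$ such that $\Sigma$ is highly core-free in $\Gamma_1$ and $[\Gamma_2:\Sigma]\geq2$. Then $\Gamma_1*_\Sigma\Gamma_2\in\mathcal H(\mathbb U_S)$. In particular: (a) if $\Gamma_1$ is countably infinite and $\Gamma_2$ is finite and non-trivial, then $\Gamma_1*\Gamma_2\in\mathcal H(\mathbb U_S)$; (b) if $\Gamma_1$ (infinite countable) is i.c.c., $\Gamma_2$ is finite with a common subgroup $\Sigma$ with $\Gamma_1$, and $[\Gamma_2:\Sigma]\geq2$, then $\Gamma_1*_\Sigma\Gamma_2\in\mathcal H(\mathbb U_S)$.
   Context: $S$ is a fixed countable subset of $[0,1]$ with $0,1\in S$ and $\min(s+t,1)\in S$ for all $s,t\in S$. An $S$-metric space is a metric space whose metric takes values in $S$. The $S$-Urysohn space $\mathbb U_S$ is the unique (up to isometry) countable $S$-metric space with the extension property: whenever $X\subseteq Y$ are finite $S$-metric spaces, every isometric embedding $X\to\mathbb U_S$ extends to an isometric embedding $Y\to\mathbb U_S$. A subgroup $\Sigma$ of a countable group $G$ is highly core-free in $G$ if for every finite subset $F\subseteq G$ there is $\gamma\in G$ such that the map $\Sigma\times F\to G$, $(\sigma,f)\mapsto\sigma\gamma f$, is injective and its range $\Sigma\gamma F$ is disjoint from $F$. A group is i.c.c. if the conjugacy class of every nonidentity element is infinite. An action of a group $\Gamma$ by isometries on $\mathbb U_S$ is homogeneous if for every isometry $\varphi$ between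 two finite subsets of $\mathbb U_S$ there is $\gamma\in\Gamma$ with $\gamma x=\varphi(x)$ for all $x\in\operatorname{dom}\varphi$. $\mathcal H(\mathbb U_S)$ is the class of countable groups which admit a faithful homogeneous action by isometries on $\mathbb U_S$. *)

theory Defs
  imports "HOL-Analysis.Analysis" "HOL-Algebra.Algebra"
begin

section \<open>\<open>S\<close>-metric spaces and the \<open>S\<close>-Urysohn space\<close>

definition distance_set :: "real set \<Rightarrow> bool" where
  "distance_set S \<longleftrightarrow> countable S \<and> S \<subseteq> {0..1} \<and> 0 \<in> S \<and> 1 \<in> S \<and>
     (\<forall>s\<in>S. \<forall>t\<in>S. min (s + t) 1 \<in> S)"

definition S_metric_space :: "real set \<Rightarrow> 'a set \<Rightarrow> ('a \<Rightarrow> 'a \<Rightarrow> real) \<Rightarrow> bool" where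
  "S_metric_space S A d \<longleftrightarrow> Metric_space A d \<and> (\<forall>x\<in>A. \<forall>y\<in>A. d x y \<in> S)"

definition isometric_embedding ::
  "'a set \<Rightarrow> ('a \<Rightarrow> 'a \<Rightarrow> real) \<Rightarrow> 'b set \<Rightarrow> ('b \<Rightarrow> 'b \<Rightarrow> real) \<Rightarrow> ('a \<Rightarrow> 'b) \<Rightarrow> bool" where
  "isometric_embedding A d B d' f \<longleftrightarrow>
     f \<in> A \<rightarrow> B \<and> (\<forall>x\<in>A. \<forall>y\<in>A. d' (f x) (f y) = d x y)"

text \<open>
  The \<open>S\<close>-Urysohn space is unique up to isometry, so it is described by a predicate rather than
  by a chosen model. The finite test spaces \<open>A \<subseteq> B\<close> are taken with points in \<^typ>\<open>nat\<close>: every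
  finite metric space is isometric to such a space.
\<close>

definition S_Urysohn_space :: "real set \<Rightarrow> 'u set \<Rightarrow> ('u \<Rightarrow> 'u \<Rightarrow> real) \<Rightarrow> bool" where
  "S_Urysohn_space S U d \<longleftrightarrow>
     countable U \<and> S_metric_space S U d \<and>
     (\<forall>(A :: nat set) B e f.
        finite B \<and> A \<subseteq> B \<and> S_metric_space S B e \<and> isometric_embedding A e U d f \<longrightarrow>
        (\<exists>g. isometric_embedding B e U d g \<and> (\<forall>x\<in>A. g x = f x)))"


section \<open>Homogeneous actions\<close>

definition isometric_action ::
  "('g, 'm) monoid_scheme \<Rightarrow> 'u set \<Rightarrow> ('u \<Rightarrow> 'u \<Rightarrow> real) \<Rightarrow> ('g \<Rightarrow> 'u \<Rightarrow> 'u) \<Rightarrow> bool" where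
  "isometric_action G U d \<phi> \<longleftrightarrow>
     group_action G U \<phi> \<and>
     (\<forall>g\<in>carrier G. \<forall>x\<in>U. \<forall>y\<in>U. d (\<phi> g x) (\<phi> g y) = d x y)"

definition homogeneous_action ::
  "('g, 'm) monoid_scheme \<Rightarrow> 'u set \<Rightarrow> ('u \<Rightarrow> 'u \<Rightarrow> real) \<Rightarrow> ('g \<Rightarrow> 'u \<Rightarrow> 'u) \<Rightarrow> bool" where
  "homogeneous_action G U d \<phi> \<longleftrightarrow>
     isometric_action G U d \<phi> \<and>
     (\<forall>A B f. finite A \<and> A \<subseteq> U \<and> B \<subseteq> U \<and> f ` A = B \<and> isometric_embedding A d B d f \<longrightarrow>
        (\<exists>g\<in>carrier G. \<forall>x\<in>A. \<phi> g x = f x))"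

definition homogeneous_groups ::
  "'u set \<Rightarrow> ('u \<Rightarrow> 'u \<Rightarrow> real) \<Rightarrow> 'g monoid set"  (\<open>\<H>\<close>) where
  "\<H> U d = {G. group G \<and> countable (carrier G) \<and>
     (\<exists>\<phi>. faithful_action G U \<phi> \<and> homogeneous_action G U d \<phi>)}"


section \<open>Group-theoretic notions\<close>

definition highly_core_free :: "'g set \<Rightarrow> ('g, 'm) monoid_scheme \<Rightarrow> bool" where
  "highly_core_free H G \<longleftrightarrow>
     subgroup H G \<and>
     (\<forall>F. finite F \<and> F \<subseteq> carrier G \<longrightarrow>
        (\<exists>\<gamma>\<in>carrier G.
           inj_on (\<lambda>(\<sigma>, f). \<sigma> \<otimes>\<^bsub>G\<^esub> \<gamma> \<otimes>\<^bsub>G\<^esub> f) (H \<times> F) \<and>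
           (\<lambda>(\<sigma>, f). \<sigma> \<otimes>\<^bsub>G\<^esub> \<gamma> \<otimes>\<^bsub>G\<^esub> f) ` (H \<times> F) \<inter> F = {}))"

definition icc :: "('g, 'm) monoid_scheme \<Rightarrow> bool" where
  "icc G \<longleftrightarrow>
     (\<forall>g\<in>carrier G. g \<noteq> \<one>\<^bsub>G\<^esub> \<longrightarrow> infinite {h \<otimes>\<^bsub>G\<^esub> g \<otimes>\<^bsub>G\<^esub> inv\<^bsub>G\<^esub> h | h. h \<in> carrier G})"


section \<open>Free products and amalgamated free products\<close>

text \<open>
  Both are quotients of the monoid of words over the disjoint union of the two carriers by the
  least congruence that makes the two inclusions multiplicative and unital and identifies the
  letters \<open>Inl x\<close> and \<open>Inr y\<close> for \<open>(x, y) \<in> R\<close>. This is the presentation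
  \<open>\<langle>G1, G2 | x = y for (x, y) \<in> R\<rangle>\<close>; formal inverses of letters are not needed because
  the factors are groups.
\<close>

inductive_set word_cong ::
  "('a, 'm) monoid_scheme \<Rightarrow> ('b, 'n) monoid_scheme \<Rightarrow> ('a \<times> 'b) set \<Rightarrow>
     (('a + 'b) list \<times> ('a + 'b) list) set"
  for G1 :: "('a, 'm) monoid_scheme" and G2 :: "('b, 'n) monoid_scheme" and R :: "('a \<times> 'b) set"
where
  one_left: "([Inl \<one>\<^bsub>G1\<^esub>], []) \<in> word_cong G1 G2 R"
| one_right: "([Inr \<one>\<^bsub>G2\<^esub>], []) \<in> word_cong G1 G2 R"
| mult_left: "\<lbrakk>x \<in> carrier G1; y \<in> carrier G1\<rbrakk> \<Longrightarrow>
    ([Inl x, Inl y], [Inl (x \<otimes>\<^bsub>G1\<^esub> y)]) \<in> word_cong G1 G2 R"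
| mult_right: "\<lbrakk>x \<in> carrier G2; y \<in> carrier G2\<rbrakk> \<Longrightarrow>
    ([Inr x, Inr y], [Inr (x \<otimes>\<^bsub>G2\<^esub> y)]) \<in> word_cong G1 G2 R"
| identify: "\<lbrakk>(x, y) \<in> R; x \<in> carrier G1; y \<in> carrier G2\<rbrakk> \<Longrightarrow>
    ([Inl x], [Inr y]) \<in> word_cong G1 G2 R"
| refl: "u \<in> lists (carrier G1 <+> carrier G2) \<Longrightarrow> (u, u) \<in> word_cong G1 G2 R"
| sym: "(u, v) \<in> word_cong G1 G2 R \<Longrightarrow> (v, u) \<in> word_cong G1 G2 R"
| trans: "\<lbrakk>(u, v) \<in> word_cong G1 G2 R; (v, w) \<in> word_cong G1 G2 R\<rbrakk> \<Longrightarrow>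
    (u, w) \<in> word_cong G1 G2 R"
| append: "\<lbrakk>(u, u') \<in> word_cong G1 G2 R; (v, v') \<in> word_cong G1 G2 R\<rbrakk> \<Longrightarrow>
    (u @ v, u' @ v') \<in> word_cong G1 G2 R"

definition word_quotient ::
  "('a, 'm) monoid_scheme \<Rightarrow> ('b, 'n) monoid_scheme \<Rightarrow> ('a \<times> 'b) set \<Rightarrow> ('a + 'b) list set monoid"
where
  "word_quotient G1 G2 R =
     \<lparr>carrier = lists (carrier G1 <+> carrier G2) // word_cong G1 G2 R,
      mult = (\<lambda>A B. word_cong G1 G2 R `` {u @ v | u v. u \<in> A \<and> v \<in> B}),
      one = word_cong G1 G2 R `` {[]}\<rparr>"

definition free_product ::
  "('a, 'm) monoid_scheme \<Rightarrow> ('b, 'n) monoid_scheme \<Rightarrow> ('a + 'b) list set monoid" where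
  "free_product G1 G2 = word_quotient G1 G2 {}"

definition amalgamated_free_product ::
  "('a, 'm) monoid_scheme \<Rightarrow> ('b, 'n) monoid_scheme \<Rightarrow> ('s, 'k) monoid_scheme \<Rightarrow>
     ('s \<Rightarrow> 'a) \<Rightarrow> ('s \<Rightarrow> 'b) \<Rightarrow> ('a + 'b) list set monoid" where
  "amalgamated_free_product G1 G2 K i1 i2 =
     word_quotient G1 G2 {(i1 s, i2 s) | s. s \<in> carrier K}"

text \<open>
  A common subgroup of \<open>G1\<close> and \<open>G2\<close> is a group \<open>K\<close> together with embeddings \<open>i1\<close>, \<open>i2\<close>
  into both groups; its copies there are \<open>i1 ` carrier K\<close> and \<open>i2 ` carrier K\<close>.
\<close>

definition common_subgroup ::
  "('s, 'k) monoid_scheme \<Rightarrow> ('a, 'm) monoid_scheme \<Rightarrow> ('b, 'n) monoid_scheme \<Rightarrow>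
     ('s \<Rightarrow> 'a) \<Rightarrow> ('s \<Rightarrow> 'b) \<Rightarrow> bool" where
  "common_subgroup K G1 G2 i1 i2 \<longleftrightarrow> group K \<and> i1 \<in> mon K G1 \<and> i2 \<in> mon K G2"

end

theory Submission
  imports Defs
begin

text \<open>
  The first factor is made to act on the Urysohn space freely and in such a way that any two points
  are moved to distance \<open>1\<close> from each other by all but finitely many elements, every orbit that could
  be added over a finite set is already present, and a discrete copy of the amalgam itself occurs as
  an invariant subset. Such a space is the union of a chain of stages, each of which adds one free
  orbit with shortest-path distances truncated at \<open>1\<close>; by back and forth it is the Urysohn space.

  Inside this space an action of the finite factor that agrees with the first one on the amalgamated
  subgroup is obtained as the union of a chain of isometric actions on finite sets. Its domain can be
  enlarged by any point. A finite partial isometry \<open>\<phi>\<close> can be realised: as the subgroup is highly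
  core-free, some \<open>g1\<close> and \<open>g2\<close> move the domain and the range of \<open>\<phi>\<close> to distance \<open>1\<close> from everything
  relevant, so that an element of the finite factor outside the subgroup may be declared to map
  \<open>g1 x\<close> to \<open>g2 (\<phi> x)\<close>. Finally, any finite part of the orbit of a nontrivial element can be
  made to occur in a translate of the copy of the amalgam, which gives faithfulness.
\<close>

section \<open>Adjoining free orbits to metric spaces\<close>

text \<open>Two obstacles shape the construction. Since both factors must agree on the amalgamated
  subgroup, points cannot be placed one at a time: whole orbits of that subgroup are placed,
  equivariantly. The subgroup embeds into a finite group and hence is finite, so the first action is
  built to realise prescribed orbits over finite invariant sets for finite subgroups. The other
  obstacle is that \<open>S\<close> need not be closed under infima, so a shortest-path distance
  must be a minimum over a finite set. Truncation at \<open>1\<close> makes all points irrelevant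
  except those at distance less than \<open>1\<close>, and the invariant of the construction is that
  every point has only finitely many of these around it. Together with freeness the same invariant
  bounds the group elements that fail to move one point to distance \<open>1\<close> from another.
  Thus only finitely many elements are bad, and a condition on finite subsets of the group, such as
  high core-freeness, can deal with them.\<close>

lemma distance_setD:
  assumes "distance_set S"
  shows "countable S" "0 \<in> S" "1 \<in> S"
    and "s \<in> S \<Longrightarrow> 0 \<le> s" "s \<in> S \<Longrightarrow> s \<le> 1"
    and "s \<in> S \<Longrightarrow> t \<in> S \<Longrightarrow> min (s + t) 1 \<in> S"
  using assms unfolding distance_set_def by (auto simp: subset_iff)

text \<open>The inserted \<open>1\<close> provides the value for empty \<open>A\<close>. Truncating
  each term matters because \<open>S\<close> is closed only under sums cut off at \<open>1\<close>;
  the minimum then lies in \<open>S\<close> because it is attained.\<close>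

definition trunc_Min :: "'a set \<Rightarrow> ('a \<Rightarrow> real) \<Rightarrow> real" where
  "trunc_Min A r = Min (insert 1 ((\<lambda>a. min (r a) 1) ` A))"

lemma trunc_Min_le_1: "finite A \<Longrightarrow> trunc_Min A r \<le> 1"
  unfolding trunc_Min_def by (intro Min_le) auto

lemma trunc_Min_le: "finite A \<Longrightarrow> a \<in> A \<Longrightarrow> trunc_Min A r \<le> r a"
proof -
  assume "finite A" "a \<in> A"
  then have "trunc_Min A r \<le> min (r a) 1"
    unfolding trunc_Min_def by (intro Min_le) auto
  then show ?thesis by simp
qed

lemma trunc_Min_cases:
  assumes "finite A"
  obtains "trunc_Min A r = 1" | a where "a \<in> A" "trunc_Min A r = r a" "r a < 1"
proof -
  have "trunc_Min A r \<in> insert 1 ((\<lambda>a. min (r a) 1) ` A)"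
    unfolding trunc_Min_def using assms by (intro Min_in) auto
  then consider "trunc_Min A r = 1" | a where "a \<in> A" "trunc_Min A r = min (r a) 1" by blast
  then show thesis using that by cases (metis, metis linorder_not_le min.absorb3 min.absorb2)
qed

lemma trunc_Min_in:
  assumes "distance_set S" "finite A" "\<And>a. a \<in> A \<Longrightarrow> \<exists>s\<in>S. \<exists>t\<in>S. r a = s + t"
  shows "trunc_Min A r \<in> S"
proof -
  have "trunc_Min A r \<in> insert 1 ((\<lambda>a. min (r a) 1) ` A)"
    unfolding trunc_Min_def using assms by (intro Min_in) auto
  then show ?thesis using assms distance_setD[OF assms(1)] by fastforce
qed

text \<open>Unlike in \<open>Metric_space\<close>, all conditions are confined to \<open>M\<close>,
  since distances are built in stages and are arbitrary elsewhere. For a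
  \<open>distance_set\<close>, nonnegativity is contained in \<open>d x y \<in> S\<close>.\<close>

definition S_metric_on :: "real set \<Rightarrow> 'x set \<Rightarrow> ('x \<Rightarrow> 'x \<Rightarrow> real) \<Rightarrow> bool" where
  "S_metric_on S M d \<longleftrightarrow>
     (\<forall>x\<in>M. \<forall>y\<in>M. d x y \<in> S \<and> d x y = d y x \<and> (d x y = 0 \<longleftrightarrow> x = y) \<and>
        (\<forall>z\<in>M. d x z \<le> d x y + d y z))"

lemma S_metric_onD:
  assumes "S_metric_on S M d" "x \<in> M" "y \<in> M"
  shows "d x y \<in> S" "d x y = d y x" "d x y = 0 \<longleftrightarrow> x = y" "z \<in> M \<Longrightarrow> d x z \<le> d x y + d y z"
  using assms unfolding S_metric_on_def by blast+

lemma S_metric_on_subset: "S_metric_on S M d \<Longrightarrow> N \<subseteq> M \<Longrightarrow> S_metric_on S N d"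
  unfolding S_metric_on_def by blast

text \<open>Keeping \<open>H\<close> as a set of elements of \<open>G\<close> lets one function
  \<open>act\<close> serve the whole group and its subgroups.\<close>

definition isometric_on ::
  "('g, 'm) monoid_scheme \<Rightarrow> 'g set \<Rightarrow> 'x set \<Rightarrow> ('g \<Rightarrow> 'x \<Rightarrow> 'x) \<Rightarrow> ('x \<Rightarrow> 'x \<Rightarrow> real) \<Rightarrow> bool"
where
  "isometric_on G H M act d \<longleftrightarrow>
     (\<forall>x\<in>M. act \<one>\<^bsub>G\<^esub> x = x) \<and>
     (\<forall>g\<in>H. \<forall>x\<in>M. act g x \<in> M \<and> (\<forall>h\<in>H. act (g \<otimes>\<^bsub>G\<^esub> h) x = act g (act h x)) \<and>
        (\<forall>y\<in>M. d (act g x) (act g y) = d x y))"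

lemma isometric_onD:
  assumes "isometric_on G H M act d" "x \<in> M"
  shows "act \<one>\<^bsub>G\<^esub> x = x"
    and "g \<in> H \<Longrightarrow> act g x \<in> M"
    and "g \<in> H \<Longrightarrow> h \<in> H \<Longrightarrow> act (g \<otimes>\<^bsub>G\<^esub> h) x = act g (act h x)"
    and "g \<in> H \<Longrightarrow> y \<in> M \<Longrightarrow> d (act g x) (act g y) = d x y"
  using assms unfolding isometric_on_def by blast+

lemma isometric_on_subset:
  assumes "isometric_on G H M act d" "N \<subseteq> M" "K \<subseteq> H" "\<And>g x. g \<in> K \<Longrightarrow> x \<in> N \<Longrightarrow> act g x \<in> N"
  shows "isometric_on G K N act d"
  using assms unfolding isometric_on_def by blast

text \<open>
  Data for adjoining the orbit of a new point \<open>p\<close> with trivial stabiliser: \<open>w x\<close> is the distance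
  from \<open>p\<close> to \<open>x\<close>, and \<open>c g\<close> is the distance from \<open>p\<close> to \<open>g p\<close>.
\<close>

definition orbit_data ::
  "('g, 'm) monoid_scheme \<Rightarrow> real set \<Rightarrow> 'g set \<Rightarrow> 'x set \<Rightarrow> ('g \<Rightarrow> 'x \<Rightarrow> 'x) \<Rightarrow>
     ('x \<Rightarrow> 'x \<Rightarrow> real) \<Rightarrow> ('x \<Rightarrow> real) \<Rightarrow> ('g \<Rightarrow> real) \<Rightarrow> bool"
where
  "orbit_data G S H M act d w c \<longleftrightarrow>
     (\<forall>x\<in>M. w x \<in> S \<and> 0 < w x \<and> (\<forall>y\<in>M. w x \<le> w y + d x y \<and> d x y \<le> w x + w y)) \<and>
     (\<forall>g\<in>H. c g \<in> S \<and> (c g = 0 \<longleftrightarrow> g = \<one>\<^bsub>G\<^esub>) \<and>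
        (\<forall>h\<in>H. c (g \<otimes>\<^bsub>G\<^esub> h) \<le> c g + c h \<and> (g \<otimes>\<^bsub>G\<^esub> h = \<one>\<^bsub>G\<^esub> \<longrightarrow> c g = c h)) \<and>
        (\<forall>x\<in>M. w (act g x) \<le> w x + c g \<and> c g \<le> w x + w (act g x)))"

lemma orbit_dataD:
  assumes "orbit_data G S H M act d w c"
  shows "x \<in> M \<Longrightarrow> w x \<in> S" "x \<in> M \<Longrightarrow> 0 < w x"
    and "x \<in> M \<Longrightarrow> y \<in> M \<Longrightarrow> w x \<le> w y + d x y"
    and "x \<in> M \<Longrightarrow> y \<in> M \<Longrightarrow> d x y \<le> w x + w y"
    and "g \<in> H \<Longrightarrow> c g \<in> S" "g \<in> H \<Longrightarrow> c g = 0 \<longleftrightarrow> g = \<one>\<^bsub>G\<^esub>"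
    and "g \<in> H \<Longrightarrow> h \<in> H \<Longrightarrow> c (g \<otimes>\<^bsub>G\<^esub> h) \<le> c g + c h"
    and "g \<in> H \<Longrightarrow> h \<in> H \<Longrightarrow> g \<otimes>\<^bsub>G\<^esub> h = \<one>\<^bsub>G\<^esub> \<Longrightarrow> c g = c h"
    and "g \<in> H \<Longrightarrow> x \<in> M \<Longrightarrow> w (act g x) \<le> w x + c g"
    and "g \<in> H \<Longrightarrow> x \<in> M \<Longrightarrow> c g \<le> w x + w (act g x)"
  using assms unfolding orbit_data_def by blast+

text \<open>The Katetov extension of \<open>w0\<close>: the shortest path from the new point
  \<open>p\<close> to \<open>x\<close> through \<open>F\<close>, cut off at \<open>1\<close>.
  Invariance of \<open>F\<close> under \<open>H\<close> lets such paths be translated, which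
  preserves the inequalities involving \<open>c\<close>. A value below \<open>1\<close> forces
  \<open>x\<close> into the open unit ball about some point of \<open>F\<close>, whence the final
  finiteness.\<close>

lemma orbit_data_extend_space:
  fixes G (structure)
  assumes S: "distance_set S" and G: "group G" and H: "subgroup H G"
    and M: "S_metric_on S M d" and act: "isometric_on G H M act d"
    and F: "finite F" "F \<subseteq> M" "\<And>h f. h \<in> H \<Longrightarrow> f \<in> F \<Longrightarrow> act h f \<in> F"
    and D: "orbit_data G S H F act d w0 c"
    and balls: "\<And>y. y \<in> M \<Longrightarrow> finite {x \<in> M. d y x < 1}"
  obtains w where "orbit_data G S H M act d w c" "\<And>x. x \<in> F \<Longrightarrow> w x = w0 x"
    "finite {x \<in> M. w x < 1}"
proof -
  interpret group G by fact
  interpret H: subgroup H G by fact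
  note S = distance_setD[OF S] and m = S_metric_onD[OF M] and a = isometric_onD[OF act]
    and o = orbit_dataD[OF D]
  define w where "w x = trunc_Min F (\<lambda>f. w0 f + d f x)" for x
  have le1: "w x \<le> 1" for x unfolding w_def by (intro trunc_Min_le_1 F)
  have le: "w x \<le> w0 f + d f x" if "f \<in> F" for f x
    unfolding w_def using trunc_Min_le[OF F(1) that, of "\<lambda>f. w0 f + d f x"] by simp
  have cs: "w x = 1 \<or> (\<exists>f\<in>F. w x = w0 f + d f x \<and> w0 f + d f x < 1)" for x
    unfolding w_def by (rule trunc_Min_cases[OF F(1), of "\<lambda>f. w0 f + d f x"]) auto
  have d0: "0 \<le> d x y" "d x y \<le> 1" if "x \<in> M" "y \<in> M" for x y
    using m[OF that] S by auto
  have FM: "f \<in> M" if "f \<in> F" for f using that F by auto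
  have wS: "w x \<in> S" if "x \<in> M" for x
    unfolding w_def using that o(1) m(1) FM by (intro trunc_Min_in assms(1) F(1)) blast
  have w0: "0 < w x" if "x \<in> M" for x
    using cs[of x] o(2) d0(1) FM that by (metis add_pos_nonneg zero_less_one)
  have k1: "w x \<le> w y + d x y" if "x \<in> M" "y \<in> M" for x y
  proof (cases "w y = 1")
    case True
    then show ?thesis using le1[of x] d0[OF that] by linarith
  next
    case False
    then obtain f where f: "f \<in> F" "w y = w0 f + d f y" using cs by blast
    then show ?thesis using le[OF f(1), of x] m(4)[OF FM[OF f(1)] that(2) that(1)] m(2)[OF that]
      by linarith
  qed
  have k2: "d x y \<le> w x + w y" if "x \<in> M" "y \<in> M" for x y
  proof (cases "w x = 1 \<or> w y = 1")
    case True
    then show ?thesis using d0[OF that] w0[OF that(1)] w0[OF that(2)] by linarith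
  next
    case False
    then obtain f f' where f: "f \<in> F" "w x = w0 f + d f x" and f': "f' \<in> F" "w y = w0 f' + d f' y"
      using cs by meson
    have "d x y \<le> d x f + d f f' + d f' y"
      using m(4)[OF that(1) FM[OF f(1)] FM[OF f'(1)]] m(4)[OF that(1) FM[OF f'(1)] that(2)]
      by linarith
    then show ?thesis using o(4)[OF f(1) f'(1)] f(2) f'(2) m(2)[OF that(1) FM[OF f(1)]] by linarith
  qed
  \<comment> \<open>If a shortest path from \<open>p\<close> to \<open>x\<close> runs through
    \<open>f\<close>, then \<open>act g x\<close> is reached through \<open>act g f\<close>, which
    is again a point of \<open>F\<close>.\<close>
  have k3: "w (act g x) \<le> w x + c g" if "g \<in> H" "x \<in> M" for g x
  proof (cases "w x = 1")
    case True
    then show ?thesis using le1[of "act g x"] S(4)[OF o(5)[OF that(1)]] by linarith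
  next
    case False
    then obtain f where f: "f \<in> F" "w x = w0 f + d f x" using cs by blast
    show ?thesis
      using le[OF F(3)[OF that(1) f(1)], of "act g x"] a(4)[OF FM[OF f(1)] that]
        o(9)[OF that(1) f(1)] f(2) by linarith
  qed
  have k4: "c g \<le> w x + w (act g x)" if "g \<in> H" "x \<in> M" for g x
  proof (cases "w x = 1 \<or> w (act g x) = 1")
    case True
    then show ?thesis
      using S(5)[OF o(5)[OF that(1)]] w0[OF that(2)] w0[OF a(2)[OF that(2,1)]] by linarith
  next
    case False
    then obtain f f' where f: "f \<in> F" "w x = w0 f + d f x"
      and f': "f' \<in> F" "w (act g x) = w0 f' + d f' (act g x)"
      using cs by meson
    have "w0 (act g f) \<le> w0 f' + d (act g f) f'"
      using o(3) F(3) that f(1) f'(1) by blast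
    moreover have "d (act g f) f' \<le> d (act g f) (act g x) + d (act g x) f'"
      using m(4) a(2) FM f(1) f'(1) that by blast
    moreover have "d (act g f) (act g x) = d f x" using a(4) FM f(1) that by blast
    moreover have "d (act g x) f' = d f' (act g x)" using m(2) a(2) FM f'(1) that by blast
    ultimately show ?thesis using o(10)[OF that(1) f(1)] f(2) f'(2) by linarith
  qed
  have "orbit_data G S H M act d w c"
    unfolding orbit_data_def using wS w0 k1 k2 k3 k4 o(5-8) by simp
  moreover have "w x = w0 x" if "x \<in> F" for x
  proof (rule antisym)
    have "d x x = 0" using m(3) FM that by blast
    then show "w x \<le> w0 x" using le[OF that, of x] by simp
    show "w0 x \<le> w x"
      using cs[of x] S(5)[OF o(1)[OF that]] o(3)[OF that] m(2)[OF FM[OF that]] FM by force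
  qed
  moreover have "finite {x \<in> M. w x < 1}"
  proof (rule finite_subset)
    show "{x \<in> M. w x < 1} \<subseteq> (\<Union>f\<in>F. {x \<in> M. d f x < 1})"
    proof
      fix x assume x: "x \<in> {x \<in> M. w x < 1}"
      then obtain f where "f \<in> F" "w0 f + d f x < 1" using cs[of x] by fastforce
      then show "x \<in> (\<Union>f\<in>F. {x \<in> M. d f x < 1})" using o(2)[of f] x by fastforce
    qed
    show "finite (\<Union>f\<in>F. {x \<in> M. d f x < 1})" using F balls by auto
  qed
  ultimately show thesis using that by blast
qed

text \<open>Outside \<open>H\<close> the distance from \<open>p\<close> to \<open>g p\<close> is the
  length of a shortest path through the old space: from \<open>p\<close> to \<open>act g z\<close>
  and on to \<open>g p\<close>, of length \<open>w (act g z) + w z\<close>. The last conclusion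
  records which \<open>g\<close> can move \<open>p\<close> by less than \<open>1\<close>, so that
  they can be counted later.\<close>

lemma orbit_data_extend_group:
  fixes G (structure)
  assumes S: "distance_set S" and G: "group G" and H: "subgroup H G"
    and M: "S_metric_on S M d" and act: "isometric_on G (carrier G) M act d"
    and D: "orbit_data G S H M act d w c0"
    and fin: "finite {x \<in> M. w x < 1}"
  obtains c where "orbit_data G S (carrier G) M act d w c" "\<And>h. h \<in> H \<Longrightarrow> c h = c0 h"
    "\<And>g. g \<in> carrier G \<Longrightarrow> c g < 1 \<Longrightarrow> g \<in> H \<or> (\<exists>z\<in>M. w z < 1 \<and> w (act g z) < 1)"
proof -
  interpret group G by fact
  interpret H: subgroup H G by fact
  note S = distance_setD[OF S] and m = S_metric_onD[OF M] and a = isometric_onD[OF act]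
    and o = orbit_dataD[OF D]
  \<comment> \<open>A point \<open>z\<close> with \<open>w z = 1\<close> gives no path shorter than
    \<open>1\<close>, so the minimum may be taken over the finite set \<open>W\<close>.\<close>
  define W where "W = {x \<in> M. w x < 1}"
  define c where "c g = (if g \<in> H then c0 g else trunc_Min W (\<lambda>z. w z + w (act g z)))" for g
  have W: "finite W" "z \<in> W \<Longrightarrow> z \<in> M" for z using fin by (auto simp: W_def)
  have wS: "0 \<le> w z" "w z \<le> 1" if "z \<in> M" for z using S o(1)[OF that] by auto
  have cH: "c g = c0 g" if "g \<in> H" for g using that by (simp add: c_def)
  have le1: "c g \<le> 1" if "g \<in> carrier G" for g
    using o(5)[of g] S by (auto simp: c_def intro: trunc_Min_le_1 W)
  have le: "c g \<le> w z + w (act g z)" if "g \<in> carrier G" "z \<in> M" for g z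
  proof (cases "g \<in> H")
    case True
    then show ?thesis using o(10)[OF True that(2)] by (simp add: cH)
  next
    case False
    show ?thesis
    proof (cases "z \<in> W")
      case True
      show ?thesis using False trunc_Min_le[OF W(1) True, of "\<lambda>z. w z + w (act g z)"]
        by (simp add: c_def)
    next
      case False
      then have "w z = 1" using that wS(2)[of z] by (auto simp: W_def)
      then show ?thesis using le1[OF that(1)] wS(1)[of "act g z"] a(2)[of z g] that by linarith
    qed
  qed
  have cs: "c g = 1 \<or> (\<exists>z\<in>W. c g = w z + w (act g z) \<and> w z + w (act g z) < 1)" if "g \<notin> H" for g
    using that by (auto simp: c_def intro: trunc_Min_cases[OF W(1), of "\<lambda>z. w z + w (act g z)"])
  have cS: "c g \<in> S" if "g \<in> carrier G" for g
  proof (cases "g \<in> H")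
    case False
    then show ?thesis
      using o(1) a(2) that W by (auto simp: c_def intro!: trunc_Min_in assms(1)) blast
  qed (use o in \<open>simp add: c_def\<close>)
  have c0: "c g = 0 \<longleftrightarrow> g = \<one>" if "g \<in> carrier G" for g
  proof (cases "g \<in> H")
    case False
    have "c g \<noteq> 0"
      using cs[OF False] o(2) a(2) W that by (smt (verit, best))
    then show ?thesis using False by auto
  qed (use o in \<open>simp add: c_def\<close>)
  have inv_le: "c g \<le> c h" if "g \<in> carrier G" "h \<in> carrier G" "g \<otimes> h = \<one>" for g h
  proof (cases "g \<in> H")
    case True
    have "h = inv g" using that by (metis inv_equality l_inv_ex r_inv inv_unique' inv_comm)
    then have "h \<in> H" using True by simp
    then show ?thesis using True o(8)[of g h] that by (simp add: cH)
  next
    case False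
    have "h \<notin> H" using False that by (metis H.m_inv_closed inv_equality)
    then consider "c h = 1" | z where "z \<in> W" "c h = w z + w (act h z)" using cs by blast
    then show ?thesis
    proof cases
      case 1
      then show ?thesis using le1 that by simp
    next
      case 2
      \<comment> \<open>The path for \<open>h\<close> through \<open>z\<close>, read backwards, is a
        path for \<open>g\<close> through \<open>act h z\<close>.\<close>
      have "act g (act h z) = z" using a(3)[of z g h] a(1)[of z] 2 W that by simp
      then show ?thesis using le[of g "act h z"] a(2)[of z h] 2 W that by simp
    qed
  qed
  have inv_eq: "c g = c h" if "g \<in> carrier G" "h \<in> carrier G" "g \<otimes> h = \<one>" for g h
    using inv_le[OF that] inv_le[of h g] that inv_comm by force
  have k3: "w (act g x) \<le> w x + c g" if "g \<in> carrier G" "x \<in> M" for g x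
  proof (cases "g \<in> H")
    case True
    then show ?thesis using o(9)[OF True that(2)] by (simp add: cH)
  next
    case False
    then consider "c g = 1" | z where "z \<in> W" "c g = w z + w (act g z)" using cs by blast
    then show ?thesis
    proof cases
      case 1
      then show ?thesis using wS that a(2) by (simp add: add_increasing)
    next
      case 2
      have "w (act g x) \<le> w (act g z) + d (act g x) (act g z)" using o(3) a(2) W that 2 by blast
      moreover have "d (act g x) (act g z) = d x z" using a(4) W that 2 by blast
      moreover have "d x z \<le> w x + w z" using o(4) W that 2 by blast
      ultimately show ?thesis using 2 by linarith
    qed
  qed
  have tri: "c (g \<otimes> h) \<le> c g + c h" if gh: "g \<in> carrier G" "h \<in> carrier G" for g h
  proof -
    have act_gh: "act (g \<otimes> h) z = act g (act h z)" if "z \<in> M" for z using a(3) gh that by blast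
    have ge0: "0 \<le> c g" "0 \<le> c h" using cS S(4) gh by auto
    show ?thesis
    proof (cases "h \<in> H")
      case False
      then consider "c h = 1" | z where "z \<in> W" "c h = w z + w (act h z)" using cs by blast
      then show ?thesis
      proof cases
        case 1
        then show ?thesis using le1[of "g \<otimes> h"] ge0 gh by simp
      next
        case 2
        have "c (g \<otimes> h) \<le> w z + w (act g (act h z))" using le[of "g \<otimes> h" z] act_gh W 2 gh by simp
        moreover have "w (act g (act h z)) \<le> w (act h z) + c g" using k3 a(2) W 2 gh by simp
        ultimately show ?thesis using 2 by linarith
      qed
    next
      case hH: True
      show ?thesis
      proof (cases "g \<in> H")
        case True
        then show ?thesis using hH o(7) cH by simp
      next
        case False
        then consider "c g = 1" | z where "z \<in> W" "c g = w z + w (act g z)" using cs by blast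
        then show ?thesis
        proof cases
          case 1
          then show ?thesis using le1[of "g \<otimes> h"] ge0 gh by simp
        next
          case 2
          \<comment> \<open>The path for \<open>g\<close> through \<open>z\<close> becomes a path
            for \<open>g \<otimes> h\<close> through the point that \<open>h\<close> maps to
            \<open>z\<close>; the detour costs at most \<open>c h\<close>.\<close>
          define y where "y = act (inv h) z"
          have y: "y \<in> M" unfolding y_def using a(2) W 2 gh by simp
          have hy: "act h y = z"
            unfolding y_def using a(3)[of z h "inv h"] a(1)[of z] W 2 gh by simp
          have "w y \<le> w z + c (inv h)" unfolding y_def using k3 W 2 gh by simp
          moreover have "c (inv h) = c h" using inv_eq gh by simp
          moreover have "c (g \<otimes> h) \<le> w y + w (act g z)"
            using le[of "g \<otimes> h" y] act_gh[OF y] hy y gh by simp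
          ultimately show ?thesis using 2 by linarith
        qed
      qed
    qed
  qed
  have "orbit_data G S (carrier G) M act d w c"
    unfolding orbit_data_def using o(1-4) cS c0 tri inv_eq k3 le by simp
  moreover have "g \<in> H \<or> (\<exists>z\<in>M. w z < 1 \<and> w (act g z) < 1)"
    if gc: "g \<in> carrier G" and lt: "c g < 1" for g
  proof (cases "g \<in> H")
    case False
    then obtain z where z: "z \<in> W" "w z + w (act g z) < 1" using cs[OF False] lt by force
    then have "w z < 1" "w (act g z) < 1"
      using wS(1)[of z] wS(1)[of "act g z"] a(2)[of z g] W(2) gc by fastforce+
    then show ?thesis using z W by blast
  qed simp
  ultimately show thesis using that cH by blast
qed

text \<open>Invariance forces these formulas: translating \<open>p g\<close>, the point
  \<open>g p\<close>, back to the base point leaves only the distances \<open>w\<close> and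
  \<open>c\<close>. Up to such translations the eight types of triangle reduce to the triangle
  inequality in \<open>M\<close> and the inequalities in \<open>orbit_data\<close>. As
  \<open>d\<close> is only assumed to satisfy the formulas, the lemma serves both for the infinite
  stages and for finite partial actions.\<close>

lemma adjoin_orbit:
  fixes G (structure)
  assumes S: "distance_set S" and G: "group G"
    and M: "S_metric_on S M d" and act: "isometric_on G (carrier G) M act d"
    and D: "orbit_data G S (carrier G) M act d w c"
    and p: "inj_on p (carrier G)" "\<And>g. g \<in> carrier G \<Longrightarrow> p g \<notin> M"
    and act_p: "\<And>g h. g \<in> carrier G \<Longrightarrow> h \<in> carrier G \<Longrightarrow> act g (p h) = p (g \<otimes>\<^bsub>G\<^esub> h)"
    and dp: "\<And>g x. g \<in> carrier G \<Longrightarrow> x \<in> M \<Longrightarrow> d (p g) x = w (act (inv\<^bsub>G\<^esub> g) x)"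
      "\<And>g x. g \<in> carrier G \<Longrightarrow> x \<in> M \<Longrightarrow> d x (p g) = w (act (inv\<^bsub>G\<^esub> g) x)"
      "\<And>g h. g \<in> carrier G \<Longrightarrow> h \<in> carrier G \<Longrightarrow> d (p g) (p h) = c (inv\<^bsub>G\<^esub> g \<otimes>\<^bsub>G\<^esub> h)"
  shows "S_metric_on S (M \<union> p ` carrier G) d"
    and "isometric_on G (carrier G) (M \<union> p ` carrier G) act d"
proof -
  interpret group G by fact
  note S = distance_setD[OF S] and m = S_metric_onD[OF M] and a = isometric_onD[OF act]
    and o = orbit_dataD[OF D]
  have invact: "act (inv g) x \<in> M" if "g \<in> carrier G" "x \<in> M" for g x using a(2) that by simp
  have pM: "p g \<noteq> x" "x \<noteq> p g" if "g \<in> carrier G" "x \<in> M" for g x using p(2) that by auto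
  have pp: "p g = p h \<longleftrightarrow> g = h" if "g \<in> carrier G" "h \<in> carrier G" for g h
    using p(1) that by (auto simp: inj_on_def)
  have c_sym: "c (inv g \<otimes> h) = c (inv h \<otimes> g)" if "g \<in> carrier G" "h \<in> carrier G" for g h
  proof -
    have "inv g \<otimes> h \<otimes> (inv h \<otimes> g) = \<one>"
      using that by (metis inv_closed inv_mult_group inv_inv m_closed r_inv)
    then show ?thesis using o(8) that by simp
  qed
  \<comment> \<open>Passing from the base point \<open>p g\<close> to \<open>p h\<close> changes the
    position of \<open>x\<close> relative to the base point by
    \<open>inv h \<otimes> g\<close>.\<close>
  have mv: "act (inv h) x = act (inv h \<otimes> g) (act (inv g) x)"
    if "g \<in> carrier G" "h \<in> carrier G" "x \<in> M" for g h x
    using a(3)[of "act (inv g) x" "inv h \<otimes> g" "inv g"] a(3)[of x "inv h \<otimes> g" "inv g"] that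
    by (simp add: m_assoc)
  have 1: "d x z \<le> d x y + d y z"
    if "x \<in> M \<union> p ` carrier G" "y \<in> M \<union> p ` carrier G" "z \<in> M \<union> p ` carrier G" for x y z
  proof -
    have t1: "d x z \<le> d x (p g) + d (p g) z" if "x \<in> M" "z \<in> M" "g \<in> carrier G" for x z g
    proof -
      have "d x z = d (act (inv g) x) (act (inv g) z)" using a(4) that by simp
      also have "\<dots> \<le> w (act (inv g) x) + w (act (inv g) z)" using o(4) invact that by simp
      finally show ?thesis using dp that by simp
    qed
    have t2: "w (act (inv g) x) \<le> w (act (inv g) y) + d x y" if "x \<in> M" "y \<in> M" "g \<in> carrier G" for x y g
    proof -
      have "d x y = d (act (inv g) x) (act (inv g) y)" using a(4) that by simp
      then show ?thesis using o(3) invact that by simp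
    qed
    have t3: "w (act (inv h) x) \<le> w (act (inv g) x) + c (inv h \<otimes> g)"
      if "g \<in> carrier G" "h \<in> carrier G" "x \<in> M" for g h x
      using mv[OF that] o(9)[of "inv h \<otimes> g" "act (inv g) x"] invact that by simp
    have t4: "c (inv h \<otimes> g) \<le> w (act (inv g) x) + w (act (inv h) x)"
      if "g \<in> carrier G" "h \<in> carrier G" "x \<in> M" for g h x
      using mv[OF that] o(10)[of "inv h \<otimes> g" "act (inv g) x"] invact that by simp
    have t5: "c (inv g \<otimes> k) \<le> c (inv g \<otimes> h) + c (inv h \<otimes> k)"
      if "g \<in> carrier G" "h \<in> carrier G" "k \<in> carrier G" for g h k
    proof -
      have "inv g \<otimes> k = (inv g \<otimes> h) \<otimes> (inv h \<otimes> k)"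
        using that by (simp add: m_assoc inv_solve_left inv_solve_left' flip: m_assoc[of h "inv h" k])
      then show ?thesis using o(7)[of "inv g \<otimes> h" "inv h \<otimes> k"] that by simp
    qed
    from that show ?thesis
    proof (elim UnE imageE)
      assume "x \<in> M" "y \<in> M" "z \<in> M" then show ?thesis using m(4) by blast
    next
      fix g assume "x \<in> M" "y \<in> M" "z = p g" "g \<in> carrier G"
      then show ?thesis using t2[of x y g] dp by simp
    next
      fix g assume "x \<in> M" "y = p g" "z \<in> M" "g \<in> carrier G"
      then show ?thesis using t1 by simp
    next
      fix g h assume "x \<in> M" "y = p g" "z = p h" "g \<in> carrier G" "h \<in> carrier G"
      then show ?thesis using t3[of g h x] dp c_sym by simp
    next
      fix g assume "x = p g" "y \<in> M" "z \<in> M" "g \<in> carrier G"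
      then show ?thesis using t2[of z y g] dp m(2)[of y z] by simp
    next
      fix g h assume "x = p g" "y \<in> M" "z = p h" "g \<in> carrier G" "h \<in> carrier G"
      then show ?thesis using t4[of h g y] dp by simp
    next
      fix g h assume "x = p g" "y = p h" "z \<in> M" "g \<in> carrier G" "h \<in> carrier G"
      then show ?thesis using t3[of h g z] dp by simp
    next
      fix g h k assume "x = p g" "y = p h" "z = p k" "g \<in> carrier G" "h \<in> carrier G" "k \<in> carrier G"
      then show ?thesis using t5 dp by simp
    qed
  qed
  have 2: "d x y \<in> S \<and> d x y = d y x \<and> (d x y = 0 \<longleftrightarrow> x = y)"
    if "x \<in> M \<union> p ` carrier G" "y \<in> M \<union> p ` carrier G" for x y
  proof -
    have t1: "w (act (inv g) x) \<in> S \<and> w (act (inv g) x) \<noteq> 0" if "x \<in> M" "g \<in> carrier G" for x g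
      using o(1,2) invact that by force
    have t2: "c (inv g \<otimes> h) \<in> S \<and> (c (inv g \<otimes> h) = 0 \<longleftrightarrow> g = h)"
      if "g \<in> carrier G" "h \<in> carrier G" for g h
      using o(5)[of "inv g \<otimes> h"] o(6)[of "inv g \<otimes> h"] that
      by (metis inv_closed inv_equality inv_inv l_inv m_closed)
    from that show ?thesis
    proof (elim UnE imageE)
      assume "x \<in> M" "y \<in> M" then show ?thesis using m by blast
    next
      fix g assume "x \<in> M" "y = p g" "g \<in> carrier G"
      then show ?thesis using t1 dp pM by simp
    next
      fix g assume "x = p g" "y \<in> M" "g \<in> carrier G"
      then show ?thesis using t1 dp pM by simp
    next
      fix g h assume "x = p g" "y = p h" "g \<in> carrier G" "h \<in> carrier G"
      then show ?thesis using t2 c_sym dp pp by simp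
    qed
  qed
  show "S_metric_on S (M \<union> p ` carrier G) d"
    unfolding S_metric_on_def using 1 2 by blast
  have 3: "d (act g x) (act g y) = d x y"
    if "x \<in> M \<union> p ` carrier G" "y \<in> M \<union> p ` carrier G" and g: "g \<in> carrier G" for x y g
  proof -
    have t1: "act (inv (g \<otimes> k)) (act g x) = act (inv k) x" if "x \<in> M" "k \<in> carrier G" for x k
    proof -
      have "inv k = inv (g \<otimes> k) \<otimes> g" using that g by (simp add: inv_mult_group m_assoc)
      then show ?thesis using a(3)[of x "inv (g \<otimes> k)" g] that g by simp
    qed
    have t2: "inv (g \<otimes> k) \<otimes> (g \<otimes> h) = inv k \<otimes> h" if "k \<in> carrier G" "h \<in> carrier G" for k h
    proof -
      have "inv (g \<otimes> k) \<otimes> (g \<otimes> h) = inv k \<otimes> (inv g \<otimes> (g \<otimes> h))"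
        using that g by (simp add: inv_mult_group m_assoc)
      also have "inv g \<otimes> (g \<otimes> h) = h" using that g by (simp flip: m_assoc)
      finally show ?thesis .
    qed
    from that show ?thesis
    proof (elim UnE imageE)
      assume "x \<in> M" "y \<in> M" then show ?thesis using a(4) g by blast
    next
      fix k assume "x \<in> M" "y = p k" "k \<in> carrier G"
      then show ?thesis using t1 dp act_p a(2) g by simp
    next
      fix k assume "x = p k" "y \<in> M" "k \<in> carrier G"
      then show ?thesis using t1 dp act_p a(2) g by simp
    next
      fix k h assume "x = p k" "y = p h" "k \<in> carrier G" "h \<in> carrier G"
      then show ?thesis using t2 dp act_p g by simp
    qed
  qed
  show "isometric_on G (carrier G) (M \<union> p ` carrier G) act d"
    unfolding isometric_on_def
  proof (intro conjI ballI)
    show "act \<one> x = x" if "x \<in> M \<union> p ` carrier G" for x using that a(1) act_p by auto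
    fix g x assume g: "g \<in> carrier G" and x: "x \<in> M \<union> p ` carrier G"
    show "act g x \<in> M \<union> p ` carrier G" using g x a(2) act_p by auto
    show "act (g \<otimes> h) x = act g (act h x)" if "h \<in> carrier G" for h
      using g x a(3) act_p that by (auto simp: m_assoc)
    show "d (act g x) (act g y) = d x y" if "y \<in> M \<union> p ` carrier G" for y using 3 g x that by blast
  qed
qed

section \<open>A generic metric space with a free action\<close>

text \<open>The Rasiowa-Sikorski argument for countably many dense sets. It is applied three times:
  to metrics on a space with an action, to finite partial isometries and to finite partial
  actions.\<close>

lemma generic_chain:
  fixes le :: "'q \<Rightarrow> 'q \<Rightarrow> bool"
  assumes "countable I" and refl: "\<And>q. le q q"
    and trans: "\<And>p q r. le p q \<Longrightarrow> le q r \<Longrightarrow> le p r"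
    and "p0 \<in> Q"
    and dense: "\<And>i p. i \<in> I \<Longrightarrow> p \<in> Q \<Longrightarrow> \<exists>q\<in>Q. le p q \<and> R i q"
  obtains f :: "nat \<Rightarrow> 'q" where "\<And>n. f n \<in> Q" "\<And>n. le p0 (f n)"
    "\<And>m n. m \<le> n \<Longrightarrow> le (f m) (f n)" "\<And>i. i \<in> I \<Longrightarrow> \<exists>n. R i (f n)"
proof -
  have "\<exists>f. \<forall>n. (f n \<in> Q \<and> le p0 (f n)) \<and>
      (le (f n) (f (Suc n)) \<and> (I \<noteq> {} \<longrightarrow> R (from_nat_into I n) (f (Suc n))))"
  proof (rule dependent_nat_choice)
    show "\<exists>x. x \<in> Q \<and> le p0 x" using assms by blast
    fix x n assume x: "x \<in> Q \<and> le p0 x"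
    show "\<exists>y. (y \<in> Q \<and> le p0 y) \<and> (le x y \<and> (I \<noteq> {} \<longrightarrow> R (from_nat_into I n) y))"
    proof (cases "I = {}")
      case False
      then show ?thesis using dense[OF from_nat_into[OF False]] x trans by meson
    qed (use x refl in blast)
  qed
  then obtain f where f: "\<And>n. f n \<in> Q" "\<And>n. le p0 (f n)" "\<And>n. le (f n) (f (Suc n))"
    "\<And>n. I \<noteq> {} \<Longrightarrow> R (from_nat_into I n) (f (Suc n))"
    by blast
  have "le (f m) (f n)" if "m \<le> n" for m n
    using that by (induction rule: dec_induct) (use refl trans f(3) in blast)+
  moreover have "\<exists>n. R i (f n)" if "i \<in> I" for i
    using that f(4) from_nat_into_surj[OF assms(1) that] by blast
  ultimately show thesis using that f by blast
qed

lemma finite_subset_chain: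
  fixes N :: "nat \<Rightarrow> 'x set"
  assumes "\<And>i j. i \<le> j \<Longrightarrow> N i \<subseteq> N j" "finite F" "F \<subseteq> (\<Union>i. N i)"
  shows "\<exists>i. F \<subseteq> N i"
  using assms(2,3)
proof (induction F)
  case (insert x F)
  then obtain i k where "F \<subseteq> N i" "x \<in> N k" by auto
  then have "insert x F \<subseteq> N (max i k)" using assms(1)[of i "max i k"] assms(1)[of k "max i k"] by auto
  then show ?case by blast
qed auto

lemma isometric_on_cong:
  assumes "isometric_on G H M act d" "\<And>g x. g \<in> H \<Longrightarrow> x \<in> M \<Longrightarrow> act g x \<in> M"
    "\<And>x y. x \<in> M \<Longrightarrow> y \<in> M \<Longrightarrow> d' x y = d x y"
  shows "isometric_on G H M act d'"
  using assms unfolding isometric_on_def by simp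

lemma S_metric_on_cong:
  assumes "S_metric_on S M d" "\<And>x y. x \<in> M \<Longrightarrow> y \<in> M \<Longrightarrow> d' x y = d x y"
  shows "S_metric_on S M d'"
  using assms unfolding S_metric_on_def by simp

lemma orbit_data_cong:
  assumes "\<And>x y. x \<in> M \<Longrightarrow> y \<in> M \<Longrightarrow> d' x y = d x y"
    "\<And>x. x \<in> M \<Longrightarrow> w' x = w x" "\<And>g. g \<in> H \<Longrightarrow> c' g = c g"
    "\<And>g x. g \<in> H \<Longrightarrow> x \<in> M \<Longrightarrow> act g x \<in> M" "\<And>g h. g \<in> H \<Longrightarrow> h \<in> H \<Longrightarrow> g \<otimes>\<^bsub>G\<^esub> h \<in> H"
  shows "orbit_data G S H M act d' w' c' \<longleftrightarrow> orbit_data G S H M act d w c"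
  using assms unfolding orbit_data_def by simp

text \<open>The equivariant extension property. For trivial \<open>H\<close> it is the one-point
  extension property of the Urysohn space; general finite \<open>H\<close> is what lets the second
  factor act on new points while agreeing with the first on the amalgamated subgroup.\<close>

definition orbit_extension ::
  "('g, 'm) monoid_scheme \<Rightarrow> real set \<Rightarrow> 'x set \<Rightarrow> ('g \<Rightarrow> 'x \<Rightarrow> 'x) \<Rightarrow> ('x \<Rightarrow> 'x \<Rightarrow> real) \<Rightarrow> bool"
where
  "orbit_extension G S M act d \<longleftrightarrow>
     (\<forall>H F w c. subgroup H G \<and> finite H \<and> finite F \<and> F \<subseteq> M \<and>
        (\<forall>h\<in>H. \<forall>x\<in>F. act h x \<in> F) \<and> orbit_data G S H F act d w c \<longrightarrow>
        (\<exists>p\<in>M. (\<forall>x\<in>F. d p x = w x) \<and> (\<forall>h\<in>H. d p (act h p) = c h)))"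

lemma orbit_extensionE:
  assumes "orbit_extension G S M act d" "subgroup H G" "finite H" "finite F" "F \<subseteq> M"
    "\<And>h x. h \<in> H \<Longrightarrow> x \<in> F \<Longrightarrow> act h x \<in> F" "orbit_data G S H F act d w c"
  obtains p where "p \<in> M" "\<And>x. x \<in> F \<Longrightarrow> d p x = w x" "\<And>h. h \<in> H \<Longrightarrow> d p (act h p) = c h"
proof -
  have "\<exists>p\<in>M. (\<forall>x\<in>F. d p x = w x) \<and> (\<forall>h\<in>H. d p (act h p) = c h)"
    using assms unfolding orbit_extension_def by blast
  then show thesis using that by blast
qed

text \<open>The point set is fixed in advance: \<open>Inl\<close> holds the given free action on
  \<open>P\<close>, and \<open>Inr (h, n)\<close> is the translate by \<open>h\<close> of the base
  point of the \<open>n\<close>-th adjoined orbit. Only the metric is constructed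
  generically.\<close>

lemma generic_space:
  fixes G :: "('a, 'm) monoid_scheme" (structure) and P :: "'p set"
  assumes S: "distance_set S" and G: "group G" and "countable (carrier G)" and "countable P"
    and pact: "\<And>p. p \<in> P \<Longrightarrow> pact \<one> p = p"
      "\<And>g p. g \<in> carrier G \<Longrightarrow> p \<in> P \<Longrightarrow> pact g p \<in> P"
      "\<And>g h p. g \<in> carrier G \<Longrightarrow> h \<in> carrier G \<Longrightarrow> p \<in> P \<Longrightarrow> pact (g \<otimes> h) p = pact g (pact h p)"
      "\<And>g p. g \<in> carrier G \<Longrightarrow> p \<in> P \<Longrightarrow> pact g p = p \<Longrightarrow> g = \<one>"
  obtains V :: "('p + 'a \<times> nat) set" and act D where
    "countable V" "Inl ` P \<subseteq> V" "S_metric_on S V D" "isometric_on G (carrier G) V act D"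
    "\<And>g p. p \<in> P \<Longrightarrow> act g (Inl p) = Inl (pact g p)"
    "\<And>g x. g \<in> carrier G \<Longrightarrow> x \<in> V \<Longrightarrow> act g x = x \<Longrightarrow> g = \<one>"
    "\<And>x y. x \<in> V \<Longrightarrow> y \<in> V \<Longrightarrow> finite {g \<in> carrier G. D (act g x) y < 1}"
    "\<And>p q. p \<in> P \<Longrightarrow> q \<in> P \<Longrightarrow> p \<noteq> q \<Longrightarrow> D (Inl p) (Inl q) = 1"
    "\<And>x. x \<in> V \<Longrightarrow> finite {p \<in> P. D x (Inl p) < 1}"
    "orbit_extension G S V act D"
proof -
  interpret group G by fact
  note S' = distance_setD[OF S]
  define act :: "'a \<Rightarrow> 'p + 'a \<times> nat \<Rightarrow> 'p + 'a \<times> nat" where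
    "act g x = (case x of Inl p \<Rightarrow> Inl (pact g p) | Inr (h, n) \<Rightarrow> Inr (g \<otimes> h, n))" for g x
  have act_simps [simp]: "act g (Inl p) = Inl (pact g p)" "act g (Inr (h, n)) = Inr (g \<otimes> h, n)" for g p h n
    by (auto simp: act_def)
  define V :: "nat \<Rightarrow> ('p + 'a \<times> nat) set" where "V n = Inl ` P \<union> Inr ` (carrier G \<times> {..<n})" for n
  define V' :: "('p + 'a \<times> nat) set" where "V' = Inl ` P \<union> Inr ` (carrier G \<times> UNIV)"
  have XX': "V n \<subseteq> V'" for n by (auto simp: V_def V'_def)
  have X_mono: "V m \<subseteq> V n" if "m \<le> n" for m n using that by (auto simp: V_def)
  have X_Suc: "V (Suc n) = V n \<union> (\<lambda>g. Inr (g, n)) ` carrier G" for n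
    by (auto simp: V_def less_Suc_eq)
  have cX': "countable V'" unfolding V'_def using assms(3,4) by (intro countable_Un countable_image) auto
  have act_in: "act g x \<in> V n" if "g \<in> carrier G" "x \<in> V n" for g x n
    using that pact(2) by (auto simp: V_def)
  have act_one: "act \<one> x = x" if "x \<in> V'" for x using that pact(1) by (auto simp: V'_def)
  have act_mult: "act (g \<otimes> h) x = act g (act h x)"
    if "g \<in> carrier G" "h \<in> carrier G" "x \<in> V'" for g h x
    using that pact(3) by (auto simp: V'_def m_assoc)
  have act_free: "g = \<one>" if "g \<in> carrier G" "x \<in> V'" "act g x = x" for g x
    using that pact(4) by (auto simp: V'_def)
  have act_inX': "act g x \<in> V'" if "g \<in> carrier G" "x \<in> V'" for g x
    using that pact(2) by (auto simp: V'_def)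
  have act_inj: "g = h" if "g \<in> carrier G" "h \<in> carrier G" "x \<in> V'" "act g x = act h x" for g h x
  proof -
    have "act (inv h \<otimes> g) x = act (inv h) (act g x)" using act_mult that by simp
    also have "\<dots> = act (inv h) (act h x)" using that by simp
    also have "\<dots> = act (inv h \<otimes> h) x" using act_mult[of "inv h" h x] that by simp
    also have "\<dots> = x" using act_one that by simp
    finally have "inv h \<otimes> g = \<one>" using act_free that by simp
    then show ?thesis using that by (metis inv_closed inv_equality inv_inv)
  qed
  have act_inj': "inj_on (act g) V'" if "g \<in> carrier G" for g
  proof (rule inj_on_inverseI)
    show "act (inv g) (act g x) = x" if "x \<in> V'" for x
      using act_mult[of "inv g" g x] act_one[of x] that \<open>g \<in> carrier G\<close> by simp
  qed
  have fin_orbit: "finite {g \<in> carrier G. act g x \<in> B}" if "finite B" "x \<in> V'" for x B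
  proof (rule finite_subset)
    have "inj_on (\<lambda>g. act g x) (carrier G)" using act_inj that by (intro inj_onI) blast
    then show "finite ((\<lambda>g. act g x) -` B \<inter> carrier G)" using that(1) finite_vimage_IntI by blast
  qed auto
  \<comment> \<open>A condition is a metric on \<open>P\<close> and the first \<open>n\<close>
    orbits. Finiteness of the open unit balls is the invariant that makes the extension lemmas
    applicable and that, with freeness, leaves only finitely many \<open>g\<close> with
    \<open>D (act g x) y < 1\<close> at the end.\<close>
  define Q where "Q = {(n, d). S_metric_on S (V n) d \<and> isometric_on G (carrier G) (V n) act d \<and>
      (\<forall>y\<in>V n. finite {x \<in> V n. d y x < 1}) \<and> (\<forall>p\<in>P. \<forall>q\<in>P. p \<noteq> q \<longrightarrow> d (Inl p) (Inl q) = 1)}"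
  define le where "le = (\<lambda>(n, d) (n', d' :: _ \<Rightarrow> _ \<Rightarrow> real). n \<le> (n'::nat) \<and> (\<forall>x\<in>V n. \<forall>y\<in>V n. d' x y = d x y))"
  have le_refl: "le q q" for q by (auto simp: le_def)
  have le_trans: "le p r" if "le p q" "le q r" for p q r
  proof -
    obtain a u b v c w where [simp]: "p = (a, u)" "q = (b, v)" "r = (c, w)" by (metis surj_pair)
    have *: "V a \<subseteq> V b" "a \<le> c" using that X_mono by (auto simp: le_def)
    have "w x y = u x y" if "x \<in> V a" "y \<in> V a" for x y
      using that * \<open>le p q\<close> \<open>le q r\<close> by (auto simp: le_def subset_iff)
    then show ?thesis using * by (simp add: le_def)
  qed
  have QD: "S_metric_on S (V n) d" "isometric_on G (carrier G) (V n) act d"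
      "\<And>y. y \<in> V n \<Longrightarrow> finite {x \<in> V n. d y x < 1}"
      "\<And>p q. p \<in> P \<Longrightarrow> q \<in> P \<Longrightarrow> p \<noteq> q \<Longrightarrow> d (Inl p) (Inl q) = 1"
    if "(n, d) \<in> Q" for n d using that by (auto simp: Q_def)

  have step: "\<exists>d'. (Suc n, d') \<in> Q \<and> le (n, d) (Suc n, d') \<and>
      (\<exists>x\<in>V (Suc n). (\<forall>y\<in>V n. d' x y = w y) \<and> (\<forall>g\<in>carrier G. d' x (act g x) = c g))"
    if q: "(n, d) \<in> Q" and D: "orbit_data G S (carrier G) (V n) act d w c"
      and fw: "finite {x \<in> V n. w x < 1}" and fc: "finite {g \<in> carrier G. c g < 1}" for n d w c
  proof -
    \<comment> \<open>\<open>gp\<close> reads off the group element of a new point;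
      \<open>d'\<close> is then the only invariant extension of \<open>d\<close> with the prescribed
      \<open>w\<close> and \<open>c\<close>.\<close>
    define gp :: "'p + 'a \<times> nat \<Rightarrow> 'a" where "gp x = fst (projr x)" for x
    define d' where "d' x y = (if x \<in> V n then (if y \<in> V n then d x y else w (act (inv (gp y)) x))
      else if y \<in> V n then w (act (inv (gp x)) y) else c (inv (gp x) \<otimes> gp y))" for x y
    define p :: "'a \<Rightarrow> 'p + 'a \<times> nat" where "p g = Inr (g, n)" for g
    have pX: "p g \<notin> V n" for g by (auto simp: p_def V_def)
    have gp: "gp (p g) = g" for g by (simp add: gp_def p_def)
    have XS: "V (Suc n) = V n \<union> p ` carrier G" by (auto simp: X_Suc p_def)
    have d'd: "d' x y = d x y" if "x \<in> V n" "y \<in> V n" for x y using that by (simp add: d'_def)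
    have d'1: "d' (p g) x = w (act (inv g) x)" "d' x (p g) = w (act (inv g) x)" if "x \<in> V n" for g x
      using that pX gp by (auto simp: d'_def)
    have d'2: "d' (p g) (p h) = c (inv g \<otimes> h)" for g h using pX gp by (simp add: d'_def)
    have act_p: "act g (p h) = p (g \<otimes> h)" for g h by (simp add: p_def)
    have m: "S_metric_on S (V n) d'" using S_metric_on_cong[OF QD(1)[OF q]] d'd by blast
    have i: "isometric_on G (carrier G) (V n) act d'"
      using isometric_on_cong[OF QD(2)[OF q]] d'd act_in by blast
    have o: "orbit_data G S (carrier G) (V n) act d' w c"
      using D by (subst orbit_data_cong) (use d'd act_in in auto)
    note ao = adjoin_orbit[OF S G m i o, of p, OF _ pX act_p d'1 d'2, folded XS]
    have "inj_on p (carrier G)" by (auto simp: p_def inj_on_def)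
    note ao = ao[OF this]
    have "finite {x \<in> V (Suc n). d' y x < 1}" if y: "y \<in> V (Suc n)" for y
    proof (cases "y \<in> V n")
      case True
      \<comment> \<open>New points near an old point \<open>y\<close> are the \<open>p g\<close>
        with \<open>w (act (inv g) y) < 1\<close>; by freeness only finitely many elements move
        \<open>y\<close> into the finite set where \<open>w\<close> is below
        \<open>1\<close>.\<close>
      have "finite {g \<in> carrier G. act g y \<in> {x \<in> V n. w x < 1}}"
        using fin_orbit[OF fw] True XX' by blast
      then have "finite (p ` (\<lambda>g. inv g) ` {g \<in> carrier G. act g y \<in> {x \<in> V n. w x < 1}})" by blast
      moreover have "{x \<in> V (Suc n). d' y x < 1} \<subseteq>
        {x \<in> V n. d y x < 1} \<union> p ` (\<lambda>g. inv g) ` {g \<in> carrier G. act g y \<in> {x \<in> V n. w x < 1}}"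
      proof
        fix x assume x: "x \<in> {x \<in> V (Suc n). d' y x < 1}"
        show "x \<in> {x \<in> V n. d y x < 1} \<union> p ` (\<lambda>g. inv g) ` {g \<in> carrier G. act g y \<in> {x \<in> V n. w x < 1}}"
        proof (cases "x \<in> V n")
          case False
          then obtain g where g: "g \<in> carrier G" "x = p g" using x XS by auto
          then have "x = p (inv (inv g))" "inv g \<in> {g \<in> carrier G. act g y \<in> {x \<in> V n. w x < 1}}"
            using x d'1 True act_in by auto
          then show ?thesis by blast
        qed (use x True d'd in auto)
      qed
      ultimately show ?thesis using QD(3)[OF q True] finite_subset by blast
    next
      case False
      then obtain g where g: "g \<in> carrier G" "y = p g" using y XS by auto
      have "finite (act (inv g) -` {x \<in> V n. w x < 1} \<inter> V n)"
        using g act_inj'[of "inv g"] XX' by (intro finite_vimage_IntI fw) (auto intro: inj_on_subset)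
      moreover have "finite (p ` (\<lambda>h. g \<otimes> h) ` {h \<in> carrier G. c h < 1})" using fc by blast
      moreover have "{x \<in> V (Suc n). d' y x < 1} \<subseteq>
        (act (inv g) -` {x \<in> V n. w x < 1} \<inter> V n) \<union> p ` (\<lambda>h. g \<otimes> h) ` {h \<in> carrier G. c h < 1}"
      proof
        fix x assume x: "x \<in> {x \<in> V (Suc n). d' y x < 1}"
        show "x \<in> (act (inv g) -` {x \<in> V n. w x < 1} \<inter> V n) \<union> p ` (\<lambda>h. g \<otimes> h) ` {h \<in> carrier G. c h < 1}"
        proof (cases "x \<in> V n")
          case False
          then obtain k where k: "k \<in> carrier G" "x = p k" using x XS by auto
          have "x = p (g \<otimes> (inv g \<otimes> k))" using g k by (simp flip: m_assoc)
          moreover have "inv g \<otimes> k \<in> {h \<in> carrier G. c h < 1}" using x g k d'2 by auto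
          ultimately show ?thesis by blast
        qed (use x g d'1 act_in in auto)
      qed
      ultimately show ?thesis using finite_subset by blast
    qed
    moreover have "d' (Inl p) (Inl q) = 1" if "p \<in> P" "q \<in> P" "p \<noteq> q" for p q
      using that QD(4)[OF q] d'd by (auto simp: V_def)
    ultimately have "(Suc n, d') \<in> Q" unfolding Q_def using ao by blast
    moreover have "le (n, d) (Suc n, d')" by (auto simp: le_def d'd)
    moreover have "\<exists>x\<in>V (Suc n). (\<forall>y\<in>V n. d' x y = w y) \<and> (\<forall>g\<in>carrier G. d' x (act g x) = c g)"
      by (rule bexI[of _ "p \<one>"])
        (use d'1 d'2 act_p act_one XX' XS in \<open>auto simp: subset_iff\<close>)
    ultimately show ?thesis by blast
  qed

  \<comment> \<open>A task may mention orbits that have not been adjoined yet. These are filled in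
    with all new distances between distinct points equal to \<open>1\<close>.\<close>
  have raise: "\<exists>d'. (m + n, d') \<in> Q \<and> le (n, d) (m + n, d')" if "(n, d) \<in> Q" for n d m
  proof (induction m)
    case 0
    then show ?case using that le_refl by auto
  next
    case (Suc m)
    then obtain d' where d': "(m + n, d') \<in> Q" "le (n, d) (m + n, d')" by blast
    define c where "c g = (if g = \<one> then 0 else 1 :: real)" for g
    have d'01: "0 \<le> d' x y" "d' x y \<le> 1" if "x \<in> V (m + n)" "y \<in> V (m + n)" for x y
      using S_metric_onD(1)[OF QD(1)[OF d'(1)] that] S' by auto
    have "orbit_data G S (carrier G) (V (m + n)) act d' (\<lambda>x. 1) c"
      unfolding orbit_data_def
    proof (intro conjI ballI impI)
      fix g h assume gh: "g \<in> carrier G" "h \<in> carrier G"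
      show "c (g \<otimes> h) \<le> c g + c h" using gh by (simp add: c_def)
      assume "g \<otimes> h = \<one>"
      then have "g = \<one> \<longleftrightarrow> h = \<one>" using gh by auto
      then show "c g = c h" by (simp add: c_def)
    qed (use S' in \<open>auto simp: c_def add_increasing add_increasing2 d'01 intro: order_trans[OF d'01(2)]\<close>)
    moreover have "finite {g \<in> carrier G. c g < 1}"
      by (rule finite_subset[of _ "{\<one>}"]) (auto simp: c_def)
    ultimately have "\<exists>d''. (Suc (m + n), d'') \<in> Q \<and> le (m + n, d') (Suc (m + n), d'')"
      using step[OF d'(1), of "\<lambda>x. 1" c] by auto
    then show ?case using d' le_trans by auto
  qed

  \<comment> \<open>The tasks range over all of \<open>V'\<close>. Whether \<open>w\<close> and
    \<open>c\<close> are consistent depends on the metric, so consistency is a premise inside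
    \<open>R\<close>. In any case \<open>R\<close> asks for \<open>F \<subseteq> V n\<close>, so
    that the metric on \<open>F\<close> is final when consistency is tested. Taking extensional
    functions makes the tasks countable in number.\<close>
  define I where "I = (SIGMA (F, H) : {F. finite F \<and> F \<subseteq> V'} \<times> {H. finite H \<and> H \<subseteq> carrier G}.
    (F \<rightarrow>\<^sub>E S) \<times> (H \<rightarrow>\<^sub>E S))"
  have cI: "countable I"
    unfolding I_def using cX' assms(3) S'(1)
    by (intro countable_SIGMA countable_Collect_finite_subset) (auto intro!: countable_SIGMA countable_PiE)
  define R where "R = (\<lambda>((F, H), w, c) (n, d). F \<subseteq> V n \<and>
    (subgroup H G \<and> (\<forall>h\<in>H. \<forall>x\<in>F. act h x \<in> F) \<and> orbit_data G S H F act d w c \<longrightarrow>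
      (\<exists>p\<in>V n. (\<forall>x\<in>F. d p x = w x) \<and> (\<forall>h\<in>H. d p (act h p) = c h))))"
  have dense: "\<exists>q\<in>Q. le p q \<and> R i q" if i: "i \<in> I" and p: "p \<in> Q" for i p
  proof -
    obtain F H w0 c0 n d where [simp]: "i = ((F, H), w0, c0)" "p = (n, d)" by (metis surj_pair)
    have F: "finite F" "F \<subseteq> V'" and fH: "finite H" using i by (auto simp: I_def)
    have "V' = (\<Union>n. V n)" by (auto simp: V_def V'_def)
    then obtain m where m: "F \<subseteq> V m" using finite_subset_chain[of V F, OF X_mono F(1)] F(2) by auto
    obtain d1 where d1: "(m + n, d1) \<in> Q" "le p (m + n, d1)" using raise[of n d m] p by auto
    have FV: "F \<subseteq> V (m + n)" using m X_mono[of m "m + n"] by auto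
    show ?thesis
    proof (cases "subgroup H G \<and> (\<forall>h\<in>H. \<forall>x\<in>F. act h x \<in> F) \<and> orbit_data G S H F act d1 w0 c0")
      case False
      then have "R i (m + n, d1)" using FV by (auto simp: R_def)
      then show ?thesis using d1 by blast
    next
      case True
      then have H: "subgroup H G" and inva: "\<And>h f. h \<in> H \<Longrightarrow> f \<in> F \<Longrightarrow> act h f \<in> F"
        and D: "orbit_data G S H F act d1 w0 c0" by auto
      interpret H: subgroup H G by fact
      have iH: "isometric_on G H (V (m + n)) act d1"
        using act_in H.subset by (intro isometric_on_subset[OF QD(2)[OF d1(1)] subset_refl H.subset]) blast
      obtain w where w: "orbit_data G S H (V (m + n)) act d1 w c0" "\<And>x. x \<in> F \<Longrightarrow> w x = w0 x"
        "finite {x \<in> V (m + n). w x < 1}"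
        by (rule orbit_data_extend_space[OF S G H QD(1)[OF d1(1)] iH F(1) FV inva D
          QD(3)[OF d1(1)]]) (assumption | rule that)+
      obtain c where c: "orbit_data G S (carrier G) (V (m + n)) act d1 w c" "\<And>h. h \<in> H \<Longrightarrow> c h = c0 h"
        "\<And>g. g \<in> carrier G \<Longrightarrow> c g < 1 \<Longrightarrow> g \<in> H \<or> (\<exists>z\<in>V (m + n). w z < 1 \<and> w (act g z) < 1)"
        by (rule orbit_data_extend_group[OF S G H QD(1,2)[OF d1(1)] w(1,3)]) (assumption | rule that)+
      \<comment> \<open>If \<open>c g < 1\<close>, then \<open>g\<close> lies in \<open>H\<close> or
        maps some point of \<open>B\<close> into \<open>B\<close>. Both leave finitely many
        \<open>g\<close>, the latter by freeness.\<close>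
      define B where "B = {x \<in> V (m + n). w x < 1}"
      have "finite (H \<union> (\<Union>z\<in>B. {g \<in> carrier G. act g z \<in> B}))"
      proof (intro finite_UnI finite_UN_I fH)
        show "finite B" using w(3) by (simp add: B_def)
        then show "finite {g \<in> carrier G. act g z \<in> B}" if "z \<in> B" for z
          using fin_orbit[of B z] XX'[of "m + n"] that unfolding B_def by blast
      qed
      moreover have "{g \<in> carrier G. c g < 1} \<subseteq> H \<union> (\<Union>z\<in>B. {g \<in> carrier G. act g z \<in> B})"
      proof
        fix g assume g: "g \<in> {g \<in> carrier G. c g < 1}"
        then consider "g \<in> H" | z where "z \<in> V (m + n)" "w z < 1" "w (act g z) < 1" using c(3) by blast
        then show "g \<in> H \<union> (\<Union>z\<in>B. {g \<in> carrier G. act g z \<in> B})"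
          by cases (use g act_in[of g _ "m + n"] in \<open>auto simp: B_def\<close>)
      qed
      ultimately have "finite {g \<in> carrier G. c g < 1}" by (rule finite_subset[rotated])
      note st = step[OF d1(1) c(1) w(3) this]
      then obtain d2 x where d2: "(Suc (m + n), d2) \<in> Q" "le (m + n, d1) (Suc (m + n), d2)"
        and x: "x \<in> V (Suc (m + n))" "\<forall>y\<in>V (m + n). d2 x y = w y"
          "\<forall>g\<in>carrier G. d2 x (act g x) = c g"
        by (elim exE conjE bexE) (rule that)
      have "\<exists>x\<in>V (Suc (m + n)). (\<forall>y\<in>F. d2 x y = w0 y) \<and> (\<forall>h\<in>H. d2 x (act h x) = c0 h)"
        using x(2,3) w(2) c(2) FV by (intro bexI[OF _ x(1)]) (auto simp: subset_iff)
      then have "R i (Suc (m + n), d2)"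
        using FV X_mono[of "m + n" "Suc (m + n)"] by (auto simp: R_def)
      then show ?thesis using d1 d2 le_trans by blast
    qed
  qed

  \<comment> \<open>The start is the discrete metric on the copy of \<open>P\<close>, which later
    stages never change.\<close>
  define d0 :: "('p + 'a \<times> nat) \<Rightarrow> ('p + 'a \<times> nat) \<Rightarrow> real" where "d0 x y = (if x = y then 0 else 1)" for x y
  have p0: "(0, d0) \<in> Q"
  proof -
    have "finite {x \<in> V 0. d0 y x < 1}" for y by (rule finite_subset[of _ "{y}"]) (auto simp: d0_def)
    moreover have "S_metric_on S (V 0) d0" using S' by (auto simp: S_metric_on_def d0_def)
    moreover have "isometric_on G (carrier G) (V 0) act d0"
      unfolding isometric_on_def d0_def
      using act_one act_in act_mult act_inj' XX' by (auto simp: inj_on_def subset_iff)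
    ultimately show ?thesis by (auto simp: Q_def d0_def)
  qed
  obtain f :: "nat \<Rightarrow> _" where f: "\<And>n. f n \<in> Q" "\<And>n. le (0, d0) (f n)"
    "\<And>m n. m \<le> n \<Longrightarrow> le (f m) (f n)" "\<And>i. i \<in> I \<Longrightarrow> \<exists>n. R i (f n)"
    by (rule generic_chain[OF cI le_refl le_trans p0 dense]) (assumption | rule that)+
  define N where "N i = V (fst (f i))" for i
  define e where "e i = snd (f i)" for i
  have q: "(fst (f i), e i) \<in> Q" for i using f(1) by (simp add: e_def)
  note Q1 = QD(1)[OF q, folded N_def] and Q2 = QD(2)[OF q, folded N_def]
    and Q3 = QD(3)[OF q, folded N_def] and Q4 = QD(4)[OF q, folded N_def]
  have N_mono: "N i \<subseteq> N j" if "i \<le> j" for i j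
    using f(3)[OF that] X_mono by (auto simp: N_def le_def split: prod.splits)
  have e_mono: "e j x y = e i x y" if "i \<le> j" "x \<in> N i" "y \<in> N i" for i j x y
    using f(3)[OF that(1)] that(2,3) by (auto simp: N_def e_def le_def split: prod.splits)
  define XX where "XX = (\<Union>i. N i)"
  define D where "D x y = e (LEAST i. x \<in> N i \<and> y \<in> N i) x y" for x y
  have De: "D x y = e i x y" if "x \<in> N i" "y \<in> N i" for x y i
  proof -
    have "x \<in> N (LEAST i. x \<in> N i \<and> y \<in> N i) \<and> y \<in> N (LEAST i. x \<in> N i \<and> y \<in> N i)"
      using LeastI[of "\<lambda>i. x \<in> N i \<and> y \<in> N i" i] that by blast
    moreover have "(LEAST i. x \<in> N i \<and> y \<in> N i) \<le> i" using that by (intro Least_le) blast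
    ultimately show ?thesis unfolding D_def using e_mono by simp
  qed
  have fin_N: "\<exists>i. F \<subseteq> N i" if "finite F" "F \<subseteq> XX" for F
    using finite_subset_chain[of N F, OF N_mono that(1)] that(2) by (simp add: XX_def)
  have act_N: "act g x \<in> N i" if "g \<in> carrier G" "x \<in> N i" for g x i
    using act_in that by (simp add: N_def)
  have XXX': "XX \<subseteq> V'" using XX' by (auto simp: XX_def N_def)
  show thesis
  proof (rule that[of XX D act])
    show "countable XX" using XXX' cX' countable_subset by blast
    show sub: "Inl ` P \<subseteq> XX" by (auto simp: XX_def N_def V_def)
    show "S_metric_on S XX D"
      unfolding S_metric_on_def
    proof (intro ballI)
      fix x y assume xy: "x \<in> XX" "y \<in> XX"
      have "D x z \<le> D x y + D y z" if z: "z \<in> XX" for z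
      proof -
        obtain i where "{x, y, z} \<subseteq> N i" using fin_N[of "{x, y, z}"] xy z by auto
        then show ?thesis using De[where i = i] S_metric_onD(4)[OF Q1[of i], of x y z] by simp
      qed
      moreover obtain i where "{x, y} \<subseteq> N i" using fin_N[of "{x, y}"] xy by auto
      then have "D x y \<in> S \<and> D x y = D y x \<and> (D x y = 0 \<longleftrightarrow> x = y)"
        using De[where i = i] S_metric_onD(1-3)[OF Q1[of i], of x y] by simp
      ultimately show "D x y \<in> S \<and> D x y = D y x \<and> (D x y = 0 \<longleftrightarrow> x = y) \<and>
          (\<forall>z\<in>XX. D x z \<le> D x y + D y z)" by blast
    qed
    show "isometric_on G (carrier G) XX act D"
      unfolding isometric_on_def
    proof (intro conjI ballI)
      show "act \<one> x = x" if "x \<in> XX" for x using act_one that XXX' by blast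
      fix g x assume g: "g \<in> carrier G" "x \<in> XX"
      show "act g x \<in> XX" using g act_N by (auto simp: XX_def)
      show "act (g \<otimes> h) x = act g (act h x)" if "h \<in> carrier G" for h
        using act_mult g that XXX' by blast
      show "D (act g x) (act g y) = D x y" if y: "y \<in> XX" for y
      proof -
        obtain i where i: "{x, y} \<subseteq> N i" using fin_N[of "{x, y}"] g y by auto
        then show ?thesis using isometric_onD(4)[OF Q2[of i], of x g y] act_N[OF g(1)] De[where i = i] g by simp
      qed
    qed
    show "act g (Inl p) = Inl (pact g p)" if "p \<in> P" for g p by simp
    show "g = \<one>" if "g \<in> carrier G" "x \<in> XX" "act g x = x" for g x
      using act_free that XXX' by blast
    show "finite {g \<in> carrier G. D (act g x) y < 1}" if xy: "x \<in> XX" "y \<in> XX" for x y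
    proof -
      obtain i where i: "{x, y} \<subseteq> N i" using fin_N[of "{x, y}"] xy by auto
      have "finite {g \<in> carrier G. act g x \<in> {x \<in> N i. e i y x < 1}}"
        using i xy XXX' by (intro fin_orbit Q3) auto
      moreover have "{g \<in> carrier G. D (act g x) y < 1} \<subseteq> {g \<in> carrier G. act g x \<in> {x \<in> N i. e i y x < 1}}"
        using act_N i De[where i = i] S_metric_onD(2)[OF Q1] by fastforce
      ultimately show ?thesis using finite_subset by blast
    qed
    show "D (Inl p) (Inl q) = 1" if "p \<in> P" "q \<in> P" "p \<noteq> q" for p q
    proof -
      have "Inl p \<in> N 0" "Inl q \<in> N 0" using that by (auto simp: N_def V_def)
      then show ?thesis using De[where i = 0] Q4[of p q 0] that by simp
    qed
    show "finite {p \<in> P. D x (Inl p) < 1}" if x: "x \<in> XX" for x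
    proof -
      obtain i where i: "x \<in> N i" using x by (auto simp: XX_def)
      have "Inl p \<in> N i" if "p \<in> P" for p using that by (auto simp: N_def V_def)
      then have "Inl ` {p \<in> P. D x (Inl p) < 1} \<subseteq> {y \<in> N i. e i x y < 1}" using De[where i = i] i by auto
      then have "finite (Inl ` {p \<in> P. D x (Inl p) < 1} :: ('p + 'a \<times> nat) set)"
        using Q3[OF i] finite_subset by blast
      then show ?thesis by (rule finite_imageD) auto
    qed
    show "orbit_extension G S XX act D"
      unfolding orbit_extension_def
    proof (intro allI impI, elim conjE)
      fix H F w c
      assume H: "subgroup H G" "finite H" and F: "finite F" "F \<subseteq> XX"
        and inva': "\<forall>h\<in>H. \<forall>x\<in>F. act h x \<in> F" and o: "orbit_data G S H F act D w c"
      note inva = inva'[rule_format]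
      interpret H: subgroup H G by fact
      have "((F, H), restrict w F, restrict c H) \<in> I"
        using F H orbit_dataD(1,5)[OF o] XXX' H.subset by (auto simp: I_def)
      then obtain i where i: "R ((F, H), restrict w F, restrict c H) (f i)" using f(4) by blast
      then have FN: "F \<subseteq> N i" by (auto simp: R_def N_def split: prod.splits)
      have "orbit_data G S H F act (e i) (restrict w F) (restrict c H)"
        using De[where i = i] FN inva by (intro iffD1[OF orbit_data_cong o]) auto
      then have "\<exists>p\<in>N i. (\<forall>x\<in>F. e i p x = restrict w F x) \<and> (\<forall>h\<in>H. e i p (act h p) = restrict c H h)"
        using i H(1) inva by (simp add: R_def N_def e_def split_beta)
      then obtain x where x: "x \<in> N i" "\<And>f. f \<in> F \<Longrightarrow> e i x f = w f" "\<And>h. h \<in> H \<Longrightarrow> e i x (act h x) = c h"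
        by auto
      show "\<exists>x\<in>XX. (\<forall>f\<in>F. D x f = w f) \<and> (\<forall>h\<in>H. D x (act h x) = c h)"
      proof (intro bexI conjI ballI)
        show "x \<in> XX" using x by (auto simp: XX_def)
        show "D x f = w f" if "f \<in> F" for f using x FN De[where i = i] that by (auto simp: subset_iff)
        show "D x (act h x) = c h" if "h \<in> H" for h
          using x De[where i = i] act_N[of h x i] that H.subset by auto
      qed
    qed
  qed
qed

section \<open>Uniqueness of the Urysohn space\<close>

text \<open>The functions \<open>w\<close> are the Katetov functions without zeros, that is, the
  possible distances to a point outside \<open>F\<close>. One new point at a time is what back and
  forth consumes.\<close>

definition point_extension :: "real set \<Rightarrow> 'x set \<Rightarrow> ('x \<Rightarrow> 'x \<Rightarrow> real) \<Rightarrow> bool" where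
  "point_extension S M d \<longleftrightarrow>
     (\<forall>F w. finite F \<and> F \<subseteq> M \<and>
        (\<forall>x\<in>F. w x \<in> S \<and> 0 < w x \<and> (\<forall>y\<in>F. w x \<le> w y + d x y \<and> d x y \<le> w x + w y)) \<longrightarrow>
        (\<exists>x\<in>M. \<forall>y\<in>F. d x y = w y))"

lemma S_Urysohn_space_S_metric_on:
  assumes "S_Urysohn_space S U d"
  shows "S_metric_on S U d"
proof -
  have "Metric_space U d" "\<And>x y. x \<in> U \<Longrightarrow> y \<in> U \<Longrightarrow> d x y \<in> S"
    using assms by (auto simp: S_Urysohn_space_def S_metric_space_def)
  then show ?thesis
    unfolding S_metric_on_def by (auto simp: Metric_space.commute Metric_space.zero intro: Metric_space.triangle)
qed

lemma S_Urysohn_space_point_extension: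
  assumes S: "distance_set S" and U: "S_Urysohn_space S U d"
  shows "point_extension S U d"
  unfolding point_extension_def
proof (intro allI impI)
  fix F w
  assume A: "finite F \<and> F \<subseteq> U \<and>
    (\<forall>x\<in>F. w x \<in> S \<and> 0 < w x \<and> (\<forall>y\<in>F. w x \<le> w y + d x y \<and> d x y \<le> w x + w y))"
  interpret Metric_space U d using U by (simp add: S_Urysohn_space_def S_metric_space_def)
  have dS: "d x y \<in> S" if "x \<in> U" "y \<in> U" for x y
    using U that by (simp add: S_Urysohn_space_def S_metric_space_def)
  obtain h :: "nat \<Rightarrow> _" where h: "bij_betw h {0..<card F} F"
    using ex_bij_betw_nat_finite A by blast
  define n where "n = card F"
  have hF: "h i \<in> F" if "i < n" for i using h that by (auto simp: bij_betw_def n_def)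
  then have hU: "h i \<in> U" if "i < n" for i using that A by blast
  have h_inj: "h i = h j \<longleftrightarrow> i = j" if "i < n" "j < n" for i j
    using h that by (auto simp: bij_betw_def n_def inj_on_def)
  have w: "w (h i) \<in> S" "0 < w (h i)" if "i < n" for i using A hF[OF that] by auto
  have k: "w (h i) \<le> w (h j) + d (h i) (h j)" "d (h i) (h j) \<le> w (h i) + w (h j)"
    if "i < n" "j < n" for i j using A hF that by blast+
  \<comment> \<open>Test spaces have points in \<open>nat\<close>: the set \<open>F\<close> occupies
    the numbers below \<open>n\<close>, and the new point is \<open>n\<close> itself.\<close>
  define e where "e i j = (if i < n then (if j < n then d (h i) (h j) else w (h i))
    else if j < n then w (h j) else 0)" for i j
  have B: "i < n \<or> i = n" if "i \<in> {0..n}" for i using that by auto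
  have "Metric_space {0..n} e"
  proof
    fix i j show "0 \<le> e i j" using w(2) by (auto simp: e_def less_imp_le)
    show "e i j = e j i" by (auto simp: e_def commute)
  next
    fix i j assume "i \<in> {0..n}" "j \<in> {0..n}"
    then show "e i j = 0 \<longleftrightarrow> i = j" using w(2) hU h_inj
      by (auto simp: e_def) (metis less_irrefl)+
  next
    fix i j k assume ijk: "i \<in> {0..n}" "j \<in> {0..n}" "k \<in> {0..n}"
    show "e i k \<le> e i j + e j k"
      using B[OF ijk(1)] B[OF ijk(2)] B[OF ijk(3)]
      using k[of i j] k[of j k] k[of i k] k[of k j] w(2)[of i] w(2)[of j] w(2)[of k] triangle[OF hU hU hU, of i j k]
      by (auto simp: e_def commute[of "h k" "h j"])
  qed
  then have "S_metric_space S {0..n} e"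
    unfolding S_metric_space_def using dS hU w(1) distance_setD[OF S] by (auto simp: e_def)
  moreover have "isometric_embedding {0..<n} e U d h"
    unfolding isometric_embedding_def using hU by (auto simp: e_def)
  moreover have "{0..<n} \<subseteq> {0..n}" by auto
  ultimately have "\<exists>g. isometric_embedding {0..n} e U d g \<and> (\<forall>x\<in>{0..<n}. g x = h x)"
    using U[unfolded S_Urysohn_space_def, THEN conjunct2, THEN conjunct2, rule_format,
        of "{0..n}" "{0..<n}" e h] by blast
  then obtain g where g: "isometric_embedding {0..n} e U d g" "\<And>x. x < n \<Longrightarrow> g x = h x" by auto
  show "\<exists>x\<in>U. \<forall>y\<in>F. d x y = w y"
  proof (intro bexI ballI)
    show "g n \<in> U" using g(1) by (auto simp: isometric_embedding_def)
    fix y assume "y \<in> F"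
    then have "y \<in> h ` {0..<n}" using h by (simp add: bij_betw_def n_def)
    then obtain i where i: "i < n" "y = h i" by auto
    have "d (g n) (g i) = e n i" using g(1) i by (auto simp: isometric_embedding_def)
    then show "d (g n) y = w y" using i g(2) by (simp add: e_def)
  qed
qed

section \<open>Back and forth between countable spaces\<close>

definition partial_isometry ::
  "'a set \<Rightarrow> ('a \<Rightarrow> 'a \<Rightarrow> real) \<Rightarrow> 'b set \<Rightarrow> ('b \<Rightarrow> 'b \<Rightarrow> real) \<Rightarrow> ('a \<times> 'b) set \<Rightarrow> bool" where
  "partial_isometry M d N e \<Phi> \<longleftrightarrow>
     finite \<Phi> \<and> \<Phi> \<subseteq> M \<times> N \<and> (\<forall>x u y v. (x, u) \<in> \<Phi> \<longrightarrow> (y, v) \<in> \<Phi> \<longrightarrow> d x y = e u v)"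

lemma partial_isometryD:
  assumes "partial_isometry M d N e \<Phi>" "(x, u) \<in> \<Phi>"
  shows "x \<in> M" "u \<in> N" "(y, v) \<in> \<Phi> \<Longrightarrow> d x y = e u v"
  using assms unfolding partial_isometry_def by auto

lemma partial_isometry_converse:
  "partial_isometry M d N e \<Phi> \<longleftrightarrow> partial_isometry N e M d (\<Phi>\<inverse>)"
  unfolding partial_isometry_def by auto

lemma partial_isometry_inj:
  assumes "S_metric_on S M d" "S_metric_on S N e" "partial_isometry M d N e \<Phi>"
    and "(x, u) \<in> \<Phi>" "(y, u) \<in> \<Phi>"
  shows "x = y"
  using partial_isometryD[OF assms(3,4)] partial_isometryD[OF assms(3,5)] assms(5)
    S_metric_onD(3)[OF assms(1), of x y] S_metric_onD(3)[OF assms(2), of u u] by simp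

text \<open>Transported to the range of \<open>\<Phi>\<close>, the distances from a new point
  \<open>x\<close> form a Katetov function, which the extension property of \<open>N\<close>
  realises.\<close>

lemma partial_isometry_extend:
  assumes S: "distance_set S" and M: "S_metric_on S M d" and N: "S_metric_on S N e"
    and eN: "point_extension S N e" and \<Phi>: "partial_isometry M d N e \<Phi>" and x: "x \<in> M"
  shows "\<exists>u. partial_isometry M d N e (insert (x, u) \<Phi>)"
proof (cases "x \<in> fst ` \<Phi>")
  case True
  then obtain u where "(x, u) \<in> \<Phi>" by force
  then show ?thesis using \<Phi> by (intro exI[of _ u]) (simp add: insert_absorb)
next
  case False
  note m = S_metric_onD[OF M] and n = S_metric_onD[OF N] and QD = partial_isometryD[OF \<Phi>]
  define w where "w v = d x (THE y. (y, v) \<in> \<Phi>)" for v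
  have w: "w v = d x y" if "(y, v) \<in> \<Phi>" for y v
    unfolding w_def using that partial_isometry_inj[OF M N \<Phi>] by (metis the_equality)
  have "\<exists>u\<in>N. \<forall>v\<in>snd ` \<Phi>. e u v = w v"
  proof (rule eN[unfolded point_extension_def, rule_format], intro conjI ballI)
    show "finite (snd ` \<Phi>)" "snd ` \<Phi> \<subseteq> N" using \<Phi> by (auto simp: partial_isometry_def)
    fix v assume "v \<in> snd ` \<Phi>"
    then obtain y where y: "(y, v) \<in> \<Phi>" by force
    have yx: "x \<noteq> y" using False y by force
    show "w v \<in> S" using w y m(1) x QD(1) by simp
    show "0 < w v"
      using w[OF y] m(1,3)[OF x QD(1)[OF y]] yx distance_setD(4)[OF S, of "d x y"] by simp
    fix v' assume "v' \<in> snd ` \<Phi>"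
    then obtain y' where y': "(y', v') \<in> \<Phi>" by force
    have "e v v' = d y y'" using QD(3)[OF y y'] by simp
    then show "w v \<le> w v' + e v v'" "e v v' \<le> w v + w v'"
      using w[OF y] w[OF y'] m(4)[OF x QD(1)[OF y'] QD(1)[OF y]] m(4)[OF QD(1)[OF y] x QD(1)[OF y']]
        m(2)[OF QD(1)[OF y] QD(1)[OF y']] m(2)[OF x QD(1)[OF y]]
      by auto
  qed
  then obtain u where u: "u \<in> N" "\<And>y v. (y, v) \<in> \<Phi> \<Longrightarrow> e u v = d x y" using w by force
  then have "e v u = d y x" if "(y, v) \<in> \<Phi>" for y v
    using that m(2)[OF x, of y] n(2)[OF u(1), of v] QD[OF that] by simp
  moreover have "e u u = d x x" using m(3)[OF x x] n(3)[OF u(1) u(1)] by simp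
  ultimately have "partial_isometry M d N e (insert (x, u) \<Phi>)"
    using \<Phi> x u by (auto simp: partial_isometry_def)
  then show ?thesis by blast
qed

text \<open>Back and forth on finite partial isometries: task \<open>Inl x\<close> puts
  \<open>x\<close> into the domain, and task \<open>Inr u\<close> puts \<open>u\<close> into the
  range, the latter by extending the converse relation.\<close>

lemma point_extension_isometric:
  assumes S: "distance_set S" and "countable M" "countable N"
    and M: "S_metric_on S M d" and N: "S_metric_on S N e"
    and eM: "point_extension S M d" and eN: "point_extension S N e"
  obtains f where "bij_betw f M N" "\<And>x y. x \<in> M \<Longrightarrow> y \<in> M \<Longrightarrow> e (f x) (f y) = d x y"
proof -
  define Q where "Q = {\<Phi>. partial_isometry M d N e \<Phi>}"
  define R where "R i \<Phi> = (case i of Inl x \<Rightarrow> x \<in> fst ` \<Phi> | Inr u \<Rightarrow> u \<in> snd ` \<Phi>)" for i and \<Phi> :: "('a \<times> 'b) set"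
  have QD: "d x y = e u v" "x \<in> M" "u \<in> N" if "\<Phi> \<in> Q" "(x, u) \<in> \<Phi>" "(y, v) \<in> \<Phi>" for \<Phi> x y u v
    using that partial_isometryD by (fastforce simp: Q_def)+
  have Q_inj: "x = y" if "\<Phi> \<in> Q" "(x, u) \<in> \<Phi>" "(y, u) \<in> \<Phi>" for \<Phi> x y u
    using partial_isometry_inj[OF M N] that by (simp add: Q_def)
  have Q_fun: "u = v" if "\<Phi> \<in> Q" "(x, u) \<in> \<Phi>" "(x, v) \<in> \<Phi>" for \<Phi> x u v
    using partial_isometry_inj[OF N M, of "\<Phi>\<inverse>"] that partial_isometry_converse[of M d N e \<Phi>] by (simp add: Q_def)
  have dense: "\<exists>\<Psi>\<in>Q. \<Phi> \<subseteq> \<Psi> \<and> R i \<Psi>" if i: "i \<in> M <+> N" and \<Phi>: "\<Phi> \<in> Q" for i \<Phi>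
    using i
  proof (elim PlusE)
    fix x assume x: "x \<in> M" "i = Inl x"
    obtain u where "partial_isometry M d N e (insert (x, u) \<Phi>)"
      using partial_isometry_extend[OF S M N eN _ x(1)] \<Phi> by (auto simp: Q_def)
    then show ?thesis by (intro bexI[of _ "insert (x, u) \<Phi>"]) (auto simp: R_def x Q_def)
  next
    fix u assume u: "u \<in> N" "i = Inr u"
    obtain x where "partial_isometry N e M d (insert (u, x) (\<Phi>\<inverse>))"
      using partial_isometry_extend[OF S N M eM _ u(1)]
        \<Phi>[unfolded Q_def mem_Collect_eq partial_isometry_converse[of M d]] by blast
    moreover have "insert (u, x) (\<Phi>\<inverse>) = (insert (x, u) \<Phi>)\<inverse>" by auto
    ultimately have "partial_isometry M d N e (insert (x, u) \<Phi>)"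
      using partial_isometry_converse[of M d N e "insert (x, u) \<Phi>"] by simp
    then show ?thesis by (intro bexI[of _ "insert (x, u) \<Phi>"]) (auto simp: R_def u Q_def)
  qed
  have cI: "countable (M <+> N)" using assms(2,3) by (rule countable_Plus)
  have "{} \<in> Q" by (simp add: Q_def partial_isometry_def)
  obtain F :: "nat \<Rightarrow> _" where F: "\<And>n. F n \<in> Q" "\<And>m n. m \<le> n \<Longrightarrow> F m \<subseteq> F n"
    "\<And>i. i \<in> M <+> N \<Longrightarrow> \<exists>n. R i (F n)"
    by (rule generic_chain[OF cI subset_refl subset_trans \<open>{} \<in> Q\<close> dense]) (assumption | rule that)+
  define \<Phi> where "\<Phi> = (\<Union>n. F n)"
  have two: "\<exists>n. p \<in> F n \<and> q \<in> F n" if "p \<in> \<Phi>" "q \<in> \<Phi>" for p q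
  proof -
    from that obtain m n where "p \<in> F m" "q \<in> F n" by (auto simp: \<Phi>_def)
    then show ?thesis using F(2)[of m "max m n"] F(2)[of n "max m n"] by auto
  qed
  define f where "f x = (SOME u. (x, u) \<in> \<Phi>)" for x
  have f: "(x, f x) \<in> \<Phi>" if x: "x \<in> M" for x
  proof -
    obtain n where "R (Inl x) (F n)" using F(3)[of "Inl x"] x by auto
    then have "\<exists>u. (x, u) \<in> \<Phi>" by (force simp: R_def \<Phi>_def)
    then show ?thesis unfolding f_def by (rule someI_ex)
  qed
  show thesis
  proof (rule that[of f])
    show iso: "e (f x) (f y) = d x y" if "x \<in> M" "y \<in> M" for x y
      using two[OF f[OF that(1)] f[OF that(2)]] QD(1)[OF F(1)] by metis
    show "bij_betw f M N"
      unfolding bij_betw_def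
    proof (intro conjI inj_onI equalityI subsetI)
      fix x y assume "x \<in> M" "y \<in> M" "f x = f y"
      then show "x = y" using two[OF f f] Q_inj[OF F(1)] by metis
    next
      fix u assume "u \<in> f ` M"
      then show "u \<in> N" using f two QD(3)[OF F(1)] by blast
    next
      fix u assume "u \<in> N"
      then obtain n where "R (Inr u) (F n)" using F(3)[of "Inr u"] by auto
      then obtain x where x: "(x, u) \<in> \<Phi>" by (force simp: R_def \<Phi>_def)
      then have "x \<in> M" using two QD(2)[OF F(1)] by blast
      then have "f x = u" using two[OF f x] Q_fun[OF F(1)] by blast
      then show "u \<in> f ` M" using \<open>x \<in> M\<close> by blast
    qed
  qed
qed

text \<open>The generic space lives on a type of its own. Its action is transported to the given
  Urysohn space along an isometry, which exists because both spaces are countable and have the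
  one-point extension property.\<close>

lemma generic_action_on_Urysohn_space:
  fixes G :: "('a, 'm) monoid_scheme" (structure) and P :: "'p set"
    and U :: "'u set" and d :: "'u \<Rightarrow> 'u \<Rightarrow> real"
  assumes S: "distance_set S" and U: "S_Urysohn_space S U d"
    and G: "group G" and "countable (carrier G)" and "countable P"
    and pact: "\<And>p. p \<in> P \<Longrightarrow> pact \<one> p = p"
      "\<And>g p. g \<in> carrier G \<Longrightarrow> p \<in> P \<Longrightarrow> pact g p \<in> P"
      "\<And>g h p. g \<in> carrier G \<Longrightarrow> h \<in> carrier G \<Longrightarrow> p \<in> P \<Longrightarrow> pact (g \<otimes> h) p = pact g (pact h p)"
      "\<And>g p. g \<in> carrier G \<Longrightarrow> p \<in> P \<Longrightarrow> pact g p = p \<Longrightarrow> g = \<one>"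
  obtains act j where
    "isometric_on G (carrier G) U act d" "j \<in> P \<rightarrow> U"
    "\<And>g p. p \<in> P \<Longrightarrow> act g (j p) = j (pact g p)"
    "\<And>g x. g \<in> carrier G \<Longrightarrow> x \<in> U \<Longrightarrow> act g x = x \<Longrightarrow> g = \<one>"
    "\<And>x y. x \<in> U \<Longrightarrow> y \<in> U \<Longrightarrow> finite {g \<in> carrier G. d (act g x) y < 1}"
    "\<And>p q. p \<in> P \<Longrightarrow> q \<in> P \<Longrightarrow> p \<noteq> q \<Longrightarrow> d (j p) (j q) = 1"
    "\<And>x. x \<in> U \<Longrightarrow> finite {p \<in> P. d x (j p) < 1}"
    "orbit_extension G S U act d"
proof -
  interpret group G by fact
  obtain V :: "('p + 'a \<times> nat) set" and act D where
    V: "countable V" "Inl ` P \<subseteq> V" "S_metric_on S V D" "isometric_on G (carrier G) V act D"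
    "\<And>g p. p \<in> P \<Longrightarrow> act g (Inl p) = Inl (pact g p)"
    "\<And>g x. g \<in> carrier G \<Longrightarrow> x \<in> V \<Longrightarrow> act g x = x \<Longrightarrow> g = \<one>"
    "\<And>x y. x \<in> V \<Longrightarrow> y \<in> V \<Longrightarrow> finite {g \<in> carrier G. D (act g x) y < 1}"
    "\<And>p q. p \<in> P \<Longrightarrow> q \<in> P \<Longrightarrow> p \<noteq> q \<Longrightarrow> D (Inl p) (Inl q) = 1"
    "\<And>x. x \<in> V \<Longrightarrow> finite {p \<in> P. D x (Inl p) < 1}"
    "orbit_extension G S V act D"
    by (rule generic_space[OF S G assms(4,5) pact]) (assumption | rule that)+
  note a = isometric_onD[OF V(4)]
  have pV: "point_extension S V D"
    unfolding point_extension_def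
  proof (intro allI impI)
    fix F w
    assume F: "finite F \<and> F \<subseteq> V \<and>
      (\<forall>x\<in>F. w x \<in> S \<and> 0 < w x \<and> (\<forall>y\<in>F. w x \<le> w y + D x y \<and> D x y \<le> w x + w y))"
    \<comment> \<open>One-point extension is the case of the trivial subgroup, whose only
      displacement is \<open>0\<close>.\<close>
    have 1: "orbit_data G S {\<one>} F act D w (\<lambda>g. 0)"
      unfolding orbit_data_def using F a(1) distance_setD(2)[OF S] by (auto simp: subset_iff less_imp_le)
    have 2: "act h x \<in> F" if "h \<in> {\<one>}" "x \<in> F" for h x using that F a(1) by auto
    have 3: "finite {\<one>}" "finite F" "F \<subseteq> V" using F by auto
    obtain x where "x \<in> V" "\<And>y. y \<in> F \<Longrightarrow> D x y = w y"
      by (rule orbit_extensionE[OF V(10) triv_subgroup 3 2 1]) (assumption | rule that)+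
    then show "\<exists>x\<in>V. \<forall>y\<in>F. D x y = w y" by blast
  qed
  have cU: "countable U" using U by (simp add: S_Urysohn_space_def)
  obtain f where f: "bij_betw f V U" and iso: "\<And>x y. x \<in> V \<Longrightarrow> y \<in> V \<Longrightarrow> d (f x) (f y) = D x y"
    by (rule point_extension_isometric[OF S V(1) cU V(3) S_Urysohn_space_S_metric_on[OF U] pV
        S_Urysohn_space_point_extension[OF S U]]) (assumption | rule that)+
  define f' where "f' = inv_into V f"
  have f': "f' u \<in> V" "f (f' u) = u" if "u \<in> U" for u
    using f that unfolding f'_def by (auto simp: bij_betw_def inv_into_into f_inv_into_f)
  have f'f: "f' (f x) = x" "f x \<in> U" if "x \<in> V" for x
    using f that unfolding f'_def by (auto simp: bij_betw_def inv_into_f_f)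
  have iso': "d u v = D (f' u) (f' v)" if "u \<in> U" "v \<in> U" for u v
    using iso[of "f' u" "f' v"] f' that by simp
  define act' where "act' g u = f (act g (f' u))" for g u
  define j where "j p = f (Inl p)" for p
  have jV: "Inl p \<in> V" if "p \<in> P" for p using V(2) that by blast
  show thesis
  proof (rule that[of act' j])
    show "isometric_on G (carrier G) U act' d"
      unfolding isometric_on_def act'_def using f' f'f a iso iso' by simp
    show "j \<in> P \<rightarrow> U" using f'f jV by (auto simp: j_def)
    show "act' g (j p) = j (pact g p)" if "p \<in> P" for g p
      using that V(5) f'f jV by (simp add: j_def act'_def)
    show "g = \<one>" if "g \<in> carrier G" "x \<in> U" "act' g x = x" for g x
      using V(6)[of g "f' x"] that f' f'f a by (metis act'_def)
    show "finite {g \<in> carrier G. d (act' g x) y < 1}" if "x \<in> U" "y \<in> U" for x y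
    proof -
      have "{g \<in> carrier G. d (act' g x) y < 1} = {g \<in> carrier G. D (act g (f' x)) (f' y) < 1}"
        using that f' f'f a iso' by (auto simp: act'_def)
      then show ?thesis using V(7) f' that by simp
    qed
    show "d (j p) (j q) = 1" if "p \<in> P" "q \<in> P" "p \<noteq> q" for p q
      using that V(8) jV iso by (simp add: j_def)
    show "finite {p \<in> P. d x (j p) < 1}" if "x \<in> U" for x
    proof -
      have "{p \<in> P. d x (j p) < 1} = {p \<in> P. D (f' x) (Inl p) < 1}"
        using that f' f'f iso' jV by (auto simp: j_def)
      then show ?thesis using V(9) f' that by simp
    qed
    show "orbit_extension G S U act' d"
      unfolding orbit_extension_def
    proof (intro allI impI, elim conjE)
      fix H F w c
      assume H: "subgroup H G" "finite H" and F: "finite F" "F \<subseteq> U"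
        and inva: "\<forall>h\<in>H. \<forall>x\<in>F. act' h x \<in> F" and o: "orbit_data G S H F act' d w c"
      interpret H: subgroup H G by fact
      have FU: "x \<in> U" if "x \<in> F" for x using F that by blast
      have eq: "act h (f' x) = f' (act' h x)" if "h \<in> H" "x \<in> F" for h x
        using that f' f'f a(2) FU H.subset by (auto simp: act'_def)
      have 1: "finite (f' ` F)" "f' ` F \<subseteq> V" using F f' by auto
      have 2: "act h x \<in> f' ` F" if "h \<in> H" "x \<in> f' ` F" for h x using that eq inva by auto
      have 3: "orbit_data G S H (f' ` F) act D (\<lambda>y. w (f y)) c"
        unfolding orbit_data_def using orbit_dataD[OF o] eq FU f' f'f iso' inva by simp
      obtain x where x: "x \<in> V" "\<And>y. y \<in> f' ` F \<Longrightarrow> D x y = w (f y)" "\<And>h. h \<in> H \<Longrightarrow> D x (act h x) = c h"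
        by (rule orbit_extensionE[OF V(10) H 1 2 3]) (assumption | rule that)+
      show "\<exists>x\<in>U. (\<forall>y\<in>F. d x y = w y) \<and> (\<forall>h\<in>H. d x (act' h x) = c h)"
      proof (intro bexI conjI ballI)
        show "f x \<in> U" using x f'f by simp
        show "d (f x) y = w y" if "y \<in> F" for y using x f'f f' iso' that FU by simp
        show "d (f x) (act' h (f x)) = c h" if "h \<in> H" for h
          using x f'f iso that a(2) H.subset by (auto simp: act'_def subset_iff)
      qed
    qed
  qed
qed

section \<open>Highly core-free subgroups\<close>

text \<open>B. H. Neumann's lemma on coverings by cosets, with infinite index expressed by the
  absence of finite coset covers. The induction is on the number of subgroups, not of cosets, so all
  cosets of \<open>H\<close> are eliminated at once.\<close>

lemma infinite_index_coset_cover: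
  fixes G (structure)
  assumes G: "group G" and "finite \<K>"
    and "\<And>H. H \<in> \<K> \<Longrightarrow> subgroup H G"
    and "\<And>H F. H \<in> \<K> \<Longrightarrow> finite F \<Longrightarrow> F \<subseteq> carrier G \<Longrightarrow> \<not> carrier G \<subseteq> (\<Union>f\<in>F. H #> f)"
    and "\<And>H. H \<in> \<K> \<Longrightarrow> finite (T H)" "\<And>H. H \<in> \<K> \<Longrightarrow> T H \<subseteq> carrier G"
  shows "\<not> carrier G \<subseteq> (\<Union>H\<in>\<K>. \<Union>f\<in>T H. H #> f)"
  using assms(2-)
proof (induction \<K> arbitrary: T)
  case empty
  interpret group G by fact
  show ?case by auto
next
  case (insert H \<K>)
  interpret group G by fact
  interpret H: subgroup H G by (rule insert.prems(1)) simp
  have TH: "finite (T H)" "T H \<subseteq> carrier G" by (rule insert.prems(3,4), simp)+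
  obtain g where g: "g \<in> carrier G" "g \<notin> (\<Union>f\<in>T H. H #> f)"
    using insert.prems(2)[of H "T H"] TH by blast
  show ?case
  proof
    assume cover: "carrier G \<subseteq> (\<Union>K\<in>insert H \<K>. \<Union>f\<in>T K. K #> f)"
    \<comment> \<open>If cosets \<open>K #> t\<close> cover \<open>H #> g\<close>, then right
      translation by \<open>inv g \<otimes> f\<close> turns them into cosets covering
      \<open>H #> f\<close>; the added elements represent these.\<close>
    define T' where "T' K = T K \<union> (\<lambda>(t, f). t \<otimes> inv g \<otimes> f) ` (T K \<times> T H)" for K
    have "\<not> carrier G \<subseteq> (\<Union>K\<in>\<K>. \<Union>f\<in>T' K. K #> f)"
    proof (rule insert.IH)
      fix K assume K: "K \<in> \<K>"
      show "subgroup K G" using insert.prems(1) K by simp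
      show "finite (T' K)" using insert.prems(3) K by (auto simp: T'_def)
      show "T' K \<subseteq> carrier G" using insert.prems(4) K g TH unfolding T'_def by fastforce
    next
      fix K F assume "K \<in> \<K>" "finite F" "F \<subseteq> carrier G"
      then show "\<not> carrier G \<subseteq> (\<Union>f\<in>F. K #> f)" using insert.prems(2)[of K F] by simp
    qed
    moreover have "x \<in> (\<Union>K\<in>\<K>. \<Union>f\<in>T' K. K #> f)" if x: "x \<in> carrier G" for x
    proof -
      obtain K t where K: "K \<in> insert H \<K>" "t \<in> T K" "x \<in> K #> t" using cover x by blast
      show ?thesis
      proof (cases "K = H")
        case False
        then show ?thesis using K by (auto simp: T'_def)
      next
        case True
        \<comment> \<open>The coset \<open>H g\<close> is disjoint from the cosets \<open>H f\<close> of the cover, hence covered by the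
          other subgroups, and so is its translate \<open>H t\<close>.\<close>
        then obtain h where h: "h \<in> H" "x = h \<otimes> t" using K by (auto simp: r_coset_def)
        have t: "t \<in> carrier G" using K True TH by blast
        have "h \<otimes> g \<in> carrier G" using h g by simp
        then obtain L s where L: "L \<in> insert H \<K>" "s \<in> T L" "h \<otimes> g \<in> L #> s" using cover by blast
        have sG: "s \<in> carrier G" using L(2) insert.prems(4)[OF L(1)] by blast
        have "L \<noteq> H"
        proof
          assume "L = H"
          then obtain h' where h': "h' \<in> H" "h \<otimes> g = h' \<otimes> s" using L by (auto simp: r_coset_def)
          then have "g = inv h \<otimes> h' \<otimes> s"
            using h g sG by (metis H.mem_carrier inv_closed inv_solve_left m_assoc m_closed)
          then have "g \<in> H #> s" using h h' by (auto simp: r_coset_def)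
          then show False using g L \<open>L = H\<close> by blast
        qed
        then have LH: "L \<in> \<K>" using L by blast
        have LG: "L \<subseteq> carrier G" using insert.prems(1)[OF L(1)] by (rule subgroup.subset)
        obtain l where l: "l \<in> L" "h \<otimes> g = l \<otimes> s" using L by (auto simp: r_coset_def)
        have "h = l \<otimes> s \<otimes> inv g" using l g h LG sG
          by (metis H.mem_carrier inv_solve_right m_closed subsetD)
        then have "x = l \<otimes> (s \<otimes> inv g \<otimes> t)" using h l LG sG g t by (auto simp: m_assoc subset_iff)
        then have "x \<in> L #> (s \<otimes> inv g \<otimes> t)" using l by (auto simp: r_coset_def)
        moreover have "s \<otimes> inv g \<otimes> t \<in> T' L" using L(2) K True by (force simp: T'_def)
        ultimately show ?thesis using LH by blast
      qed
    qed
    ultimately show False by blast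
  qed
qed

text \<open>A bad \<open>\<gamma>\<close> either lies in the finite set of products
  \<open>s \<otimes> e\<close> or conjugates some nontrivial \<open>s\<close> in \<open>H\<close> to
  some \<open>e\<close>, where \<open>e\<close> runs through the quotients of elements of
  \<open>F\<close>. Elements of the second kind fill finitely many cosets of centralisers, and these
  have infinite index because the conjugacy classes are infinite. Neumann's lemma therefore leaves a
  good \<open>\<gamma>\<close>.\<close>

lemma highly_core_free_finite:
  fixes G (structure)
  assumes G: "group G" and inf: "infinite (carrier G)" and H: "subgroup H G" and "finite H"
    and icc: "\<And>s. s \<in> H \<Longrightarrow> s \<noteq> \<one> \<Longrightarrow> infinite {h \<otimes> s \<otimes> inv h | h. h \<in> carrier G}"
  shows "highly_core_free H G"
  unfolding highly_core_free_def
proof (intro conjI allI impI)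
  interpret group G by fact
  interpret H: subgroup H G by fact
  show "subgroup H G" by fact
  fix F assume F: "finite F \<and> F \<subseteq> carrier G"
  then have FG: "f \<in> carrier G" if "f \<in> F" for f using that by blast
  define C where "C s = {g \<in> carrier G. g \<otimes> s = s \<otimes> g}" for s
  have C: "subgroup (C s) G" if "s \<in> carrier G" for s
  proof
    show "x \<otimes> y \<in> C s" if "x \<in> C s" "y \<in> C s" for x y
    proof -
      have x: "x \<in> carrier G" "x \<otimes> s = s \<otimes> x" and y: "y \<in> carrier G" "y \<otimes> s = s \<otimes> y"
        using that by (auto simp: C_def)
      have "x \<otimes> y \<otimes> s = (x \<otimes> s) \<otimes> y" using x(1) y \<open>s \<in> carrier G\<close> by (simp add: m_assoc)
      also have "\<dots> = s \<otimes> (x \<otimes> y)" unfolding x(2) using x(1) y(1) \<open>s \<in> carrier G\<close> by (simp add: m_assoc)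
      finally show ?thesis using x y by (simp add: C_def)
    qed
    show "inv x \<in> C s" if "x \<in> C s" for x
    proof -
      have x: "x \<in> carrier G" "x \<otimes> s = s \<otimes> x" using that by (auto simp: C_def)
      have "inv x \<otimes> s = inv x \<otimes> (s \<otimes> x) \<otimes> inv x" using x(1) \<open>s \<in> carrier G\<close> by (simp add: m_assoc)
      also have "\<dots> = s \<otimes> inv x" using x \<open>s \<in> carrier G\<close> by (simp add: inv_solve_left' flip: x(2))
      finally show ?thesis using x by (simp add: C_def)
    qed
  qed (use that in \<open>auto simp: C_def\<close>)
  \<comment> \<open>An equality \<open>s \<otimes> \<gamma> \<otimes> f = s' \<otimes> \<gamma>
    \<otimes> f'\<close> says that \<open>\<gamma>\<close> conjugates
    \<open>inv s' \<otimes> s\<close> to the quotient \<open>f' \<otimes> inv f\<close>, and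
    \<open>s \<otimes> \<gamma> \<otimes> f = f'\<close> says that
    \<open>\<gamma> = inv s \<otimes> (f' \<otimes> inv f)\<close>.\<close>
  define E where "E = (\<lambda>(a, b). a \<otimes> inv b) ` (F \<times> F)"
  have E: "finite E" "E \<subseteq> carrier G" using F FG by (auto simp: E_def)
  \<comment> \<open>The elements \<open>g\<close> with \<open>inv g \<otimes> s \<otimes> g = e\<close> form a coset of \<open>C s\<close>, represented by \<open>r s e\<close>.\<close>
  define r where "r s e = (SOME g. g \<in> carrier G \<and> s \<otimes> g = g \<otimes> e)" for s e
  \<comment> \<open>Single points are cosets of the trivial subgroup, hence the first part. The
    representatives \<open>r s e\<close> are given to every \<open>K\<close>: different
    \<open>s\<close> may share a centraliser, and finitely many further cosets do no harm.\<close>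
  define T where "T K = (if K = {\<one>} then (\<lambda>(s, e). s \<otimes> e) ` (H \<times> E) else {})
    \<union> {r s e | s e. s \<in> H \<and> e \<in> E \<and> (\<exists>g. g \<in> carrier G \<and> s \<otimes> g = g \<otimes> e)}" for K
  define \<K> where "\<K> = insert {\<one>} (C ` (H - {\<one>}))"
  have r: "r s e \<in> carrier G \<and> s \<otimes> r s e = r s e \<otimes> e"
    if "\<exists>g. g \<in> carrier G \<and> s \<otimes> g = g \<otimes> e" for s e
    unfolding r_def by (rule someI_ex[OF that])
  have "\<not> carrier G \<subseteq> (\<Union>K\<in>\<K>. \<Union>f\<in>T K. K #> f)"
  proof (rule infinite_index_coset_cover[OF G])
    show "finite \<K>" using assms(4) by (auto simp: \<K>_def)
    fix K assume K: "K \<in> \<K>"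
    show "subgroup K G" using K C triv_subgroup by (auto simp: \<K>_def)
    have "finite {r s e | s e. s \<in> H \<and> e \<in> E \<and> (\<exists>g. g \<in> carrier G \<and> s \<otimes> g = g \<otimes> e)}"
      by (rule finite_subset[of _ "(\<lambda>(s, e). r s e) ` (H \<times> E)"]) (use assms(4) E in auto)
    then show "finite (T K)" using assms(4) E by (auto simp: T_def)
    show "T K \<subseteq> carrier G" using r E by (auto simp: T_def subset_iff)
    fix S assume S: "finite S" "S \<subseteq> carrier G"
    show "\<not> carrier G \<subseteq> (\<Union>f\<in>S. K #> f)"
    proof (cases "K = {\<one>}")
      case True
      then have "(\<Union>f\<in>S. K #> f) \<subseteq> S" using S by (auto simp: r_coset_def)
      then show ?thesis using S inf by (meson finite_subset)
    next
      case False
      then obtain s where s: "s \<in> H" "s \<noteq> \<one>" "K = C s"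
        using K unfolding \<K>_def by blast
      then have sG: "s \<in> carrier G" by simp
      show ?thesis
      proof
        assume cover: "carrier G \<subseteq> (\<Union>f\<in>S. K #> f)"
        \<comment> \<open>If \<open>inv h = k \<otimes> f\<close> with \<open>k\<close> in the
          centraliser of \<open>s\<close>, then \<open>h \<otimes> s \<otimes> inv h\<close> depends
          on \<open>f\<close> only. Finitely many cosets would thus give a finite conjugacy
          class.\<close>
        have "{h \<otimes> s \<otimes> inv h | h. h \<in> carrier G} \<subseteq> (\<lambda>f. inv f \<otimes> s \<otimes> f) ` S"
        proof
          fix x assume "x \<in> {h \<otimes> s \<otimes> inv h | h. h \<in> carrier G}"
          then obtain h where h: "h \<in> carrier G" "x = h \<otimes> s \<otimes> inv h" by blast
          then obtain f k where f: "f \<in> S" "k \<in> C s" "inv h = k \<otimes> f"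
            using cover s(3) inv_closed[OF h(1)] unfolding r_coset_def by blast
          have k: "k \<in> carrier G" "k \<otimes> s = s \<otimes> k" and fG: "f \<in> carrier G" using f S by (auto simp: C_def)
          have "h = inv (k \<otimes> f)" using f h by (metis inv_inv)
          then have "x = inv f \<otimes> (inv k \<otimes> (s \<otimes> k)) \<otimes> f"
            using h f k fG sG by (simp add: inv_mult_group m_assoc)
          also have "inv k \<otimes> (s \<otimes> k) = s" using k sG by (metis inv_solve_left m_closed)
          finally show "x \<in> (\<lambda>f. inv f \<otimes> s \<otimes> f) ` S" using f by blast
        qed
        then show False using icc s S by (meson finite_imageI finite_subset)
      qed
    qed
  qed
  then obtain \<gamma> where \<gamma>: "\<gamma> \<in> carrier G" "\<And>K f. K \<in> \<K> \<Longrightarrow> f \<in> T K \<Longrightarrow> \<gamma> \<notin> K #> f" by blast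
  have no_conj: "s \<otimes> \<gamma> \<noteq> \<gamma> \<otimes> e" if se: "s \<in> H" "s \<noteq> \<one>" "e \<in> E" for s e
  proof
    assume eq: "s \<otimes> \<gamma> = \<gamma> \<otimes> e"
    define g where "g = r s e"
    have ex: "\<exists>g. g \<in> carrier G \<and> s \<otimes> g = g \<otimes> e" using eq \<gamma> by blast
    then have g: "g \<in> carrier G" "s \<otimes> g = g \<otimes> e" using r unfolding g_def by blast+
    have sG: "s \<in> carrier G" and eG: "e \<in> carrier G" using se E by auto
    have "\<gamma> \<otimes> inv g \<otimes> s = s \<otimes> (\<gamma> \<otimes> inv g)"
    proof -
      have "inv g \<otimes> s = e \<otimes> inv g"
        using g sG eG by (metis inv_closed inv_solve_left inv_solve_right m_assoc m_closed)
      then have "\<gamma> \<otimes> inv g \<otimes> s = \<gamma> \<otimes> e \<otimes> inv g" using g sG eG \<gamma> by (simp add: m_assoc)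
      also have "\<dots> = s \<otimes> (\<gamma> \<otimes> inv g)" using eq g sG \<gamma> by (metis inv_closed m_assoc)
      finally show ?thesis .
    qed
    then have "\<gamma> \<otimes> inv g \<in> C s" using \<gamma> g by (simp add: C_def)
    moreover have "\<gamma> = \<gamma> \<otimes> inv g \<otimes> g" using \<gamma> g by (simp add: m_assoc)
    ultimately have "\<gamma> \<in> C s #> g" unfolding r_coset_def by blast
    moreover have "g \<in> T (C s)" using se ex by (auto simp: T_def g_def)
    ultimately show False using \<gamma>(2)[of "C s" g] se by (auto simp: \<K>_def)
  qed
  have no_E: "\<gamma> \<noteq> s \<otimes> e" if "s \<in> H" "e \<in> E" for s e
  proof
    assume "\<gamma> = s \<otimes> e"
    moreover have "s \<otimes> e \<in> T {\<one>}" using that by (force simp: T_def)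
    ultimately show False using \<gamma>(2)[of "{\<one>}" \<gamma>] \<gamma>(1) by (auto simp: \<K>_def r_coset_def)
  qed
  have inj: "inj_on (\<lambda>(\<sigma>, f). \<sigma> \<otimes> \<gamma> \<otimes> f) (H \<times> F)"
  proof (rule inj_onI, clarify)
    fix s f s' f'
    assume s: "s \<in> H" "s' \<in> H" and f: "f \<in> F" "f' \<in> F" and eq: "s \<otimes> \<gamma> \<otimes> f = s' \<otimes> \<gamma> \<otimes> f'"
    have G: "s \<in> carrier G" "s' \<in> carrier G" "f \<in> carrier G" "f' \<in> carrier G" using s f FG by auto
    have "inv s' \<otimes> s \<otimes> \<gamma> = inv s' \<otimes> (s \<otimes> \<gamma> \<otimes> f) \<otimes> inv f" using G \<gamma> by (simp add: m_assoc)
    also have "\<dots> = inv s' \<otimes> (s' \<otimes> \<gamma> \<otimes> f') \<otimes> inv f" using eq by simp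
    also have "\<dots> = \<gamma> \<otimes> (f' \<otimes> inv f)" using G \<gamma> by (simp add: m_assoc inv_solve_left')
    finally have *: "inv s' \<otimes> s \<otimes> \<gamma> = \<gamma> \<otimes> (f' \<otimes> inv f)" .
    moreover have "f' \<otimes> inv f \<in> E" using f by (force simp: E_def)
    ultimately have "inv s' \<otimes> s = \<one>" using no_conj[of "inv s' \<otimes> s" "f' \<otimes> inv f"] s by auto
    then have "s = s'" using G by (metis inv_closed inv_equality inv_inv)
    moreover have "f = f'" using eq G \<gamma> \<open>s = s'\<close> by simp
    ultimately show "s = s' \<and> f = f'" by simp
  qed
  moreover have "(\<lambda>(\<sigma>, f). \<sigma> \<otimes> \<gamma> \<otimes> f) ` (H \<times> F) \<inter> F = {}"
  proof -
    have "s \<otimes> \<gamma> \<otimes> f \<notin> F" if s: "s \<in> H" and f: "f \<in> F" for s f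
    proof
      assume "s \<otimes> \<gamma> \<otimes> f \<in> F"
      then have "s \<otimes> \<gamma> \<otimes> f \<otimes> inv f \<in> E" using f by (force simp: E_def)
      moreover have "s \<otimes> \<gamma> \<otimes> f \<otimes> inv f = s \<otimes> \<gamma>" using s f FG \<gamma> by (simp add: m_assoc)
      moreover have "\<gamma> = inv s \<otimes> (s \<otimes> \<gamma>)" using s \<gamma> by (simp flip: m_assoc)
      ultimately show False using no_E[of "inv s" "s \<otimes> \<gamma>"] s by simp
    qed
    then show ?thesis by auto
  qed
  ultimately show "\<exists>\<gamma>\<in>carrier G. inj_on (\<lambda>(\<sigma>, f). \<sigma> \<otimes> \<gamma> \<otimes> f) (H \<times> F) \<and>
      (\<lambda>(\<sigma>, f). \<sigma> \<otimes> \<gamma> \<otimes> f) ` (H \<times> F) \<inter> F = {}"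
    using \<gamma> by blast
qed

section \<open>Word quotients and their actions\<close>

abbreviation words :: "('a, 'm) monoid_scheme \<Rightarrow> ('b, 'n) monoid_scheme \<Rightarrow> ('a + 'b) list set" where
  "words G1 G2 \<equiv> lists (carrier G1 <+> carrier G2)"

definition word_class ::
  "('a, 'm) monoid_scheme \<Rightarrow> ('b, 'n) monoid_scheme \<Rightarrow> ('a \<times> 'b) set \<Rightarrow> ('a + 'b) list \<Rightarrow> ('a + 'b) list set"
where
  "word_class G1 G2 R u = word_cong G1 G2 R `` {u}"

definition word_act :: "('a \<Rightarrow> 'x \<Rightarrow> 'x) \<Rightarrow> ('b \<Rightarrow> 'x \<Rightarrow> 'x) \<Rightarrow> ('a + 'b) list \<Rightarrow> 'x \<Rightarrow> 'x" where
  "word_act a b = foldr (case_sum a b)"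

lemma word_act_simps [simp]:
  "word_act a b [] x = x"
  "word_act a b (Inl g # w) x = a g (word_act a b w x)"
  "word_act a b (Inr k # w) x = b k (word_act a b w x)"
  "word_act a b (u @ v) x = word_act a b u (word_act a b v x)"
  by (simp_all add: word_act_def)

section \<open>The group of words modulo the congruence\<close>

context
  fixes G1 :: "('a, 'm) monoid_scheme" and G2 :: "('b, 'n) monoid_scheme" and R :: "('a \<times> 'b) set"
  assumes G1: "group G1" and G2: "group G2"
begin

interpretation G1: group G1 by (rule G1)
interpretation G2: group G2 by (rule G2)

lemma word_cong_words: "(u, v) \<in> word_cong G1 G2 R \<Longrightarrow> u \<in> words G1 G2 \<and> v \<in> words G1 G2"
  by (induction rule: word_cong.induct) auto

lemma equiv_word_cong: "equiv (words G1 G2) (word_cong G1 G2 R)"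
proof (rule equivI)
  show "word_cong G1 G2 R \<subseteq> words G1 G2 \<times> words G1 G2" using word_cong_words by auto
  show "refl_on (words G1 G2) (word_cong G1 G2 R)" by (auto simp: refl_on_def intro: word_cong.refl)
  show "sym (word_cong G1 G2 R)" by (auto simp: sym_def intro: word_cong.sym)
  show "trans (word_cong G1 G2 R)" by (auto simp: trans_def intro: word_cong.trans)
qed

lemma word_class_eq_iff:
  "u \<in> words G1 G2 \<Longrightarrow> v \<in> words G1 G2 \<Longrightarrow>
     word_class G1 G2 R u = word_class G1 G2 R v \<longleftrightarrow> (u, v) \<in> word_cong G1 G2 R"
  unfolding word_class_def using eq_equiv_class_iff[OF equiv_word_cong] by blast

lemma word_class_eqI: "(u, v) \<in> word_cong G1 G2 R \<Longrightarrow> word_class G1 G2 R u = word_class G1 G2 R v"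
  unfolding word_class_def by (rule equiv_class_eq[OF equiv_word_cong])

lemma word_class_self: "u \<in> words G1 G2 \<Longrightarrow> u \<in> word_class G1 G2 R u"
  by (auto simp: word_class_def intro: word_cong.refl)

lemma carrier_word_quotient: "carrier (word_quotient G1 G2 R) = word_class G1 G2 R ` words G1 G2"
  by (auto simp: word_quotient_def quotient_def word_class_def)

lemma one_word_quotient: "\<one>\<^bsub>word_quotient G1 G2 R\<^esub> = word_class G1 G2 R []"
  by (simp add: word_quotient_def word_class_def)

lemma mult_word_quotient:
  assumes u: "u \<in> words G1 G2" and v: "v \<in> words G1 G2"
  shows "word_class G1 G2 R u \<otimes>\<^bsub>word_quotient G1 G2 R\<^esub> word_class G1 G2 R v = word_class G1 G2 R (u @ v)"
proof -
  let ?M = "{x @ y | x y. x \<in> word_class G1 G2 R u \<and> y \<in> word_class G1 G2 R v}"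
  have "word_cong G1 G2 R `` ?M =
      word_class G1 G2 R (u @ v)"
  proof (intro equalityI subsetI)
    fix z assume "z \<in> word_cong G1 G2 R `` ?M"
    then obtain x y where "(u, x) \<in> word_cong G1 G2 R" "(v, y) \<in> word_cong G1 G2 R" "(x @ y, z) \<in> word_cong G1 G2 R"
      by (auto simp: word_class_def)
    then show "z \<in> word_class G1 G2 R (u @ v)"
      unfolding word_class_def by (blast intro: word_cong.trans word_cong.append)
  next
    fix z assume "z \<in> word_class G1 G2 R (u @ v)"
    then have "(u @ v, z) \<in> word_cong G1 G2 R" by (simp add: word_class_def)
    then show "z \<in> word_cong G1 G2 R `` ?M"
      using word_class_self u v by blast
  qed
  then show ?thesis by (simp add: word_quotient_def)
qed

lemma word_left_inverse:
  assumes "w \<in> words G1 G2"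
  obtains w' where "w' \<in> words G1 G2" "(w' @ w, []) \<in> word_cong G1 G2 R"
proof -
  have "\<exists>w'\<in>words G1 G2. (w' @ w, []) \<in> word_cong G1 G2 R"
    using assms
  proof (induction w)
    case Nil
    then show ?case by (auto intro!: bexI[of _ "[]"] word_cong.refl)
  next
    case (Cons l w)
    then obtain w' where w': "w' \<in> words G1 G2" "(w' @ w, []) \<in> word_cong G1 G2 R" by auto
    have w: "w \<in> words G1 G2" using Cons by auto
    have "\<exists>l'\<in>carrier G1 <+> carrier G2. ([l', l], []) \<in> word_cong G1 G2 R"
    proof (cases l)
      case (Inl g)
      then have g: "g \<in> carrier G1" using Cons by auto
      have "([Inl (inv\<^bsub>G1\<^esub> g), Inl g], [Inl \<one>\<^bsub>G1\<^esub>]) \<in> word_cong G1 G2 R"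
        using word_cong.mult_left[of "inv\<^bsub>G1\<^esub> g" G1 g G2 R] g by simp
      then have "([Inl (inv\<^bsub>G1\<^esub> g), Inl g], []) \<in> word_cong G1 G2 R"
        using word_cong.one_left word_cong.trans by blast
      then show ?thesis using Inl g by blast
    next
      case (Inr g)
      then have g: "g \<in> carrier G2" using Cons by auto
      have "([Inr (inv\<^bsub>G2\<^esub> g), Inr g], [Inr \<one>\<^bsub>G2\<^esub>]) \<in> word_cong G1 G2 R"
        using word_cong.mult_right[of "inv\<^bsub>G2\<^esub> g" G2 g G1 R] g by simp
      then have "([Inr (inv\<^bsub>G2\<^esub> g), Inr g], []) \<in> word_cong G1 G2 R"
        using word_cong.one_right word_cong.trans by blast
      then show ?thesis using Inr g by blast
    qed
    then obtain l' where l': "l' \<in> carrier G1 <+> carrier G2" "([l', l], []) \<in> word_cong G1 G2 R" by blast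
    have "(w' @ [l', l] @ w, w' @ [] @ w) \<in> word_cong G1 G2 R"
      using l' w w' by (intro word_cong.append word_cong.refl)
    then have "((w' @ [l']) @ l # w, []) \<in> word_cong G1 G2 R" using w'(2) word_cong.trans by fastforce
    then show ?case using w'(1) l'(1) by (intro bexI[of _ "w' @ [l']"]) auto
  qed
  then show thesis using that by blast
qed

lemma group_word_quotient: "group (word_quotient G1 G2 R)"
proof (rule groupI)
  let ?Q = "word_quotient G1 G2 R"
  have app: "u @ v \<in> words G1 G2" if "u \<in> words G1 G2" "v \<in> words G1 G2" for u v
    using that by simp
  note m = mult_word_quotient app
  show "x \<otimes>\<^bsub>?Q\<^esub> y \<in> carrier ?Q" if "x \<in> carrier ?Q" "y \<in> carrier ?Q" for x y
    using that unfolding carrier_word_quotient by (elim imageE) (metis m imageI)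
  show "\<one>\<^bsub>?Q\<^esub> \<in> carrier ?Q" unfolding carrier_word_quotient one_word_quotient by (intro imageI) simp
  show "x \<otimes>\<^bsub>?Q\<^esub> y \<otimes>\<^bsub>?Q\<^esub> z = x \<otimes>\<^bsub>?Q\<^esub> (y \<otimes>\<^bsub>?Q\<^esub> z)"
    if "x \<in> carrier ?Q" "y \<in> carrier ?Q" "z \<in> carrier ?Q" for x y z
    using that unfolding carrier_word_quotient by (elim imageE) (metis m append_assoc)
  show "\<one>\<^bsub>?Q\<^esub> \<otimes>\<^bsub>?Q\<^esub> x = x" if "x \<in> carrier ?Q" for x
    using that unfolding carrier_word_quotient one_word_quotient
    by (elim imageE) (metis m append_Nil lists.Nil)
  show "\<exists>y\<in>carrier ?Q. y \<otimes>\<^bsub>?Q\<^esub> x = \<one>\<^bsub>?Q\<^esub>" if "x \<in> carrier ?Q" for x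
  proof -
    from that obtain w where w: "w \<in> words G1 G2" "x = word_class G1 G2 R w"
      by (auto simp: carrier_word_quotient)
    obtain w' where w': "w' \<in> words G1 G2" "(w' @ w, []) \<in> word_cong G1 G2 R"
      by (rule word_left_inverse[OF w(1)])
    then have "word_class G1 G2 R w' \<otimes>\<^bsub>?Q\<^esub> x = \<one>\<^bsub>?Q\<^esub>"
      unfolding w(2) mult_word_quotient[OF w'(1) w(1)] one_word_quotient
      using word_class_eq_iff[OF app[OF w'(1) w(1)] lists.Nil] w'(2) by blast
    then show ?thesis using w'(1) unfolding carrier_word_quotient by blast
  qed
qed

lemma countable_word_quotient:
  "countable (carrier G1) \<Longrightarrow> countable (carrier G2) \<Longrightarrow> countable (carrier (word_quotient G1 G2 R))"
  unfolding carrier_word_quotient by (intro countable_image countable_lists countable_Plus)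

section \<open>Actions of words\<close>

lemma word_act_closed:
  assumes "\<And>g x. g \<in> carrier G1 \<Longrightarrow> x \<in> M \<Longrightarrow> a g x \<in> M"
    and "\<And>g x. g \<in> carrier G2 \<Longrightarrow> x \<in> M \<Longrightarrow> b g x \<in> M"
    and "w \<in> words G1 G2" "x \<in> M"
  shows "word_act a b w x \<in> M"
  using assms(3)
proof (induction w)
  case (Cons l w)
  then show ?case using assms(1,2) by (cases l) auto
qed (use assms in simp)

text \<open>The universal property of the quotient, for actions: a generating relation within one
  factor holds as that factor acts, and an identification holds as the two actions agree along
  \<open>R\<close>.\<close>

lemma word_act_cong:
  assumes a: "\<And>g x. g \<in> carrier G1 \<Longrightarrow> x \<in> M \<Longrightarrow> a g x \<in> M" "\<And>x. x \<in> M \<Longrightarrow> a \<one>\<^bsub>G1\<^esub> x = x"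
      "\<And>g h x. g \<in> carrier G1 \<Longrightarrow> h \<in> carrier G1 \<Longrightarrow> x \<in> M \<Longrightarrow> a (g \<otimes>\<^bsub>G1\<^esub> h) x = a g (a h x)"
    and b: "\<And>g x. g \<in> carrier G2 \<Longrightarrow> x \<in> M \<Longrightarrow> b g x \<in> M" "\<And>x. x \<in> M \<Longrightarrow> b \<one>\<^bsub>G2\<^esub> x = x"
      "\<And>g h x. g \<in> carrier G2 \<Longrightarrow> h \<in> carrier G2 \<Longrightarrow> x \<in> M \<Longrightarrow> b (g \<otimes>\<^bsub>G2\<^esub> h) x = b g (b h x)"
    and ab: "\<And>g h x. (g, h) \<in> R \<Longrightarrow> x \<in> M \<Longrightarrow> a g x = b h x"
    and "(u, v) \<in> word_cong G1 G2 R" "x \<in> M"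
  shows "word_act a b u x = word_act a b v x"
  using assms(8,9)
proof (induction arbitrary: x rule: word_cong.induct)
  case (append u u' v v')
  have "v' \<in> words G1 G2" using append.hyps word_cong_words by blast
  then have "word_act a b v' x \<in> M" using append.prems by (intro word_act_closed[of M a b] a b)
  then show ?case using append by simp
qed (use a b ab in auto)

text \<open>This reduces the task to two actions on \<open>U\<close> that agree along
  \<open>R\<close>: homogeneity and faithfulness are to be checked on words, and a finite partial
  isometry is given by its graph \<open>\<Phi>\<close>.\<close>

lemma word_quotient_in_homogeneous_groups:
  assumes "countable (carrier G1)" "countable (carrier G2)"
    and a: "isometric_on G1 (carrier G1) U a d" and b: "isometric_on G2 (carrier G2) U b d"
    and ab: "\<And>g h x. (g, h) \<in> R \<Longrightarrow> x \<in> U \<Longrightarrow> a g x = b h x"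
    and homog: "\<And>\<Phi>. finite \<Phi> \<Longrightarrow> \<Phi> \<subseteq> U \<times> U \<Longrightarrow>
      (\<And>x y x' y'. (x, y) \<in> \<Phi> \<Longrightarrow> (x', y') \<in> \<Phi> \<Longrightarrow> d x x' = d y y') \<Longrightarrow>
      \<exists>w\<in>words G1 G2. \<forall>(x, y)\<in>\<Phi>. word_act a b w x = y"
    and faithful: "\<And>w. w \<in> words G1 G2 \<Longrightarrow> (\<And>x. x \<in> U \<Longrightarrow> word_act a b w x = x) \<Longrightarrow>
      (w, []) \<in> word_cong G1 G2 R"
  shows "word_quotient G1 G2 R \<in> \<H> U d"
proof -
  let ?Q = "word_quotient G1 G2 R"
  note ia = isometric_onD[OF a] and ib = isometric_onD[OF b]
  have closed: "word_act a b w x \<in> U" if "w \<in> words G1 G2" "x \<in> U" for w x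
    using that by (intro word_act_closed[of U a b] ia ib)
  have cong: "word_act a b u x = word_act a b v x" if "(u, v) \<in> word_cong G1 G2 R" "x \<in> U" for u v x
    by (rule word_act_cong[of U a b, OF ia(2,1,3) ib(2,1,3) ab that])
  \<comment> \<open>\<open>Bij U\<close> consists of extensional functions, hence the restriction to
    \<open>U\<close>; by \<open>cong\<close> the choice of the representative does not
    matter.\<close>
  define \<phi> where "\<phi> A = (\<lambda>x\<in>U. word_act a b (SOME w. w \<in> A) x)" for A
  have \<phi>: "\<phi> (word_class G1 G2 R w) = (\<lambda>x\<in>U. word_act a b w x)" if "w \<in> words G1 G2" for w
  proof -
    have "(SOME v. v \<in> word_class G1 G2 R w) \<in> word_class G1 G2 R w"
      using word_class_self[OF that] by (rule someI)
    then have "(w, SOME v. v \<in> word_class G1 G2 R w) \<in> word_cong G1 G2 R" by (simp add: word_class_def)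
    then show ?thesis unfolding \<phi>_def using cong by (intro restrict_ext) simp
  qed
  have iso: "d (word_act a b w x) (word_act a b w y) = d x y"
    if "w \<in> words G1 G2" "x \<in> U" "y \<in> U" for w x y
    using that(1)
  proof (induction w)
    case (Cons l w)
    then have w: "w \<in> words G1 G2" by auto
    show ?case
      using Cons closed[OF w] that ia(4) ib(4) by (cases l) auto
  qed simp
  have bij: "\<phi> A \<in> Bij U" if "A \<in> carrier ?Q" for A
  proof -
    from that obtain w where w: "w \<in> words G1 G2" "A = word_class G1 G2 R w"
      by (auto simp: carrier_word_quotient)
    obtain w' where w': "w' \<in> words G1 G2" "(w' @ w, []) \<in> word_cong G1 G2 R"
      by (rule word_left_inverse[OF w(1)])
    \<comment> \<open>A left inverse \<open>w'\<close> of \<open>w\<close> that has a left inverse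
      \<open>w''\<close> itself acts on \<open>U\<close> as a two-sided inverse.\<close>
    obtain w'' where w'': "w'' \<in> words G1 G2" "(w'' @ w', []) \<in> word_cong G1 G2 R"
      by (rule word_left_inverse[OF w'(1)])
    have 1: "word_act a b w' (word_act a b w x) = x" if "x \<in> U" for x
      using cong[OF w'(2) that] by simp
    have 2: "word_act a b w'' (word_act a b w' x) = x" if "x \<in> U" for x
      using cong[OF w''(2) that] by simp
    have 3: "word_act a b w (word_act a b w' x) = x" if "x \<in> U" for x
      using 1 2 closed w'(1) w(1) that by metis
    have "bij_betw (word_act a b w) U U"
      by (rule bij_betw_byWitness[where f' = "word_act a b w'"]) (use 1 3 closed w w' in auto)
    then show ?thesis
      using w \<phi> by (auto simp: Bij_def cong: bij_betw_cong)
  qed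
  have hom: "\<phi> \<in> hom ?Q (BijGroup U)"
  proof (rule homI)
    show "\<phi> A \<in> carrier (BijGroup U)" if "A \<in> carrier ?Q" for A
      using bij[OF that] by (simp add: BijGroup_def)
    fix A B assume AB: "A \<in> carrier ?Q" "B \<in> carrier ?Q"
    then obtain u v where u: "u \<in> words G1 G2" "A = word_class G1 G2 R u"
      and v: "v \<in> words G1 G2" "B = word_class G1 G2 R v"
      by (auto simp: carrier_word_quotient)
    have uv: "u @ v \<in> words G1 G2" using u v by auto
    have "\<phi> (A \<otimes>\<^bsub>?Q\<^esub> B) = compose U (\<phi> A) (\<phi> B)"
      using closed[OF v(1)] unfolding u(2) v(2) mult_word_quotient[OF u(1) v(1)] \<phi>[OF u(1)] \<phi>[OF v(1)] \<phi>[OF uv]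
      by (auto simp: compose_def fun_eq_iff)
    then show "\<phi> (A \<otimes>\<^bsub>?Q\<^esub> B) = \<phi> A \<otimes>\<^bsub>BijGroup U\<^esub> \<phi> B"
      using bij AB by (simp add: BijGroup_def)
  qed
  have ga: "group_action ?Q U \<phi>"
    using group_word_quotient group_BijGroup hom
    by (auto simp: group_action_def group_hom_def group_hom_axioms_def)
  interpret Q: group_hom ?Q "BijGroup U" \<phi> using ga by (simp add: group_action_def)
  have "A = \<one>\<^bsub>?Q\<^esub>" if "A \<in> carrier ?Q" "\<phi> A = \<one>\<^bsub>BijGroup U\<^esub>" for A
  proof -
    from that obtain w where w: "w \<in> words G1 G2" "A = word_class G1 G2 R w"
      by (auto simp: carrier_word_quotient)
    have "(w, []) \<in> word_cong G1 G2 R"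
    proof (rule faithful[OF w(1)])
      fix x assume "x \<in> U"
      then show "word_act a b w x = x"
        using that(2) \<phi>[OF w(1)] w(2) by (auto simp: BijGroup_def fun_eq_iff restrict_def split: if_splits)
    qed
    then show ?thesis using w by (simp add: one_word_quotient word_class_eq_iff)
  qed
  then have "inj_on \<phi> (carrier ?Q)" using Q.inj_on_one_iff by blast
  then have fa: "faithful_action ?Q U \<phi>"
    using ga by (simp add: faithful_action_def faithful_action_axioms_def)
  have ia: "isometric_action ?Q U d \<phi>"
    unfolding isometric_action_def using ga iso \<phi> by (auto simp: carrier_word_quotient)
  have "\<exists>A\<in>carrier ?Q. \<forall>x\<in>B. \<phi> A x = f x"
    if B: "finite B" "B \<subseteq> U" and C: "C \<subseteq> U" "f ` B = C" "isometric_embedding B d C d f" for B C f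
  proof -
    have "\<exists>w\<in>words G1 G2. \<forall>(x, y)\<in>(\<lambda>x. (x, f x)) ` B. word_act a b w x = y"
      using B C by (intro homog) (auto simp: isometric_embedding_def)
    then obtain w where "w \<in> words G1 G2" "\<And>x. x \<in> B \<Longrightarrow> word_act a b w x = f x" by auto
    then show ?thesis
      using \<phi> B by (intro bexI[of _ "word_class G1 G2 R w"]) (auto simp: carrier_word_quotient)
  qed
  then have "homogeneous_action ?Q U d \<phi>"
    unfolding homogeneous_action_def by (intro conjI allI impI ia) (elim conjE)
  with fa have "\<exists>\<phi>. faithful_action ?Q U \<phi> \<and> homogeneous_action ?Q U d \<phi>" by blast
  then show ?thesis
    unfolding homogeneous_groups_def
    using group_word_quotient countable_word_quotient[OF assms(1,2)] by simp
qed

end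

section \<open>Partial actions of the finite factor\<close>

text \<open>\<open>H\<close> is the copy of the amalgamated subgroup in the first factor and
  \<open>\<theta>\<close> its embedding into the second; the last condition on
  \<open>\<theta>\<close> expresses index at least two. The conditions on \<open>act\<close> are
  those that the generic space supplies.\<close>

locale urysohn_amalgam = G1: group G1 + G2: group G2
  for G1 :: "('a, 'm) monoid_scheme" (structure) and G2 :: "('b, 'n) monoid_scheme" +
  fixes S :: "real set" and U :: "'u set" and d :: "'u \<Rightarrow> 'u \<Rightarrow> real" and act :: "'a \<Rightarrow> 'u \<Rightarrow> 'u"
    and H :: "'a set" and \<theta> :: "'a \<Rightarrow> 'b"
  assumes S: "distance_set S" and U: "countable U" "S_metric_on S U d"
    and act: "isometric_on G1 (carrier G1) U act d"
    and free: "\<And>g x. g \<in> carrier G1 \<Longrightarrow> x \<in> U \<Longrightarrow> act g x = x \<Longrightarrow> g = \<one>"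
    and mixing: "\<And>x y. x \<in> U \<Longrightarrow> y \<in> U \<Longrightarrow> finite {g \<in> carrier G1. d (act g x) y < 1}"
    and extension: "orbit_extension G1 S U act d"
    and G2_finite: "finite (carrier G2)"
    and hcf: "highly_core_free H G1"
    and \<theta>: "\<theta> \<in> hom (G1\<lparr>carrier := H\<rparr>) G2" "inj_on \<theta> H" "\<not> carrier G2 \<subseteq> \<theta> ` H"
begin

lemma H: "subgroup H G1" using hcf by (simp add: highly_core_free_def)

sublocale H: subgroup H G1 by (rule H)

lemma \<theta>_closed: "h \<in> H \<Longrightarrow> \<theta> h \<in> carrier G2"
  using \<theta>(1) by (auto simp: hom_def)

lemma \<theta>_mult: "h \<in> H \<Longrightarrow> k \<in> H \<Longrightarrow> \<theta> (h \<otimes> k) = \<theta> h \<otimes>\<^bsub>G2\<^esub> \<theta> k"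
  using \<theta>(1) by (auto simp: hom_def)

lemma \<theta>_group_hom: "group_hom (G1\<lparr>carrier := H\<rparr>) G2 \<theta>"
  using G1.subgroup_imp_group[OF H] G2.group_axioms \<theta>(1)
  by (simp add: group_hom_def group_hom_axioms_def)

lemma \<theta>_image: "subgroup (\<theta> ` H) G2"
  using group_hom.img_is_subgroup[OF \<theta>_group_hom] by simp

sublocale \<theta>H: subgroup "\<theta> ` H" G2 by (rule \<theta>_image)

lemma \<theta>_one: "\<theta> \<one> = \<one>\<^bsub>G2\<^esub>"
  using group_hom.hom_one[OF \<theta>_group_hom] by simp

text \<open>This finiteness makes the extension property, stated for finite subgroups, applicable to
  the amalgamated subgroup.\<close>

lemma finite_H: "finite H"
  using \<theta>(2) \<theta>_closed G2_finite by (meson finite_imageD finite_subset image_subsetI)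

lemmas dist = distance_setD[OF S] and metric = S_metric_onD[OF U(2)] and action = isometric_onD[OF act]

lemma d_le_1: "x \<in> U \<Longrightarrow> y \<in> U \<Longrightarrow> d x y \<le> 1" and d_ge_0: "x \<in> U \<Longrightarrow> y \<in> U \<Longrightarrow> 0 \<le> d x y"
  using metric(1) dist by blast+

lemma act_closed_H: "h \<in> H \<Longrightarrow> x \<in> U \<Longrightarrow> act h x \<in> U"
  using action(2) H.subset by blast

text \<open>Whole \<open>H\<close>-orbits are embedded one after the other: the distances of a
  missing point \<open>z\<close> from the embedded part and from its own translates are orbit data,
  which \<open>orbit_extension\<close> realises. Trivial stabilisers outside \<open>Z0\<close> make
  the map on the new orbit well defined.\<close>

lemma finite_equivariant_embedding:
  fixes Z :: "'z set"
  assumes Z: "finite Z" "S_metric_on S Z dz" "isometric_on G1 H Z az dz"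
    and "Z0 \<subseteq> Z" "\<And>h z. h \<in> H \<Longrightarrow> z \<in> Z0 \<Longrightarrow> az h z \<in> Z0"
    and "\<And>z. z \<in> Z0 \<Longrightarrow> f z \<in> U" "\<And>z z'. z \<in> Z0 \<Longrightarrow> z' \<in> Z0 \<Longrightarrow> d (f z) (f z') = dz z z'"
      "\<And>h z. h \<in> H \<Longrightarrow> z \<in> Z0 \<Longrightarrow> f (az h z) = act h (f z)"
    and "\<And>h z. h \<in> H \<Longrightarrow> z \<in> Z - Z0 \<Longrightarrow> az h z = z \<Longrightarrow> h = \<one>"
  shows "\<exists>f'. (\<forall>z\<in>Z0. f' z = f z) \<and> (\<forall>z\<in>Z. f' z \<in> U) \<and> (\<forall>z\<in>Z. \<forall>z'\<in>Z. d (f' z) (f' z') = dz z z') \<and>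
    (\<forall>h\<in>H. \<forall>z\<in>Z. f' (az h z) = act h (f' z))"
  using assms(4-)
proof (induction "card (Z - Z0)" arbitrary: Z0 f rule: less_induct)
  case less
  note Z0 = less.prems(1,2) and f = less.prems(3-5) and fr = less.prems(6)
  note mz = S_metric_onD[OF Z(2)] and iz = isometric_onD[OF Z(3)]
  show ?case
  proof (cases "Z \<subseteq> Z0")
    case True
    then have "Z = Z0" using Z0 by blast
    then show ?thesis using f by (intro exI[of _ f]) simp
  next
    case False
    then obtain z where z: "z \<in> Z" "z \<notin> Z0" by blast
    have azZ: "az h z \<in> Z" if "h \<in> H" for h using iz(2) z that by blast
    have Z0Z: "y \<in> Z" if "y \<in> Z0" for y using Z0 that by blast
    have az_inv: "az (inv h) (az h y) = y" if "h \<in> H" "y \<in> Z" for h y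
      using iz(3)[of y "inv h" h] iz(1)[of y] that by simp
    have azZ0: "az h z \<notin> Z0" if "h \<in> H" for h
      using az_inv[OF that z(1)] Z0(2)[of "inv h" "az h z"] z that by auto
    have az_inj: "h = k" if "h \<in> H" "k \<in> H" "az h z = az k z" for h k
    proof -
      have "az (inv k \<otimes> h) z = z"
        using iz(3)[of z "inv k" h] az_inv[of k z] z that by simp
      then have "inv k \<otimes> h = \<one>" using fr[of "inv k \<otimes> h" z] z that by simp
      then show ?thesis using that by (metis G1.inv_closed G1.inv_equality G1.inv_inv H.mem_carrier)
    qed
    have f_inj: "inj_on f Z0"
    proof (rule inj_onI)
      fix x y assume "x \<in> Z0" "y \<in> Z0" "f x = f y"
      then show "x = y" using f(2)[of x y] metric(3)[OF f(1) f(1), of x y] mz(3)[of x y] Z0Z by simp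
    qed
    define w where "w u = dz z (inv_into Z0 f u)" for u
    define c where "c h = dz z (az h z)" for h
    have w: "w (f y) = dz z y" if "y \<in> Z0" for y using f_inj that by (simp add: w_def)
    have "orbit_data G1 S H (f ` Z0) act d w c"
      unfolding orbit_data_def
    proof (intro conjI ballI impI)
      fix x assume "x \<in> f ` Z0"
      then obtain y where y: "y \<in> Z0" "x = f y" by blast
      have yZ: "y \<in> Z" "z \<noteq> y" using y Z0Z z by auto
      show "w x \<in> S" using w y mz(1) z yZ by simp
      show "0 < w x" using w y mz(1,3)[OF z(1) yZ(1)] yZ(2) dist(4)[of "dz z y"] by simp
      fix x' assume "x' \<in> f ` Z0"
      then obtain y' where y': "y' \<in> Z0" "x' = f y'" by blast
      show "w x \<le> w x' + d x x'" "d x x' \<le> w x + w x'"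
        using w y y' f(2) mz(4)[OF z(1) Z0Z[OF y'(1)] yZ(1)] mz(4)[OF yZ(1) z(1) Z0Z[OF y'(1)]]
          mz(2)[OF z(1) yZ(1)] mz(2)[OF yZ(1) Z0Z[OF y'(1)]] by simp_all
    next
      fix g assume g: "g \<in> H"
      show "c g \<in> S" using mz(1) z azZ g by (simp add: c_def)
      show "c g = 0 \<longleftrightarrow> g = \<one>"
        using mz(3)[OF z(1) azZ[OF g]] fr[OF g, of z] z iz(1)[OF z(1)] by (auto simp: c_def)
      fix h assume h: "h \<in> H"
      have gh: "az (g \<otimes> h) z = az g (az h z)" using iz(3) z g h by simp
      have gh': "dz (az g z) (az g (az h z)) = dz z (az h z)" using iz(4) z g azZ h by simp
      show "c (g \<otimes> h) \<le> c g + c h"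
        using mz(4)[OF z(1) azZ[OF g] azZ[of "g \<otimes> h"]] g h gh gh' by (simp add: c_def)
      assume "g \<otimes> h = \<one>"
      then have "az g (az h z) = z" using gh iz(1) z by simp
      then show "c g = c h" using gh' mz(2)[OF z(1) azZ[OF g]] by (simp add: c_def)
    next
      fix g x assume g: "g \<in> H" and "x \<in> f ` Z0"
      then obtain y where y: "y \<in> Z0" "x = f y" by blast
      have yZ: "y \<in> Z" using y Z0Z by auto
      have gy: "az g y \<in> Z0" "az g y \<in> Z" using Z0 g y by auto
      have "act g x = f (az g y)" using f(3) g y by simp
      moreover have "dz (az g z) (az g y) = dz z y" using iz(4) z g yZ by simp
      ultimately show "w (act g x) \<le> w x + c g" "c g \<le> w x + w (act g x)"
        using w y gy mz(4)[OF z(1) azZ[OF g] gy(2)] mz(4)[OF z(1) gy(2) azZ[OF g]] mz(2)[OF gy(2) azZ[OF g]]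
        by (simp_all add: c_def)
    qed
    note od = this
    have fin: "finite (f ` Z0)" using Z(1) Z0(1) finite_subset by blast
    have sub: "f ` Z0 \<subseteq> U" using f(1) by blast
    have inva: "act h x \<in> f ` Z0" if "h \<in> H" "x \<in> f ` Z0" for h x
    proof -
      from that(2) obtain y where "y \<in> Z0" "x = f y" by blast
      then show ?thesis using f(3)[OF that(1)] Z0(2)[OF that(1)] by (metis imageI)
    qed
    obtain p where p: "p \<in> U" "\<And>x. x \<in> f ` Z0 \<Longrightarrow> d p x = w x" "\<And>h. h \<in> H \<Longrightarrow> d p (act h p) = c h"
      by (rule orbit_extensionE[OF extension H finite_H fin sub inva od]) (assumption | rule that)+
    \<comment> \<open>A point of the new orbit is \<open>az h z\<close> for exactly one
      \<open>h\<close> in \<open>H\<close>; the choice operator recovers this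
      \<open>h\<close>.\<close>
    define f1 where "f1 x = (if x \<in> Z0 then f x else act (SOME h. h \<in> H \<and> x = az h z) p)" for x
    have f1_Z0: "f1 y = f y" if "y \<in> Z0" for y using that by (simp add: f1_def)
    have f1_az: "f1 (az h z) = act h p" if "h \<in> H" for h
    proof -
      have "(SOME k. k \<in> H \<and> az h z = az k z) = h" using that az_inj by (intro some_equality) auto
      then show ?thesis using azZ0[OF that] by (simp add: f1_def)
    qed
    define Ob where "Ob = (\<lambda>h. az h z) ` H"
    have dp: "d (act h p) (f y) = dz (az h z) y" if h: "h \<in> H" and y: "y \<in> Z0" for h y
    proof -
      let ?y = "az (inv h) y"
      have y': "?y \<in> Z0" "?y \<in> Z" "az h ?y = y"
        using Z0 h y iz(3)[of y h "inv h"] iz(1)[of y] by auto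
      have "f y = act h (f ?y)" using f(3)[OF h y'(1)] y' by simp
      then have "d (act h p) (f y) = d p (f ?y)" using action(4) h p f(1) y' by simp
      also have "\<dots> = dz z ?y" using p(2) w y' by simp
      also have "\<dots> = dz (az h z) y" using iz(4)[OF z(1) h y'(2)] y' by simp
      finally show ?thesis .
    qed
    have dpp: "d (act h p) (act k p) = dz (az h z) (az k z)" if h: "h \<in> H" and k: "k \<in> H" for h k
    proof -
      let ?k = "inv h \<otimes> k"
      have hk: "k = h \<otimes> ?k" "?k \<in> H" using h k by (auto simp flip: G1.m_assoc)
      have "d (act h p) (act k p) = d (act h p) (act h (act ?k p))"
        using action(3)[OF p(1), of h ?k] hk h by simp
      also have "\<dots> = d p (act ?k p)" using action(4) act_closed_H[OF hk(2) p(1)] h p by simp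
      also have "\<dots> = dz z (az ?k z)" using p(3) hk by (simp add: c_def)
      also have "\<dots> = dz (az h z) (az h (az ?k z))" using iz(4)[OF z(1) h azZ[OF hk(2)]] by simp
      also have "\<dots> = dz (az h z) (az k z)" using iz(3)[OF z(1) h hk(2)] hk by simp
      finally show ?thesis .
    qed
    have ObZ: "Ob \<subseteq> Z" using azZ by (auto simp: Ob_def)
    have "\<exists>f'. (\<forall>y\<in>Z0 \<union> Ob. f' y = f1 y) \<and> (\<forall>y\<in>Z. f' y \<in> U) \<and> (\<forall>y\<in>Z. \<forall>y'\<in>Z. d (f' y) (f' y') = dz y y') \<and>
      (\<forall>h\<in>H. \<forall>y\<in>Z. f' (az h y) = act h (f' y))"
    proof (rule less.hyps)
      have "z \<in> Ob" unfolding Ob_def by (rule image_eqI[of _ _ "\<one>"]) (use iz(1) z in simp_all)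
      then show "card (Z - (Z0 \<union> Ob)) < card (Z - Z0)"
        using z Z(1) by (intro psubset_card_mono) auto
      show "Z0 \<union> Ob \<subseteq> Z" using Z0 ObZ by blast
      show "az h y \<in> Z0 \<union> Ob" if hy: "h \<in> H" "y \<in> Z0 \<union> Ob" for h y
      proof (cases "y \<in> Z0")
        case False
        then obtain k where k: "k \<in> H" "y = az k z" using hy by (auto simp: Ob_def)
        then have "az h y = az (h \<otimes> k) z" using iz(3)[OF z(1) hy(1)] by simp
        then show ?thesis using hy(1) k by (auto simp: Ob_def)
      qed (use hy Z0(2) in blast)
      show "f1 y \<in> U" if "y \<in> Z0 \<union> Ob" for y
        using that f(1) p f1_Z0 f1_az act_closed_H by (auto simp: Ob_def)
      show "d (f1 y) (f1 y') = dz y y'" if y: "y \<in> Z0 \<union> Ob" "y' \<in> Z0 \<union> Ob" for y y'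
      proof -
        have "d (f y) (act h p) = dz y (az h z)" if "h \<in> H" "y \<in> Z0" for h y
          using dp[OF that] metric(2)[OF f(1) act_closed_H[OF _ p(1)], of y h] mz(2)[OF azZ Z0Z, of h y] that by simp
        then show ?thesis using y f(2) dp dpp f1_Z0 f1_az by (auto simp: Ob_def)
      qed
      show "f1 (az h y) = act h (f1 y)" if h: "h \<in> H" and y: "y \<in> Z0 \<union> Ob" for h y
      proof -
        have "f1 (az h (az k z)) = act h (act k p)" if "k \<in> H" for k
          using f1_az[of "h \<otimes> k"] iz(3)[OF z(1) h that] action(3)[OF p(1), of h k] h that by simp
        then show ?thesis using y f(3)[OF h] f1_Z0 Z0(2)[OF h] f1_az by (auto simp: Ob_def)
      qed
      show "h = \<one>" if "h \<in> H" "y \<in> Z - (Z0 \<union> Ob)" "az h y = y" for h y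
        using fr that by blast
    qed
    then show ?thesis using f1_Z0 by (elim ex_forward) auto
  qed
qed

section \<open>Finite partial actions and their extensions\<close>

definition partial_action :: "'u set \<Rightarrow> ('b \<Rightarrow> 'u \<Rightarrow> 'u) \<Rightarrow> bool" where
  "partial_action Y b \<longleftrightarrow> finite Y \<and> Y \<subseteq> U \<and> isometric_on G2 (carrier G2) Y b d \<and>
     (\<forall>h\<in>H. \<forall>y\<in>Y. b (\<theta> h) y = act h y)"

definition extends :: "'u set \<times> ('b \<Rightarrow> 'u \<Rightarrow> 'u) \<Rightarrow> 'u set \<times> ('b \<Rightarrow> 'u \<Rightarrow> 'u) \<Rightarrow> bool" where
  "extends = (\<lambda>(Y, b) (Y', b'). Y \<subseteq> Y' \<and> (\<forall>k\<in>carrier G2. \<forall>y\<in>Y. b' k y = b k y))"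

lemma partial_actionD:
  assumes "partial_action Y b"
  shows "finite Y" "Y \<subseteq> U" "isometric_on G2 (carrier G2) Y b d"
    "h \<in> H \<Longrightarrow> y \<in> Y \<Longrightarrow> b (\<theta> h) y = act h y"
  using assms by (auto simp: partial_action_def)

lemma partial_action_transport:
  assumes Z: "finite Z" "S_metric_on S Z dz" "isometric_on G2 (carrier G2) Z bz dz"
    and f: "\<And>z. z \<in> Z \<Longrightarrow> f z \<in> U" "\<And>z z'. z \<in> Z \<Longrightarrow> z' \<in> Z \<Longrightarrow> d (f z) (f z') = dz z z'"
      "\<And>h z. h \<in> H \<Longrightarrow> z \<in> Z \<Longrightarrow> f (bz (\<theta> h) z) = act h (f z)"
  obtains b where "partial_action (f ` Z) b" "\<And>k z. z \<in> Z \<Longrightarrow> b k (f z) = f (bz k z)"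
proof -
  note iz = isometric_onD[OF Z(3)]
  have f_inj: "inj_on f Z"
  proof (rule inj_onI)
    fix x y assume "x \<in> Z" "y \<in> Z" "f x = f y"
    then show "x = y" using f(2)[of x y] metric(3)[OF f(1) f(1), of x y] S_metric_onD(3)[OF Z(2), of x y] by simp
  qed
  define b where "b k u = f (bz k (inv_into Z f u))" for k u
  have b: "b k (f z) = f (bz k z)" if "z \<in> Z" for k z using f_inj that by (simp add: b_def)
  have "partial_action (f ` Z) b"
    unfolding partial_action_def isometric_on_def
  proof (intro conjI ballI)
    show "finite (f ` Z)" using Z by simp
    show "f ` Z \<subseteq> U" using f by blast
  next
    fix x assume "x \<in> f ` Z"
    then obtain z where z: "z \<in> Z" "x = f z" by blast
    then show "b \<one>\<^bsub>G2\<^esub> x = x" using b iz(1) by simp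
    show "b (\<theta> h) x = act h x" if "h \<in> H" for h using z b f(3) that by simp
    fix g assume g: "g \<in> carrier G2"
    show "b g x \<in> f ` Z" using z b iz(2) g by simp
    show "b (g \<otimes>\<^bsub>G2\<^esub> h) x = b g (b h x)" if "h \<in> carrier G2" for h
      using z b iz(2,3) g that by simp
    fix y assume "y \<in> f ` Z"
    then obtain z' where "z' \<in> Z" "y = f z'" by blast
    then show "d (b g x) (b g y) = d x y" using z b f(2) iz(2,4) g by simp
  qed
  then show thesis using that b by blast
qed

text \<open>
  The new points \<open>(l, i)\<close> with \<open>l \<in> L\<close> have prescribed images \<open>f0 l i\<close> in the Urysohn space; the
  other ones find a place by the extension property.
\<close>

lemma adjoin_free_orbits:
  fixes A :: "'i set" and dz :: "'u + 'b \<times> 'i \<Rightarrow> 'u + 'b \<times> 'i \<Rightarrow> real"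
  assumes Y: "partial_action Y b" and A: "finite A"
    and bz: "\<And>k y. bz k (Inl y) = Inl (b k y)" "\<And>k l i. bz k (Inr (l, i)) = Inr (k \<otimes>\<^bsub>G2\<^esub> l, i)"
    and Z: "Z = Inl ` Y \<union> Inr ` (carrier G2 \<times> A)"
    and dz: "S_metric_on S Z dz" "isometric_on G2 (carrier G2) Z bz dz"
      "\<And>y y'. y \<in> Y \<Longrightarrow> y' \<in> Y \<Longrightarrow> dz (Inl y) (Inl y') = d y y'"
    and L: "L \<subseteq> carrier G2" "\<And>h l. h \<in> H \<Longrightarrow> l \<in> L \<Longrightarrow> \<theta> h \<otimes>\<^bsub>G2\<^esub> l \<in> L"
    and f0: "\<And>l i. l \<in> L \<Longrightarrow> i \<in> A \<Longrightarrow> f0 l i \<in> U"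
      "\<And>l i y. l \<in> L \<Longrightarrow> i \<in> A \<Longrightarrow> y \<in> Y \<Longrightarrow> d (f0 l i) y = dz (Inr (l, i)) (Inl y)"
      "\<And>l i l' i'. l \<in> L \<Longrightarrow> i \<in> A \<Longrightarrow> l' \<in> L \<Longrightarrow> i' \<in> A \<Longrightarrow>
         d (f0 l i) (f0 l' i') = dz (Inr (l, i)) (Inr (l', i'))"
      "\<And>h l i. h \<in> H \<Longrightarrow> l \<in> L \<Longrightarrow> i \<in> A \<Longrightarrow> f0 (\<theta> h \<otimes>\<^bsub>G2\<^esub> l) i = act h (f0 l i)"
  shows "\<exists>Y' b' f. partial_action Y' b' \<and> extends (Y, b) (Y', b') \<and>
    (\<forall>l\<in>L. \<forall>i\<in>A. f l i = f0 l i) \<and>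
    (\<forall>l\<in>carrier G2. \<forall>i\<in>A. f l i \<in> Y' \<and> (\<forall>k\<in>carrier G2. b' k (f l i) = f (k \<otimes>\<^bsub>G2\<^esub> l) i))"
proof -
  note y = partial_actionD[OF Y] and ib = isometric_onD[OF partial_actionD(3)[OF Y]]
  have YU: "x \<in> U" if "x \<in> Y" for x using y that by blast
  define f1 where "f1 = case_sum (\<lambda>x. x) (\<lambda>(l, i). f0 l i)"
  define Z0 where "Z0 = Inl ` Y \<union> Inr ` (L \<times> A)"
  have fZ: "finite Z" unfolding Z using y A G2_finite by simp
  \<comment> \<open>Through \<open>\<theta>\<close> the configuration becomes an
    \<open>H\<close>-space. On the points \<open>(l, i)\<close> the subgroup acts by left
    translation, hence with the trivial stabilisers that the embedding lemma demands.\<close>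
  have iH: "isometric_on G1 H Z (\<lambda>h. bz (\<theta> h)) dz"
    using isometric_onD[OF dz(2)] \<theta>_closed \<theta>_one \<theta>_mult unfolding isometric_on_def by simp
  have "\<exists>f'. (\<forall>z\<in>Z0. f' z = f1 z) \<and> (\<forall>z\<in>Z. f' z \<in> U) \<and> (\<forall>z\<in>Z. \<forall>z'\<in>Z. d (f' z) (f' z') = dz z z') \<and>
    (\<forall>h\<in>H. \<forall>z\<in>Z. f' (bz (\<theta> h) z) = act h (f' z))"
  proof (rule finite_equivariant_embedding[OF fZ dz(1) iH])
    show Z0: "Z0 \<subseteq> Z" using L by (auto simp: Z Z0_def)
    show "bz (\<theta> h) z \<in> Z0" if "h \<in> H" "z \<in> Z0" for h z
      using that L bz ib(2) \<theta>_closed by (auto simp: Z0_def)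
    show f1U: "f1 z \<in> U" if "z \<in> Z0" for z using that YU f0(1) by (auto simp: Z0_def f1_def)
    show "d (f1 z) (f1 z') = dz z z'" if z: "z \<in> Z0" "z' \<in> Z0" for z z'
    proof -
      have sym: "d (f1 z) (f1 z') = d (f1 z') (f1 z)" "dz z z' = dz z' z"
        using metric(2) f1U z S_metric_onD(2)[OF dz(1)] Z0 by blast+
      from z consider y y' where "z = Inl y" "z' = Inl y'" "y \<in> Y" "y' \<in> Y"
        | y l i where "z = Inl y" "z' = Inr (l, i)" "y \<in> Y" "l \<in> L" "i \<in> A"
        | y l i where "z' = Inl y" "z = Inr (l, i)" "y \<in> Y" "l \<in> L" "i \<in> A"
        | l i l' i' where "z = Inr (l, i)" "z' = Inr (l', i')" "l \<in> L" "i \<in> A" "l' \<in> L" "i' \<in> A"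
        unfolding Z0_def by blast
      then show ?thesis
      proof cases
        case 1 then show ?thesis using dz(3) by (simp add: f1_def)
      next
        case 2 then show ?thesis using f0(2) sym by (simp add: f1_def)
      next
        case 3 then show ?thesis using f0(2) by (simp add: f1_def)
      next
        case 4 then show ?thesis using f0(3) by (simp add: f1_def)
      qed
    qed
    show "f1 (bz (\<theta> h) z) = act h (f1 z)" if "h \<in> H" "z \<in> Z0" for h z
      using that f0(4) bz y(4) by (auto simp: Z0_def f1_def)
    show "h = \<one>" if "h \<in> H" "z \<in> Z - Z0" "bz (\<theta> h) z = z" for h z
    proof -
      from that(2) obtain l i where "z = Inr (l, i)" "l \<in> carrier G2" by (auto simp: Z Z0_def)
      then have "\<theta> h \<otimes>\<^bsub>G2\<^esub> l = l" using that bz by simp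
      then have "\<theta> h = \<theta> \<one>"
        using \<open>l \<in> carrier G2\<close> \<theta>_closed[OF that(1)] \<theta>_one by (simp add: G2.r_cancel_one)
      then show ?thesis using \<theta>(2) that(1) by (auto simp: inj_on_def)
    qed
  qed
  then obtain f' where f': "\<And>z. z \<in> Z0 \<Longrightarrow> f' z = f1 z" "\<And>z. z \<in> Z \<Longrightarrow> f' z \<in> U"
    "\<And>z z'. z \<in> Z \<Longrightarrow> z' \<in> Z \<Longrightarrow> d (f' z) (f' z') = dz z z'"
    "\<And>h z. h \<in> H \<Longrightarrow> z \<in> Z \<Longrightarrow> f' (bz (\<theta> h) z) = act h (f' z)"
    by blast
  obtain b' where b': "partial_action (f' ` Z) b'" "\<And>k z. z \<in> Z \<Longrightarrow> b' k (f' z) = f' (bz k z)"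
    by (rule partial_action_transport[OF fZ dz(1,2) f'(2-4)]) (assumption | rule that)+
  have f'Y: "f' (Inl x) = x" if "x \<in> Y" for x using f'(1)[of "Inl x"] that by (simp add: Z0_def f1_def)
  have "extends (Y, b) (f' ` Z, b')"
    unfolding extends_def split
  proof (intro conjI subsetI ballI)
    show "x \<in> f' ` Z" if "x \<in> Y" for x using f'Y[OF that] that Z by force
    show "b' k x = b k x" if "k \<in> carrier G2" "x \<in> Y" for k x
      using b'(2)[of "Inl x" k] f'Y ib(2)[of x k] that bz Z by simp
  qed
  moreover have "f' (Inr (l, i)) = f0 l i" if "l \<in> L" "i \<in> A" for l i
    using f'(1)[of "Inr (l, i)"] that by (simp add: Z0_def f1_def)
  moreover have "f' (Inr (l, i)) \<in> f' ` Z \<and>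
      (\<forall>k\<in>carrier G2. b' k (f' (Inr (l, i))) = f' (Inr (k \<otimes>\<^bsub>G2\<^esub> l, i)))"
    if "l \<in> carrier G2" "i \<in> A" for l i
    using b'(2)[of "Inr (l, i)"] that bz Z by simp
  ultimately show ?thesis using b'(1)
    by (intro exI[of _ "f' ` Z"] exI[of _ b'] exI[of _ "\<lambda>l i. f' (Inr (l, i))"]) simp
qed

text \<open>The \<open>H\<close>-orbit of \<open>x\<close> is dictated by \<open>act\<close>, while
  the rest of its orbit under the second factor may be chosen. The distances within that
  \<open>H\<close>-orbit and to \<open>Y\<close> are orbit data for the image of
  \<open>\<theta>\<close>; their shortest-path extension to the whole factor gives a finite metric
  space, which embeds over the points already placed.\<close>

lemma extend_domain:
  assumes Y: "partial_action Y b" and x: "x \<in> U"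
  shows "\<exists>Y' b'. partial_action Y' b' \<and> extends (Y, b) (Y', b') \<and> x \<in> Y'"
proof (cases "x \<in> Y")
  case True
  then show ?thesis using Y by (intro exI[of _ Y] exI[of _ b]) (auto simp: extends_def)
next
  case False
  note y = partial_actionD[OF Y] and ib = isometric_onD[OF partial_actionD(3)[OF Y]]
  have YU: "u \<in> U" if "u \<in> Y" for u using y that by blast
  define \<zeta> where "\<zeta> = inv_into H \<theta>"
  have \<zeta>: "\<zeta> (\<theta> h) = h" if "h \<in> H" for h using \<theta>(2) that by (simp add: \<zeta>_def)
  define c0 where "c0 k = d x (act (\<zeta> k) x)" for k
  have c0: "c0 (\<theta> h) = d x (act h x)" if "h \<in> H" for h using \<zeta> that by (simp add: c0_def)
  have mY: "S_metric_on S Y d" using S_metric_on_subset[OF U(2) y(2)] .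
  have ax: "act h x \<in> U" if "h \<in> H" for h using act_closed_H x that by blast
  have "orbit_data G2 S (\<theta> ` H) Y b d (d x) c0"
    unfolding orbit_data_def
  proof (intro conjI ballI impI)
    fix u assume u: "u \<in> Y"
    show "d x u \<in> S" using metric(1) x YU u by blast
    show "0 < d x u" using metric(3)[OF x YU[OF u]] d_ge_0[OF x YU[OF u]] False u by force
    fix v assume v: "v \<in> Y"
    show "d x u \<le> d x v + d u v" using metric(4)[OF x YU[OF v] YU[OF u]] metric(2)[OF YU[OF v] YU[OF u]] by simp
    show "d u v \<le> d x u + d x v" using metric(4)[OF YU[OF u] x YU[OF v]] metric(2)[OF x YU[OF u]] by simp
  next
    fix g' assume "g' \<in> \<theta> ` H"
    then obtain g where g: "g \<in> H" "g' = \<theta> g" by blast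
    show "c0 g' \<in> S" using c0 g metric(1) x ax by simp
    have "act g x = x \<longleftrightarrow> g = \<one>" using free[of g x] g x action(1) by auto
    moreover have "g' = \<one>\<^bsub>G2\<^esub> \<longleftrightarrow> g = \<one>"
      using \<theta>(2) g by (metis \<theta>_one H.one_closed inj_on_eq_iff)
    ultimately show "c0 g' = 0 \<longleftrightarrow> g' = \<one>\<^bsub>G2\<^esub>"
      using c0 g metric(3)[OF x ax[OF g(1)]] by auto
    fix h' assume "h' \<in> \<theta> ` H"
    then obtain h where h: "h \<in> H" "h' = \<theta> h" by blast
    have gh: "act (g \<otimes> h) x = act g (act h x)" using action(3) g h x by simp
    have gh': "d (act g x) (act g (act h x)) = d x (act h x)" using action(4) x g ax h by simp
    have cgh: "c0 (g' \<otimes>\<^bsub>G2\<^esub> h') = d x (act g (act h x))"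
      using c0[of "g \<otimes> h"] \<theta>_mult g h gh by simp
    show "c0 (g' \<otimes>\<^bsub>G2\<^esub> h') \<le> c0 g' + c0 h'"
      unfolding cgh using metric(4)[OF x ax[OF g(1)] ax[of "g \<otimes> h"]] g h gh gh' c0 by simp
    assume "g' \<otimes>\<^bsub>G2\<^esub> h' = \<one>\<^bsub>G2\<^esub>"
    then have "\<theta> (g \<otimes> h) = \<theta> \<one>" using \<theta>_mult \<theta>_one g h by simp
    then have "g \<otimes> h = \<one>" using \<theta>(2) g h by (auto simp: inj_on_def)
    then have "act g (act h x) = x" using gh action(1) x by simp
    then show "c0 g' = c0 h'" using gh' metric(2)[OF x ax[OF g(1)]] c0 g h by simp
  next
    fix g' u assume "g' \<in> \<theta> ` H" and u: "u \<in> Y"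
    then obtain g where g: "g \<in> H" "g' = \<theta> g" by blast
    have bu: "b g' u = act g u" using y(4) g u by simp
    have guU: "act g u \<in> U" using act_closed_H g YU u by blast
    have "d (act g x) (act g u) = d x u" using action(4) x g YU u by simp
    then show "d x (b g' u) \<le> d x u + c0 g'" "c0 g' \<le> d x u + d x (b g' u)"
      unfolding bu using metric(4)[OF x ax[OF g(1)] guU] metric(4)[OF x guU ax[OF g(1)]] metric(2)[OF guU ax[OF g(1)]] c0 g
      by simp_all
  qed
  moreover have "finite {u \<in> Y. d x u < 1}" using y(1) by simp
  ultimately obtain c where c: "orbit_data G2 S (carrier G2) Y b d (d x) c" "\<And>k. k \<in> \<theta> ` H \<Longrightarrow> c k = c0 k"
    using orbit_data_extend_group[OF S G2.group_axioms \<theta>_image mY y(3)] by metis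
  define bz :: "'b \<Rightarrow> 'u + 'b \<times> unit \<Rightarrow> 'u + 'b \<times> unit" where
    "bz k z = (case z of Inl u \<Rightarrow> Inl (b k u) | Inr (l, i) \<Rightarrow> Inr (k \<otimes>\<^bsub>G2\<^esub> l, i))" for k z
  have bz: "bz k (Inl u) = Inl (b k u)" "bz k (Inr (l, i)) = Inr (k \<otimes>\<^bsub>G2\<^esub> l, i)" for k u l i
    by (simp_all add: bz_def)
  define dz :: "'u + 'b \<times> unit \<Rightarrow> 'u + 'b \<times> unit \<Rightarrow> real" where
    "dz z z' = (case z of
        Inl u \<Rightarrow> (case z' of Inl v \<Rightarrow> d u v | Inr (l, _) \<Rightarrow> d x (b (inv\<^bsub>G2\<^esub> l) u))
      | Inr (k, _) \<Rightarrow> (case z' of Inl v \<Rightarrow> d x (b (inv\<^bsub>G2\<^esub> k) v) | Inr (l, _) \<Rightarrow> c (inv\<^bsub>G2\<^esub> k \<otimes>\<^bsub>G2\<^esub> l)))" for z z'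
  have dz: "dz (Inl u) (Inl v) = d u v" "dz (Inl u) (Inr (l, i)) = d x (b (inv\<^bsub>G2\<^esub> l) u)"
    "dz (Inr (l, i)) (Inl u) = d x (b (inv\<^bsub>G2\<^esub> l) u)"
    "dz (Inr (k, i)) (Inr (l, i')) = c (inv\<^bsub>G2\<^esub> k \<otimes>\<^bsub>G2\<^esub> l)" for u v k l i i'
    by (simp_all add: dz_def)
  define W :: "('u + 'b \<times> unit) set" where "W = Inl ` Y"
  define p :: "'b \<Rightarrow> 'u + 'b \<times> unit" where "p k = Inr (k, ())" for k
  have W1: "S_metric_on S W dz" using mY by (simp add: W_def S_metric_on_def dz)
  have W2: "isometric_on G2 (carrier G2) W bz dz"
    using y(3) unfolding W_def isometric_on_def by (auto simp: dz bz)
  have W3: "orbit_data G2 S (carrier G2) W bz dz (\<lambda>z. d x (projl z)) c"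
    using c(1) unfolding W_def orbit_data_def by (simp add: dz bz)
  have pinj: "inj_on p (carrier G2)" by (auto simp: p_def inj_on_def)
  have Zeq: "W \<union> p ` carrier G2 = Inl ` Y \<union> Inr ` (carrier G2 \<times> {()})" by (auto simp: W_def p_def)
  have pW: "p g \<notin> W" for g by (auto simp: p_def W_def)
  have ad: "S_metric_on S (W \<union> p ` carrier G2) dz" "isometric_on G2 (carrier G2) (W \<union> p ` carrier G2) bz dz"
    by (rule adjoin_orbit[OF S G2.group_axioms W1 W2 W3 pinj pW]; (auto simp: p_def W_def bz dz; fail))+
  have ex: "\<exists>Y' b' f. partial_action Y' b' \<and> extends (Y, b) (Y', b') \<and>
    (\<forall>l\<in>\<theta> ` H. \<forall>i\<in>{()}. f l i = act (\<zeta> l) x) \<and>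
    (\<forall>l\<in>carrier G2. \<forall>i\<in>{()}. f l i \<in> Y' \<and> (\<forall>k\<in>carrier G2. b' k (f l i) = f (k \<otimes>\<^bsub>G2\<^esub> l) i))"
  proof (rule adjoin_free_orbits[OF Y _ bz HOL.refl ad[unfolded Zeq]])
    show "\<theta> ` H \<subseteq> carrier G2" using \<theta>_closed by blast
    show "\<theta> h \<otimes>\<^bsub>G2\<^esub> l \<in> \<theta> ` H" if "h \<in> H" "l \<in> \<theta> ` H" for h l using that by simp
    fix l i assume l: "l \<in> \<theta> ` H"
    then obtain h where h: "h \<in> H" "l = \<theta> h" by blast
    show "act (\<zeta> l) x \<in> U" using h \<zeta> ax by simp
    have inv: "\<theta> (inv h) = inv\<^bsub>G2\<^esub> (\<theta> h)"
      using \<theta>_mult[of "inv h" h] h \<theta>_one \<theta>_closed by (simp add: G2.inv_equality)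
    show "d (act (\<zeta> l) x) u = dz (Inr (l, i)) (Inl u)" if u: "u \<in> Y" for u
    proof -
      have uU: "u \<in> U" using YU u by blast
      have "u = act h (act (inv h) u)"
        using action(3)[OF uU, of h "inv h"] action(1)[OF uU] h by simp
      then have "d (act h x) u = d x (act (inv h) u)"
        using action(4)[OF x, of h "act (inv h) u"] act_closed_H[of "inv h" u] uU h by simp
      also have "\<dots> = d x (b (inv\<^bsub>G2\<^esub> l) u)" using y(4)[of "inv h" u] u h inv by simp
      finally show ?thesis using h \<zeta> by (simp add: dz)
    qed
    show "act (\<zeta> (\<theta> g \<otimes>\<^bsub>G2\<^esub> l)) x = act g (act (\<zeta> l) x)" if "g \<in> H" for g
      using that h \<zeta>[of "g \<otimes> h"] \<zeta>[of h] \<theta>_mult action(3)[OF x, of g h] by simp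
    fix l' i' assume "l' \<in> \<theta> ` H"
    then obtain k where k: "k \<in> H" "l' = \<theta> k" by blast
    show "d (act (\<zeta> l) x) (act (\<zeta> l') x) = dz (Inr (l, i)) (Inr (l', i'))"
    proof -
      let ?k = "inv h \<otimes> k"
      have hk: "k = h \<otimes> ?k" "?k \<in> H" using h k by (auto simp flip: G1.m_assoc)
      have "d (act h x) (act k x) = d (act h x) (act h (act ?k x))"
        using action(3)[OF x, of h ?k] hk h by simp
      also have "\<dots> = d x (act ?k x)" using action(4) ax[OF hk(2)] h x by simp
      also have "\<dots> = c (\<theta> ?k)" using c0 c(2) hk by simp
      also have "\<theta> ?k = inv\<^bsub>G2\<^esub> l \<otimes>\<^bsub>G2\<^esub> l'" using \<theta>_mult h k inv by simp
      finally show ?thesis using h k \<zeta> by (simp add: dz)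
    qed
  qed (auto simp: dz)
  then obtain Y' b' f where Y': "partial_action Y' b'" "extends (Y, b) (Y', b')"
    and f': "\<forall>l\<in>\<theta> ` H. \<forall>i\<in>{()}. f l i = act (\<zeta> l) x"
      "\<forall>l\<in>carrier G2. \<forall>i\<in>{()}. f l i \<in> Y' \<and> (\<forall>k\<in>carrier G2. b' k (f l i) = f (k \<otimes>\<^bsub>G2\<^esub> l) i)"
    by (elim exE conjE) (rule that)
  have f: "f l () = act (\<zeta> l) x" if "l \<in> \<theta> ` H" for l using bspec[OF f'(1) that] by simp
  have fY: "f l () \<in> Y'" if "l \<in> carrier G2" for l using bspec[OF f'(2) that] by simp
  have "\<one>\<^bsub>G2\<^esub> \<in> \<theta> ` H" by simp
  then have "f \<one>\<^bsub>G2\<^esub> () = act (\<zeta> \<one>\<^bsub>G2\<^esub>) x" by (rule f)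
  also have "\<dots> = x" using \<zeta>[of "\<one>"] \<theta>_one action(1) x by simp
  finally have "x \<in> Y'" using fY[of "\<one>\<^bsub>G2\<^esub>"] by simp
  then show ?thesis using Y' by blast
qed

text \<open>This is where high core-freeness enters. By \<open>mixing\<close> only finitely many
  elements fail to move \<open>A\<close> to distance \<open>1\<close> from \<open>Y\<close> or from
  \<open>A\<close>. Put into \<open>F\<close>, they are avoided by \<open>h \<otimes> g\<close>
  because the range is disjoint from \<open>F\<close>, and by
  \<open>inv g \<otimes> h \<otimes> g\<close> for \<open>h \<noteq> \<one>\<close> because the map
  is injective. Both arguments evaluate the map at the unit, which is why \<open>F\<close> contains
  it.\<close>

lemma move_away:
  assumes A: "finite A" "A \<subseteq> U" and Y: "finite Y" "Y \<subseteq> U"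
  obtains g where "g \<in> carrier G1"
    "\<And>h x y. h \<in> H \<Longrightarrow> x \<in> A \<Longrightarrow> y \<in> Y \<Longrightarrow> d (act h (act g x)) y = 1"
    "\<And>h x x'. h \<in> H \<Longrightarrow> h \<noteq> \<one> \<Longrightarrow> x \<in> A \<Longrightarrow> x' \<in> A \<Longrightarrow> d (act h (act g x)) (act g x') = 1"
proof -
  define E1 where "E1 = (\<Union>x\<in>A. \<Union>y\<in>Y. {g \<in> carrier G1. d (act g x) y < 1})"
  define E2 where "E2 = (\<Union>x\<in>A. \<Union>y\<in>A. {g \<in> carrier G1. d (act g x) y < 1})"
  define F where "F = insert \<one> (E1 \<union> E2)"
  have "finite F" unfolding F_def E1_def E2_def using A Y mixing by (auto simp: subset_iff)
  moreover have FG: "F \<subseteq> carrier G1" by (auto simp: F_def E1_def E2_def)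
  ultimately obtain g where g: "g \<in> carrier G1"
    "inj_on (\<lambda>(\<sigma>, f). \<sigma> \<otimes> g \<otimes> f) (H \<times> F)"
    "(\<lambda>(\<sigma>, f). \<sigma> \<otimes> g \<otimes> f) ` (H \<times> F) \<inter> F = {}"
    using hcf unfolding highly_core_free_def by meson
  have 1: "h \<otimes> g \<notin> F" if "h \<in> H" for h
  proof -
    have "(\<lambda>(\<sigma>, f). \<sigma> \<otimes> g \<otimes> f) (h, \<one>) \<notin> F"
      using g(3) that unfolding F_def by blast
    then show ?thesis using that g by simp
  qed
  have 2: "inv g \<otimes> h \<otimes> g \<notin> F" if h: "h \<in> H" "h \<noteq> \<one>" for h
  proof
    assume "inv g \<otimes> h \<otimes> g \<in> F"
    moreover have "\<one> \<otimes> g \<otimes> (inv g \<otimes> h \<otimes> g) = h \<otimes> g \<otimes> \<one>"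
      using h g by (simp flip: G1.m_assoc)
    ultimately have "(\<one>, inv g \<otimes> h \<otimes> g) = (h, \<one>)"
      using h by (intro inj_onD[OF g(2)]) (auto simp: F_def)
    then show False using h by simp
  qed
  have AU: "x \<in> U" if "x \<in> A" for x using A that by blast
  have YU: "x \<in> U" if "x \<in> Y" for x using Y that by blast
  have gA: "act g x \<in> U" if "x \<in> A" for x using action(2) AU g that by blast
  show thesis
  proof (rule that[OF g(1)])
    fix h x y assume h: "h \<in> H" "x \<in> A" "y \<in> Y"
    have "act h (act g x) = act (h \<otimes> g) x" using action(3)[OF AU[OF h(2)]] h g by simp
    moreover have "h \<otimes> g \<notin> E1" using 1 h by (auto simp: F_def)
    ultimately have "\<not> d (act h (act g x)) y < 1" using h g by (auto simp: E1_def)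
    then show "d (act h (act g x)) y = 1"
      using d_le_1[OF act_closed_H[OF h(1) gA[OF h(2)]] YU[OF h(3)]] by simp
  next
    fix h x x' assume h: "h \<in> H" "h \<noteq> \<one>" and x: "x \<in> A" "x' \<in> A"
    let ?e = "inv g \<otimes> h \<otimes> g"
    have e: "?e \<in> carrier G1" "g \<otimes> ?e = h \<otimes> g" using h g by (auto simp flip: G1.m_assoc)
    have "act h (act g x) = act g (act ?e x)"
      using action(3)[OF AU[OF x(1)], of h g] action(3)[OF AU[OF x(1)], of g ?e] e h g by simp
    then have *: "d (act h (act g x)) (act g x') = d (act ?e x) x'"
      using action(4)[of "act ?e x" g x'] action(2)[of x ?e] AU x e g by simp
    have "?e \<notin> E2" using 2 h by (auto simp: F_def)
    then have "\<not> d (act ?e x) x' < 1" using x e by (auto simp: E2_def)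
    then show "d (act h (act g x)) (act g x') = 1"
      unfolding * using d_le_1 action(2) AU x e by (metis linorder_le_less_linear order.antisym)
  qed
qed

text \<open>
  Elements \<open>g1\<close> and \<open>g2\<close> of the first factor move the domain and the range of the partial isometry
  away from everything else; then some element \<open>k\<close> of the second factor outside the amalgamated
  subgroup may be declared to map the one onto the other.
\<close>

lemma extend_homogeneous:
  assumes Y: "partial_action Y b" and \<Phi>: "finite \<Phi>" "\<Phi> \<subseteq> U \<times> U"
    "\<And>x y x' y'. (x, y) \<in> \<Phi> \<Longrightarrow> (x', y') \<in> \<Phi> \<Longrightarrow> d x x' = d y y'"
  shows "\<exists>Y' b'. partial_action Y' b' \<and> extends (Y, b) (Y', b') \<and>
    (\<exists>g1\<in>carrier G1. \<exists>g2\<in>carrier G1. \<exists>k\<in>carrier G2. \<forall>(x, y)\<in>\<Phi>. act g1 x \<in> Y' \<and> b' k (act g1 x) = act g2 y)"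
proof -
  note y = partial_actionD[OF Y] and ib = isometric_onD[OF partial_actionD(3)[OF Y]]
  have YU: "u \<in> U" if "u \<in> Y" for u using y that by blast
  obtain k where k: "k \<in> carrier G2" "k \<notin> \<theta> ` H" using \<theta>(3) by blast
  define A where "A = fst ` \<Phi>"
  define \<phi> where "\<phi> x = (SOME y. (x, y) \<in> \<Phi>)" for x
  have \<phi>: "(x, \<phi> x) \<in> \<Phi>" if "x \<in> A" for x
    using that unfolding \<phi>_def A_def by (auto intro: someI)
  have \<phi>_eq: "\<phi> x = y" if "(x, y) \<in> \<Phi>" for x y
  proof -
    have "(x, \<phi> x) \<in> \<Phi>" using that by (intro \<phi>) (force simp: A_def)
    then have U: "\<phi> x \<in> U" "y \<in> U" "x \<in> U" and "d x x = d (\<phi> x) y" using \<Phi>(2,3) that by blast+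
    then show ?thesis using metric(3) by metis
  qed
  have AU: "x \<in> U" if "x \<in> A" for x using that \<Phi> by (auto simp: A_def)
  have \<phi>U: "\<phi> x \<in> U" if "x \<in> A" for x using \<phi>[OF that] \<Phi> by blast
  have \<phi>_iso: "d (\<phi> x) (\<phi> x') = d x x'" if "x \<in> A" "x' \<in> A" for x x'
    using \<Phi>(3)[OF \<phi> \<phi>] that by simp
  have A: "finite A" "A \<subseteq> U" using \<Phi>(1) AU by (auto simp: A_def)
  obtain g1 where g1: "g1 \<in> carrier G1"
    "\<And>h x y. h \<in> H \<Longrightarrow> x \<in> A \<Longrightarrow> y \<in> Y \<Longrightarrow> d (act h (act g1 x)) y = 1"
    "\<And>h x x'. h \<in> H \<Longrightarrow> h \<noteq> \<one> \<Longrightarrow> x \<in> A \<Longrightarrow> x' \<in> A \<Longrightarrow> d (act h (act g1 x)) (act g1 x') = 1"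
    by (rule move_away[OF A y(1,2)]) (assumption | rule that)+
  have g1U: "act g1 x \<in> U" if "x \<in> A" for x using action(2) AU g1 that by blast
  \<comment> \<open>The range has to stay away from the \<open>H\<close>-translates of the moved
    domain as well, so these are added to \<open>Y\<close> before the second move.\<close>
  define Y1 where "Y1 = Y \<union> (\<lambda>(h, x). act h (act g1 x)) ` (H \<times> A)"
  have Y1: "finite Y1" "Y1 \<subseteq> U"
    using y finite_H A g1U act_closed_H by (auto simp: Y1_def)
  have \<phi>A: "finite (\<phi> ` A)" "\<phi> ` A \<subseteq> U" using A \<phi>U by auto
  obtain g2 where g2: "g2 \<in> carrier G1"
    "\<And>h x y. h \<in> H \<Longrightarrow> x \<in> \<phi> ` A \<Longrightarrow> y \<in> Y1 \<Longrightarrow> d (act h (act g2 x)) y = 1"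
    "\<And>h x x'. h \<in> H \<Longrightarrow> h \<noteq> \<one> \<Longrightarrow> x \<in> \<phi> ` A \<Longrightarrow> x' \<in> \<phi> ` A \<Longrightarrow> d (act h (act g2 x)) (act g2 x') = 1"
    by (rule move_away[OF \<phi>A Y1]) (assumption | rule that)+
  \<comment> \<open>\<open>i = False\<close> stands for the domain, placed at the unit of the second
    factor, and \<open>i = True\<close> for the range, placed at \<open>k\<close>.\<close>
  define u where "u i x = (if i then act g2 (\<phi> x) else act g1 x)" for i x
  define \<kappa> where "\<kappa> i = (if i then k else \<one>\<^bsub>G2\<^esub>)" for i
  have \<kappa>: "\<kappa> i \<in> carrier G2" for i using k by (simp add: \<kappa>_def)
  have uU: "u i x \<in> U" if "x \<in> A" for i x
    using action(2) g1U \<phi>U g2(1) that by (simp add: u_def)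
  have uY: "d (act h (u i x)) y = 1" if "h \<in> H" "x \<in> A" "y \<in> Y" for h i x y
    using g1(2) g2(2) that by (simp add: u_def Y1_def)
  have sep1: "d (act h (u i x)) (u i' x') = (if h = \<one> \<and> i = i' then d x x' else 1)"
    if h: "h \<in> H" and x: "x \<in> A" "x' \<in> A" for h i x i' x'
  proof (cases "i = i'")
    case True
    have "d (u i x) (u i x') = d x x'"
      using action(4) AU \<phi>U \<phi>_iso g1(1) g2(1) x by (simp add: u_def)
    then show ?thesis using True action(1)[OF uU[OF x(1)]] g1(3) g2(3) h x by (auto simp: u_def)
  next
    case False
    have *: "d (act h (act g2 (\<phi> x))) (act h' (act g1 x')) = 1" if "h \<in> H" "h' \<in> H" "x \<in> A" "x' \<in> A" for h h' x x'
      using g2(2)[of h "\<phi> x" "act h' (act g1 x')"] that by (force simp: Y1_def)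
    show ?thesis
    proof (cases i)
      case True
      then show ?thesis using False *[OF h H.one_closed x] action(1)[OF g1U[OF x(2)]] by (simp add: u_def)
    next
      case F: False
      have "act g2 (\<phi> x') \<in> U" using uU[OF x(2), of True] by (simp add: u_def)
      then show ?thesis
        using False F *[OF H.one_closed h x(2,1)] action(1) metric(2)[OF act_closed_H[OF h g1U[OF x(1)]]]
        by (simp add: u_def)
    qed
  qed
  \<comment> \<open>After both moves, each pair \<open>(h, i)\<close> gives an isometric copy of
    \<open>A\<close>, and different pairs give copies at distance \<open>1\<close> from each other.
    This is the metric \<open>dz\<close> below.\<close>
  have sep: "d (act h (u i x)) (act h' (u i' x')) = (if h = h' \<and> i = i' then d x x' else 1)"
    if h: "h \<in> H" "h' \<in> H" and x: "x \<in> A" "x' \<in> A" for h h' i i' x x'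
  proof -
    have "act h (u i x) = act h' (act (inv h' \<otimes> h) (u i x))"
      using action(3)[OF uU[OF x(1)], of h' "inv h' \<otimes> h"] h by (simp flip: G1.m_assoc)
    then have "d (act h (u i x)) (act h' (u i' x')) = d (act (inv h' \<otimes> h) (u i x)) (u i' x')"
      using action(4)[of "act (inv h' \<otimes> h) (u i x)" h' "u i' x'"] act_closed_H uU h x by simp
    moreover have "inv h' \<otimes> h = \<one> \<longleftrightarrow> h = h'"
      using h by (metis G1.inv_closed G1.inv_equality G1.inv_inv G1.l_inv H.mem_carrier)
    ultimately show ?thesis using sep1[of "inv h' \<otimes> h"] h x by simp
  qed
  \<comment> \<open>\<open>L\<close> is the union of the cosets of the image of
    \<open>\<theta>\<close> through the unit and through \<open>k\<close>. They are distinct by the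
    choice of \<open>k\<close>, so \<open>\<pi>\<close> is injective and positions may be prescribed
    on \<open>L\<close> independently.\<close>
  define \<pi> where "\<pi> = (\<lambda>(h, i). \<theta> h \<otimes>\<^bsub>G2\<^esub> \<kappa> i)"
  define L where "L = \<pi> ` (H \<times> UNIV)"
  have inj: "inj_on \<pi> (H \<times> UNIV)"
  proof (rule inj_onI, clarify)
    fix h h' i i' assume h: "h \<in> H" "h' \<in> H" and "\<pi> (h, i) = \<pi> (h', i')"
    then have eq: "\<theta> h \<otimes>\<^bsub>G2\<^esub> \<kappa> i = \<theta> h' \<otimes>\<^bsub>G2\<^esub> \<kappa> i'" by (simp add: \<pi>_def)
    have hk: "\<theta> h \<otimes>\<^bsub>G2\<^esub> k \<noteq> \<theta> h'" if "h \<in> H" "h' \<in> H" for h h'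
    proof
      assume "\<theta> h \<otimes>\<^bsub>G2\<^esub> k = \<theta> h'"
      then have "k = inv\<^bsub>G2\<^esub> (\<theta> h) \<otimes>\<^bsub>G2\<^esub> \<theta> h'"
        using k \<theta>_closed[OF that(1)] by (metis G2.inv_solve_left G2.m_closed)
      then show False using k that by simp
    qed
    have "i = i'" using eq hk[OF h] hk[OF h(2,1)] h \<theta>_closed by (auto simp: \<kappa>_def split: if_splits)
    then show "h = h' \<and> i = i'" using eq \<theta>(2) h \<theta>_closed \<kappa>[of i] by (auto simp: inj_on_def)
  qed
  define f0 where "f0 l x = (case inv_into (H \<times> UNIV) \<pi> l of (h, i) \<Rightarrow> act h (u i x))" for l x
  have f0: "f0 (\<theta> h \<otimes>\<^bsub>G2\<^esub> \<kappa> i) x = act h (u i x)" if "h \<in> H" for h i x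
    using inv_into_f_f[OF inj, of "(h, i)"] that by (simp add: f0_def \<pi>_def)
  have Lcases: "\<exists>h i. h \<in> H \<and> l = \<theta> h \<otimes>\<^bsub>G2\<^esub> \<kappa> i" if "l \<in> L" for l using that by (auto simp: L_def \<pi>_def)

  define bz :: "'b \<Rightarrow> 'u + 'b \<times> 'u \<Rightarrow> 'u + 'b \<times> 'u" where
    "bz k z = (case z of Inl u \<Rightarrow> Inl (b k u) | Inr (l, i) \<Rightarrow> Inr (k \<otimes>\<^bsub>G2\<^esub> l, i))" for k z
  have bz: "bz k (Inl u) = Inl (b k u)" "bz k (Inr (l, i)) = Inr (k \<otimes>\<^bsub>G2\<^esub> l, i)" for k u l i
    by (simp_all add: bz_def)
  \<comment> \<open>The new points form one copy of \<open>A\<close> for each element of the second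
    factor, which permutes these copies. \<open>tag\<close> names the copy, with \<open>None\<close>
    for \<open>Y\<close>; points with different tags have distance \<open>1\<close>.\<close>
  define tag :: "'u + 'b \<times> 'u \<Rightarrow> 'b option" where "tag = case_sum (\<lambda>u. None) (\<lambda>(l, x). Some l)"
  define pt :: "'u + 'b \<times> 'u \<Rightarrow> 'u" where "pt = case_sum (\<lambda>u. u) (\<lambda>(l, x). x)"
  define dz where "dz z z' = (if tag z = tag z' then d (pt z) (pt z') else 1)" for z z'
  have dz: "dz (Inl u) (Inl v) = d u v" "dz (Inl u) (Inr (l, x)) = 1" "dz (Inr (l, x)) (Inl u) = 1"
    "dz (Inr (l, x)) (Inr (l', y)) = (if l = l' then d x y else 1)" for u v l l' x y
    by (simp_all add: dz_def tag_def pt_def)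
  define Z where "Z = Inl ` Y \<union> Inr ` (carrier G2 \<times> A)"
  have pt: "pt z \<in> U" if "z \<in> Z" for z using that YU AU by (auto simp: Z_def pt_def)
  have tag_pt: "z = z' \<longleftrightarrow> tag z = tag z' \<and> pt z = pt z'" for z z'
    by (cases z; cases z') (auto simp: tag_def pt_def)
  have mz: "S_metric_on S Z dz"
    unfolding S_metric_on_def
  proof (intro ballI)
    fix z z' assume z: "z \<in> Z" "z' \<in> Z"
    have "dz z z'' \<le> dz z z' + dz z' z''" if z'': "z'' \<in> Z" for z''
      using metric(4)[OF pt[OF z(1)] pt[OF z(2)] pt[OF z'']] d_le_1[OF pt[OF z(1)] pt[OF z'']]
        d_ge_0[OF pt[OF z(1)] pt[OF z(2)]] d_ge_0[OF pt[OF z(2)] pt[OF z'']]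
      by (auto simp: dz_def)
    moreover have "dz z z' \<in> S \<and> dz z z' = dz z' z \<and> (dz z z' = 0 \<longleftrightarrow> z = z')"
      using metric(1-3)[OF pt[OF z(1)] pt[OF z(2)]] dist by (auto simp: dz_def tag_pt)
    ultimately show "dz z z' \<in> S \<and> dz z z' = dz z' z \<and> (dz z z' = 0 \<longleftrightarrow> z = z') \<and>
      (\<forall>z''\<in>Z. dz z z'' \<le> dz z z' + dz z' z'')" by blast
  qed
  have iz: "isometric_on G2 (carrier G2) Z bz dz"
    unfolding isometric_on_def
  proof (intro conjI ballI)
    show "bz \<one>\<^bsub>G2\<^esub> z = z" if "z \<in> Z" for z using that ib(1) bz by (auto simp: Z_def)
    fix g z assume g: "g \<in> carrier G2" and z: "z \<in> Z"
    show "bz g z \<in> Z" using g z ib(2) bz by (auto simp: Z_def)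
    show "bz (g \<otimes>\<^bsub>G2\<^esub> h) z = bz g (bz h z)" if "h \<in> carrier G2" for h
      using g z that ib(3) bz by (auto simp: Z_def G2.m_assoc)
    show "dz (bz g z) (bz g z') = dz z z'" if "z' \<in> Z" for z'
      using g z that ib(4) by (auto simp: Z_def bz dz)
  qed
  have "\<exists>Y' b' f. partial_action Y' b' \<and> extends (Y, b) (Y', b') \<and>
    (\<forall>l\<in>L. \<forall>x\<in>A. f l x = f0 l x) \<and>
    (\<forall>l\<in>carrier G2. \<forall>x\<in>A. f l x \<in> Y' \<and> (\<forall>k\<in>carrier G2. b' k (f l x) = f (k \<otimes>\<^bsub>G2\<^esub> l) x))"
  proof (rule adjoin_free_orbits[OF Y A(1) bz Z_def mz iz])
    show "L \<subseteq> carrier G2" using Lcases \<theta>_closed \<kappa> by blast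
    have hh: "\<theta> h \<otimes>\<^bsub>G2\<^esub> (\<theta> h' \<otimes>\<^bsub>G2\<^esub> \<kappa> i) = \<theta> (h \<otimes> h') \<otimes>\<^bsub>G2\<^esub> \<kappa> i" if "h \<in> H" "h' \<in> H" for h h' i
      using that \<theta>_mult \<theta>_closed \<kappa> by (simp add: G2.m_assoc)
    fix l x assume l: "l \<in> L" and x: "x \<in> A"
    obtain h i where h: "h \<in> H" "l = \<theta> h \<otimes>\<^bsub>G2\<^esub> \<kappa> i" using Lcases[OF l] by blast
    show "f0 l x \<in> U" using h f0 act_closed_H uU x by simp
    show "d (f0 l x) y = dz (Inr (l, x)) (Inl y)" if "y \<in> Y" for y using h f0 uY x that by (simp add: dz)
    show "f0 (\<theta> g \<otimes>\<^bsub>G2\<^esub> l) x = act g (f0 l x)" if "g \<in> H" for g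
      using h f0 hh action(3)[OF uU[OF x]] that by simp
    fix l' x' assume l': "l' \<in> L" and x': "x' \<in> A"
    obtain h' i' where h': "h' \<in> H" "l' = \<theta> h' \<otimes>\<^bsub>G2\<^esub> \<kappa> i'" using Lcases[OF l'] by blast
    have "l = l' \<longleftrightarrow> h = h' \<and> i = i'"
      using inj_on_eq_iff[OF inj, of "(h, i)" "(h', i')"] h h' by (simp add: \<pi>_def)
    then show "d (f0 l x) (f0 l' x') = dz (Inr (l, x)) (Inr (l', x'))"
      using h h' f0 sep x x' by (simp add: dz)
  next
    show "\<theta> g \<otimes>\<^bsub>G2\<^esub> l \<in> L" if "g \<in> H" "l \<in> L" for g l
    proof -
      obtain h i where h: "h \<in> H" "l = \<theta> h \<otimes>\<^bsub>G2\<^esub> \<kappa> i" using Lcases[OF \<open>l \<in> L\<close>] by blast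
      then have "\<theta> g \<otimes>\<^bsub>G2\<^esub> l = \<pi> (g \<otimes> h, i)"
        using \<theta>_mult \<theta>_closed \<kappa> that by (simp add: \<pi>_def G2.m_assoc)
      then show ?thesis using h that by (auto simp: L_def)
    qed
  qed (simp add: dz)
  then obtain Y' b' f where Y': "partial_action Y' b'" "extends (Y, b) (Y', b')"
    and f: "\<forall>l\<in>L. \<forall>x\<in>A. f l x = f0 l x"
      "\<forall>l\<in>carrier G2. \<forall>x\<in>A. f l x \<in> Y' \<and> (\<forall>k\<in>carrier G2. b' k (f l x) = f (k \<otimes>\<^bsub>G2\<^esub> l) x)"
    by (elim exE conjE) (rule that)
  have L1: "\<kappa> i \<in> L" and f01: "f0 (\<kappa> i) x = u i x" if "x \<in> A" for i x
  proof -
    have eq: "\<theta> \<one> \<otimes>\<^bsub>G2\<^esub> \<kappa> i = \<kappa> i" using \<kappa> \<theta>_one by simp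
    then have "\<kappa> i = \<pi> (\<one>, i)" by (simp add: \<pi>_def)
    then show "\<kappa> i \<in> L" by (simp add: L_def)
    show "f0 (\<kappa> i) x = u i x" using f0[of \<one> i x] eq action(1)[OF uU[OF that]] by simp
  qed
  \<comment> \<open>In the new orbits \<open>k\<close> takes the copy of \<open>A\<close> at the
    unit to the copy at \<open>k\<close>, hence the moved domain to the moved range.\<close>
  have "act g1 x \<in> Y' \<and> b' k (act g1 x) = act g2 y" if xy: "(x, y) \<in> \<Phi>" for x y
  proof -
    have x: "x \<in> A" using xy by (force simp: A_def)
    have "f (\<kappa> i) x = u i x" for i using f(1) L1[OF x] f01[OF x] x by simp
    from this[of False] this[of True] have "f \<one>\<^bsub>G2\<^esub> x = act g1 x" "f k x = act g2 y"
      by (simp_all add: \<kappa>_def u_def \<phi>_eq[OF xy])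
    then show ?thesis using f(2) x k by (metis G2.one_closed G2.r_one)
  qed
  then show ?thesis using Y' g1(1) g2(1) k(1) by blast
qed

text \<open>
  The requirements \<open>E i\<close> are met by a stage of the construction, hence by every action extending it.
\<close>

lemma generic_action:
  assumes J: "countable J" and E: "\<And>i Y b. i \<in> J \<Longrightarrow> partial_action Y b \<Longrightarrow>
      \<exists>Y' b'. partial_action Y' b' \<and> extends (Y, b) (Y', b') \<and> E i Y' b'"
  obtains b where "isometric_on G2 (carrier G2) U b d" "\<And>h x. h \<in> H \<Longrightarrow> x \<in> U \<Longrightarrow> b (\<theta> h) x = act h x"
    "\<And>\<Phi>. finite \<Phi> \<Longrightarrow> \<Phi> \<subseteq> U \<times> U \<Longrightarrow>
      \<forall>(x, y)\<in>\<Phi>. \<forall>(x', y')\<in>\<Phi>. d x x' = d y y' \<Longrightarrow>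
      \<exists>g1\<in>carrier G1. \<exists>g2\<in>carrier G1. \<exists>k\<in>carrier G2. \<forall>(x, y)\<in>\<Phi>. b k (act g1 x) = act g2 y"
    "\<And>i. i \<in> J \<Longrightarrow> \<exists>Y b'. E i Y b' \<and> (\<forall>k\<in>carrier G2. \<forall>x\<in>Y. b k x = b' k x)"
proof -
  define Q where "Q = {(Y, b). partial_action Y b}"
  define iso where "iso \<Phi> \<longleftrightarrow> (\<forall>(x, y)\<in>\<Phi>. \<forall>(x', y')\<in>\<Phi>. d x x' = d y y')" for \<Phi>
  \<comment> \<open>The tasks are of three kinds: a point for the domain, a partial isometry to be
    realised, and a further requirement from \<open>J\<close>, used later for faithfulness. The
    second kind also asks for \<open>act g1 x \<in> Y\<close>, so that the values found persist in
    the limit.\<close>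
  define I where "I = U <+> ({\<Phi>. finite \<Phi> \<and> \<Phi> \<subseteq> U \<times> U} <+> J)"
  define R where "R i = (\<lambda>(Y, b). case i of
      Inl x \<Rightarrow> x \<in> Y
    | Inr (Inl \<Phi>) \<Rightarrow> iso \<Phi> \<longrightarrow> (\<exists>g1\<in>carrier G1. \<exists>g2\<in>carrier G1. \<exists>k\<in>carrier G2.
        \<forall>(x, y)\<in>\<Phi>. act g1 x \<in> Y \<and> b k (act g1 x) = act g2 y)
    | Inr (Inr i) \<Rightarrow> E i Y b)" for i
  have cI: "countable I"
    unfolding I_def using U(1) J
    by (intro countable_Plus countable_Collect_finite_subset countable_SIGMA) auto
  have ext_refl: "extends q q" for q by (auto simp: extends_def split: prod.splits)
  have ext_trans: "extends p r" if "extends p q" "extends q r" for p q r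
    using that unfolding extends_def by (auto split: prod.splits)
  have p0: "({}, \<lambda>k x. x) \<in> Q" by (simp add: Q_def partial_action_def isometric_on_def)
  have dense: "\<exists>q\<in>Q. extends p q \<and> R i q" if i: "i \<in> I" and p: "p \<in> Q" for i p
  proof -
    obtain Y b where Yb: "p = (Y, b)" "partial_action Y b" using p by (auto simp: Q_def)
    have "\<exists>Y' b'. partial_action Y' b' \<and> extends (Y, b) (Y', b') \<and> R i (Y', b')"
      using i unfolding I_def
    proof (elim PlusE CollectE conjE)
      fix x assume "x \<in> U" "i = Inl x"
      then show ?thesis using extend_domain[OF Yb(2)] by (simp add: R_def)
    next
      fix z \<Phi> assume \<Phi>: "i = Inr z" "z = Inl \<Phi>" "finite \<Phi>" "\<Phi> \<subseteq> U \<times> U"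
      show ?thesis
      proof (cases "iso \<Phi>")
        case True
        have "d x x' = d y y'" if "(x, y) \<in> \<Phi>" "(x', y') \<in> \<Phi>" for x y x' y'
          using True that by (auto simp: iso_def)
        from extend_homogeneous[OF Yb(2) \<Phi>(3,4) this] show ?thesis
          using True by (simp add: R_def \<Phi>)
      next
        case False
        then show ?thesis using Yb ext_refl by (auto simp: R_def \<Phi>)
      qed
    next
      fix z e assume e: "i = Inr z" "z = Inr e" "e \<in> J"
      show ?thesis using E[OF e(3) Yb(2)] by (simp add: R_def e)
    qed
    then show ?thesis using Yb by (auto simp: Q_def)
  qed
  obtain f :: "nat \<Rightarrow> _" where f: "\<And>n. f n \<in> Q" "\<And>m n. m \<le> n \<Longrightarrow> extends (f m) (f n)"
    "\<And>i. i \<in> I \<Longrightarrow> \<exists>n. R i (f n)"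
    by (rule generic_chain[OF cI ext_refl ext_trans p0 dense]) (assumption | rule that)+
  define Y where "Y n = fst (f n)" for n
  define \<beta> where "\<beta> n = snd (f n)" for n
  have pa: "partial_action (Y n) (\<beta> n)" for n using f(1)[of n] by (auto simp: Q_def Y_def \<beta>_def)
  note y = partial_actionD[OF pa] and ib = isometric_onD[OF partial_actionD(3)[OF pa]]
  have mono: "Y m \<subseteq> Y n" "\<And>k x. k \<in> carrier G2 \<Longrightarrow> x \<in> Y m \<Longrightarrow> \<beta> n k x = \<beta> m k x" if "m \<le> n" for m n
    using f(2)[OF that] by (auto simp: extends_def Y_def \<beta>_def split: prod.splits)
  define b where "b k x = \<beta> (LEAST n. x \<in> Y n) k x" for k x
  have b: "b k x = \<beta> n k x" if k: "k \<in> carrier G2" and x: "x \<in> Y n" for k x n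
  proof -
    have "x \<in> Y (LEAST n. x \<in> Y n)" using x by (rule LeastI)
    moreover have "(LEAST n. x \<in> Y n) \<le> n" using x by (rule Least_le)
    ultimately show ?thesis unfolding b_def using mono(2) k by simp
  qed
  have dom: "\<exists>n. x \<in> Y n" if "x \<in> U" for x
  proof -
    have "Inl x \<in> I" using that unfolding I_def by (rule InlI)
    then show ?thesis using f(3) by (force simp: R_def Y_def split_beta)
  qed
  have dom2: "\<exists>n. x \<in> Y n \<and> y \<in> Y n" if xy: "x \<in> U" "y \<in> U" for x y
  proof -
    obtain m n where "x \<in> Y m" "y \<in> Y n" using dom xy by blast
    then show ?thesis using mono(1)[of m "max m n"] mono(1)[of n "max m n"] by auto
  qed
  show thesis
  proof (rule that[of b])
    show "isometric_on G2 (carrier G2) U b d"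
      unfolding isometric_on_def
    proof (intro conjI ballI)
      fix x assume x: "x \<in> U"
      obtain n where n: "x \<in> Y n" using dom x by blast
      show "b \<one>\<^bsub>G2\<^esub> x = x" using b[OF _ n] ib(1)[OF n] by simp
      fix k assume k: "k \<in> carrier G2"
      have kn: "\<beta> n k x \<in> Y n" using ib(2)[OF n k] .
      then show "b k x \<in> U" using b[OF k n] y(2) by auto
      show "b (k \<otimes>\<^bsub>G2\<^esub> l) x = b k (b l x)" if l: "l \<in> carrier G2" for l
        using b[OF _ n] b[OF k ib(2)[OF n l]] ib(3)[OF n k l] k l by simp
      show "d (b k x) (b k z) = d x z" if z: "z \<in> U" for z
      proof -
        obtain n where n: "x \<in> Y n" "z \<in> Y n" using dom2[OF x z] by blast
        then show ?thesis using b[OF k] ib(4)[OF n(1) k n(2)] by simp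
      qed
    qed
    show "b (\<theta> h) x = act h x" if h: "h \<in> H" and x: "x \<in> U" for h x
    proof -
      obtain n where n: "x \<in> Y n" using dom x by blast
      then show ?thesis using b[OF \<theta>_closed[OF h] n] y(4)[OF h n] by simp
    qed
    show "\<exists>g1\<in>carrier G1. \<exists>g2\<in>carrier G1. \<exists>k\<in>carrier G2. \<forall>(x, y)\<in>\<Phi>. b k (act g1 x) = act g2 y"
      if \<Phi>: "finite \<Phi>" "\<Phi> \<subseteq> U \<times> U" "\<forall>(x, y)\<in>\<Phi>. \<forall>(x', y')\<in>\<Phi>. d x x' = d y y'" for \<Phi>
    proof -
      have "Inr (Inl \<Phi>) \<in> I" using \<Phi>(1,2) unfolding I_def by (intro InrI InlI CollectI conjI)
      then obtain n where n: "R (Inr (Inl \<Phi>)) (f n)" using f(3) by blast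
      have "iso \<Phi>" using \<Phi>(3) by (simp only: iso_def)
      then have "\<exists>g1\<in>carrier G1. \<exists>g2\<in>carrier G1. \<exists>k\<in>carrier G2.
          \<forall>(x, y)\<in>\<Phi>. act g1 x \<in> Y n \<and> \<beta> n k (act g1 x) = act g2 y"
        using n by (simp add: R_def Y_def \<beta>_def split_beta)
      then obtain g1 g2 k where g: "g1 \<in> carrier G1" "g2 \<in> carrier G1" "k \<in> carrier G2"
        and *: "\<And>x y. (x, y) \<in> \<Phi> \<Longrightarrow> act g1 x \<in> Y n \<and> \<beta> n k (act g1 x) = act g2 y" by blast
      have "\<forall>(x, y)\<in>\<Phi>. b k (act g1 x) = act g2 y" using * b[OF g(3)] by fastforce
      then show ?thesis using g by blast
    qed
    show "\<exists>Y b'. E i Y b' \<and> (\<forall>k\<in>carrier G2. \<forall>x\<in>Y. b k x = b' k x)" if i: "i \<in> J" for i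
    proof -
      have "Inr (Inr i) \<in> I" using i unfolding I_def by (intro InrI)
      then obtain n where "R (Inr (Inr i)) (f n)" using f(3) by blast
      then have "E i (Y n) (\<beta> n)" by (simp add: R_def Y_def \<beta>_def split_beta)
      then show ?thesis using b by blast
    qed
  qed
qed

end

text \<open>In the application \<open>A\<close> is the amalgam and \<open>\<iota>1\<close>,
  \<open>\<iota>2\<close> are the canonical maps of the factors. \<open>j\<close> embeds
  \<open>A\<close> as a discrete set on which the first factor acts by left translation; every point
  of \<open>U\<close> is at distance \<open>1\<close> from all but finitely many of its
  points.\<close>

locale urysohn_amalgam_orbit = urysohn_amalgam G1 G2 S U d act H \<theta> + A: group A
  for G1 :: "('a, 'm) monoid_scheme" (structure) and G2 :: "('b, 'n) monoid_scheme"
    and S and U :: "'u set" and d act H \<theta> and A :: "('p, 'k) monoid_scheme" +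
  fixes \<iota>1 :: "'a \<Rightarrow> 'p" and \<iota>2 :: "'b \<Rightarrow> 'p" and j :: "'p \<Rightarrow> 'u"
  assumes A_infinite: "infinite (carrier A)"
    and \<iota>2: "\<iota>2 \<in> hom G2 A"
    and \<iota>12: "\<And>h. h \<in> H \<Longrightarrow> \<iota>1 h = \<iota>2 (\<theta> h)"
    and j: "j \<in> carrier A \<rightarrow> U"
    and act_j: "\<And>g p. p \<in> carrier A \<Longrightarrow> act g (j p) = j (\<iota>1 g \<otimes>\<^bsub>A\<^esub> p)"
    and j_discrete: "\<And>p q. p \<in> carrier A \<Longrightarrow> q \<in> carrier A \<Longrightarrow> p \<noteq> q \<Longrightarrow> d (j p) (j q) = 1"
    and j_finite: "\<And>x. x \<in> U \<Longrightarrow> finite {p \<in> carrier A. d x (j p) < 1}"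
begin

lemma j_inj: "inj_on j (carrier A)"
proof (rule inj_onI)
  fix p q assume pq: "p \<in> carrier A" "q \<in> carrier A" "j p = j q"
  then have "j p \<in> U" using j by blast
  then show "p = q" using j_discrete[OF pq(1,2)] metric(3)[of "j p" "j q"] pq by force
qed

text \<open>Right translation commutes with left translation. Hence \<open>F\<close> may first be
  moved by some \<open>t\<close> to a place far from \<open>Y\<close>, where the second factor is
  then declared to act by left translation as in \<open>A\<close>. Discreteness of the copy makes
  this isometric.\<close>

lemma extend_faithful:
  assumes Y: "partial_action Y b" and F: "finite F" "F \<subseteq> carrier A"
  shows "\<exists>Y' b'. partial_action Y' b' \<and> extends (Y, b) (Y', b') \<and>
    (\<exists>t\<in>carrier A. \<forall>q\<in>F. j (q \<otimes>\<^bsub>A\<^esub> t) \<in> Y' \<and>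
      (\<forall>k\<in>carrier G2. b' k (j (q \<otimes>\<^bsub>A\<^esub> t)) = j (\<iota>2 k \<otimes>\<^bsub>A\<^esub> (q \<otimes>\<^bsub>A\<^esub> t))))"
proof -
  note y = partial_actionD[OF Y] and ib = isometric_onD[OF partial_actionD(3)[OF Y]]
  have YU: "u \<in> U" if "u \<in> Y" for u using y that by blast
  have jU: "j p \<in> U" if "p \<in> carrier A" for p using j that by blast
  have \<iota>2c: "\<iota>2 k \<in> carrier A" if "k \<in> carrier G2" for k using \<iota>2 that by (auto simp: hom_def)
  have \<iota>2m: "\<iota>2 (k \<otimes>\<^bsub>G2\<^esub> l) = \<iota>2 k \<otimes>\<^bsub>A\<^esub> \<iota>2 l" if "k \<in> carrier G2" "l \<in> carrier G2" for k l
    using \<iota>2 that by (auto simp: hom_def)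
  have \<iota>21: "\<iota>2 \<one>\<^bsub>G2\<^esub> = \<one>\<^bsub>A\<^esub>"
    using hom_one[OF \<iota>2 G2.group_axioms A.group_axioms] .
  \<comment> \<open>Closing \<open>F\<close> under left translation by the second factor makes the
    new domain invariant; the closure is still finite.\<close>
  define F1 where "F1 = (\<lambda>(k, q). \<iota>2 k \<otimes>\<^bsub>A\<^esub> q) ` (carrier G2 \<times> F)"
  have F1: "finite F1" "F1 \<subseteq> carrier A" using F G2_finite \<iota>2c by (auto simp: F1_def)
  define B where "B = (\<Union>x\<in>Y. {p \<in> carrier A. d x (j p) < 1})"
  have "finite B" unfolding B_def using y(1) YU j_finite by blast
  then have "finite ((\<lambda>(q, p). inv\<^bsub>A\<^esub> q \<otimes>\<^bsub>A\<^esub> p) ` (F1 \<times> B))" using F1 by blast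
  moreover note A_infinite
  \<comment> \<open>If \<open>q \<otimes> t\<close> were a point \<open>p\<close> of
    \<open>B\<close>, that is, one near \<open>Y\<close>, then \<open>t\<close> would be
    \<open>inv q \<otimes> p\<close>. Only finitely many such products exist, while \<open>A\<close>
    is infinite.\<close>
  ultimately obtain t where t: "t \<in> carrier A" "t \<notin> (\<lambda>(q, p). inv\<^bsub>A\<^esub> q \<otimes>\<^bsub>A\<^esub> p) ` (F1 \<times> B)"
    by (meson finite_subset subsetI)
  define P where "P = (\<lambda>q. q \<otimes>\<^bsub>A\<^esub> t) ` F1"
  have P: "finite P" "P \<subseteq> carrier A" using F1 t by (auto simp: P_def)
  have PG: "p \<in> carrier A" if "p \<in> P" for p using P that by blast
  have \<iota>2P: "\<iota>2 k \<otimes>\<^bsub>A\<^esub> p \<in> P" if k: "k \<in> carrier G2" and p: "p \<in> P" for k p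
  proof -
    obtain l q where l: "l \<in> carrier G2" "q \<in> F" "p = \<iota>2 l \<otimes>\<^bsub>A\<^esub> q \<otimes>\<^bsub>A\<^esub> t" using p by (auto simp: P_def F1_def)
    then have "\<iota>2 k \<otimes>\<^bsub>A\<^esub> p = \<iota>2 (k \<otimes>\<^bsub>G2\<^esub> l) \<otimes>\<^bsub>A\<^esub> q \<otimes>\<^bsub>A\<^esub> t"
      using k t \<iota>2c \<iota>2m F by (auto simp: A.m_assoc subset_iff)
    moreover have "\<iota>2 (k \<otimes>\<^bsub>G2\<^esub> l) \<otimes>\<^bsub>A\<^esub> q \<in> F1" using l k by (force simp: F1_def)
    ultimately show ?thesis by (simp add: P_def)
  qed
  have far: "d x (j p) = 1" if x: "x \<in> Y" and p: "p \<in> P" for x p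
  proof (rule ccontr)
    assume "d x (j p) \<noteq> 1"
    then have pB: "p \<in> B" using x PG[OF p] d_le_1[OF YU[OF x] jU[OF PG[OF p]]] by (force simp: B_def)
    obtain q where q: "q \<in> F1" "p = q \<otimes>\<^bsub>A\<^esub> t" using p by (auto simp: P_def)
    then have "inv\<^bsub>A\<^esub> q \<otimes>\<^bsub>A\<^esub> p = t" using F1 t by (auto simp flip: A.m_assoc)
    moreover have "inv\<^bsub>A\<^esub> q \<otimes>\<^bsub>A\<^esub> p \<in> (\<lambda>(q, p). inv\<^bsub>A\<^esub> q \<otimes>\<^bsub>A\<^esub> p) ` (F1 \<times> B)"
      using q(1) pB by force
    ultimately show False using t(2) by simp
  qed
  have far': "d (j p) x = 1" if "x \<in> Y" "p \<in> P" for x p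
    using far[OF that] metric(2)[OF YU[OF that(1)] jU[OF PG[OF that(2)]]] by simp
  have jY: "j p \<notin> Y" if "p \<in> P" for p
    using far[OF _ that] metric(3)[OF jU[OF PG[OF that]] jU[OF PG[OF that]]] by force
  define b' where "b' k u = (if u \<in> Y then b k u else j (\<iota>2 k \<otimes>\<^bsub>A\<^esub> inv_into (carrier A) j u))" for k u
  have b'Y: "b' k u = b k u" if "u \<in> Y" for k u using that by (simp add: b'_def)
  have b'P: "b' k (j p) = j (\<iota>2 k \<otimes>\<^bsub>A\<^esub> p)" if "p \<in> P" for k p
    using jY[OF that] j_inj PG[OF that] by (simp add: b'_def)
  have djP: "d (j (\<iota>2 k \<otimes>\<^bsub>A\<^esub> p)) (j (\<iota>2 k \<otimes>\<^bsub>A\<^esub> q)) = d (j p) (j q)"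
    if "k \<in> carrier G2" "p \<in> P" "q \<in> P" for k p q
  proof (cases "p = q")
    case True
    moreover have "j (\<iota>2 k \<otimes>\<^bsub>A\<^esub> q) \<in> U" "j q \<in> U" using jU \<iota>2c PG that by simp_all
    ultimately show ?thesis using metric(3) by metis
  next
    case False
    then have "\<iota>2 k \<otimes>\<^bsub>A\<^esub> p \<noteq> \<iota>2 k \<otimes>\<^bsub>A\<^esub> q" using \<iota>2c PG that by simp
    then show ?thesis using False j_discrete \<iota>2c PG that by simp
  qed
  have "partial_action (Y \<union> j ` P) b'"
    unfolding partial_action_def isometric_on_def
  proof (intro conjI ballI)
    show "finite (Y \<union> j ` P)" using y(1) P by simp
    show "Y \<union> j ` P \<subseteq> U" using y(2) jU P by blast
    fix u assume u: "u \<in> Y \<union> j ` P"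
    then show "b' \<one>\<^bsub>G2\<^esub> u = u" using b'Y b'P ib(1) \<iota>21 PG by auto
    show "b' (\<theta> h) u = act h u" if h: "h \<in> H" for h
      using u b'Y b'P y(4) h \<iota>12[OF h] act_j[of _ h] PG by auto
    fix k assume k: "k \<in> carrier G2"
    show "b' k u \<in> Y \<union> j ` P" using u k b'Y b'P ib(2) \<iota>2P by auto
    show "b' (k \<otimes>\<^bsub>G2\<^esub> l) u = b' k (b' l u)" if l: "l \<in> carrier G2" for l
      using u k l b'Y b'P ib(2,3) \<iota>2P \<iota>2m \<iota>2c PG by (auto simp: A.m_assoc)
    show "d (b' k u) (b' k v) = d u v" if v: "v \<in> Y \<union> j ` P" for v
      using u v k b'Y b'P ib(2,4) \<iota>2P far far' djP by auto
  qed
  moreover have "extends (Y, b) (Y \<union> j ` P, b')" by (auto simp: extends_def b'Y)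
  moreover have "q \<otimes>\<^bsub>A\<^esub> t \<in> P" if "q \<in> F" for q
  proof -
    have "\<iota>2 \<one>\<^bsub>G2\<^esub> \<otimes>\<^bsub>A\<^esub> q \<in> F1" using that by (force simp: F1_def)
    then show ?thesis using \<iota>21 that F by (auto simp: P_def subset_iff)
  qed
  ultimately show ?thesis using b'P t(1) by (intro exI conjI bexI[OF _ t(1)] ballI) auto
qed

end

section \<open>Amalgamated free products\<close>

text \<open>
  The construction with an empty orbit set already yields an action of the amalgam whose restriction
  to the first factor is free, so no normal form is needed to see that this factor embeds.
\<close>

lemma word_cong_left_factor:
  fixes G1 :: "('a, 'm) monoid_scheme" and G2 :: "('b, 'n) monoid_scheme" and U :: "'u set"
  assumes S: "distance_set S" and U: "S_Urysohn_space S U d"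
    and G1: "group G1" "countable (carrier G1)" and G2: "group G2" "finite (carrier G2)"
    and hcf: "highly_core_free H G1"
    and \<theta>: "\<theta> \<in> hom (G1\<lparr>carrier := H\<rparr>) G2" "inj_on \<theta> H" "\<not> carrier G2 \<subseteq> \<theta> ` H"
    and g: "g \<in> carrier G1" and cong: "([Inl g], []) \<in> word_cong G1 G2 {(h, \<theta> h) | h. h \<in> H}"
  shows "g = \<one>\<^bsub>G1\<^esub>"
proof -
  interpret G1: group G1 by fact
  interpret G2: group G2 by fact
  \<comment> \<open>No points are prescribed here: the empty set over \<open>unit\<close> serves as
    \<open>P\<close>.\<close>
  have no: "countable ({} :: unit set)" "\<And>P. (p :: unit) \<in> {} \<Longrightarrow> P" for p by auto
  obtain act and j :: "unit \<Rightarrow> 'u" where act: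
    "isometric_on G1 (carrier G1) U act d"
    "\<And>g x. g \<in> carrier G1 \<Longrightarrow> x \<in> U \<Longrightarrow> act g x = x \<Longrightarrow> g = \<one>\<^bsub>G1\<^esub>"
    "\<And>x y. x \<in> U \<Longrightarrow> y \<in> U \<Longrightarrow> finite {g \<in> carrier G1. d (act g x) y < 1}"
    "orbit_extension G1 S U act d"
    by (rule generic_action_on_Urysohn_space[OF S U G1 no(1), where pact = "\<lambda>g p. p"])
      (assumption | erule no(2) | rule that)+
  have cU: "countable U" using U by (simp add: S_Urysohn_space_def)
  \<comment> \<open>Extension over the empty set provides a point of \<open>U\<close>, at which
    freeness can be tested.\<close>
  have "\<exists>x\<in>U. \<forall>y\<in>{}. d x y = 1"
    by (rule S_Urysohn_space_point_extension[OF S U, unfolded point_extension_def, rule_format]) simp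
  then obtain x where x: "x \<in> U" by blast
  interpret urysohn_amalgam G1 G2 S U d act H \<theta>
    by unfold_locales (fact S cU S_Urysohn_space_S_metric_on[OF U] act G2 hcf \<theta>)+
  obtain b where b: "isometric_on G2 (carrier G2) U b d" "\<And>h x. h \<in> H \<Longrightarrow> x \<in> U \<Longrightarrow> b (\<theta> h) x = act h x"
    by (rule generic_action[of "{} :: unit set" "\<lambda>_ _ _. True"]) (auto intro: that)
  note ib = isometric_onD[OF b(1)]
  have "word_act act b [Inl g] x = word_act act b [] x"
    by (rule word_act_cong[OF G1(1) G2(1), of U act b, OF action(2,1,3) ib(2,1,3) _ cong x]) (auto simp: b(2))
  then show ?thesis using free[OF g x] by simp
qed

text \<open>The first factor acts on the amalgam by left translation, freely because it embeds; the
  amalgam with this action is the set \<open>P\<close> given to the generic construction. The second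
  action is built generically, with one further requirement for each finite subset of the
  amalgam.\<close>

lemma word_quotient_amalgam_in_homogeneous_groups:
  fixes G1 :: "('a, 'm) monoid_scheme" and G2 :: "('b, 'n) monoid_scheme"
  assumes S: "distance_set S" and U: "S_Urysohn_space S U d"
    and G1: "group G1" "infinite (carrier G1)" "countable (carrier G1)"
    and G2: "group G2" "finite (carrier G2)"
    and hcf: "highly_core_free H G1"
    and \<theta>: "\<theta> \<in> hom (G1\<lparr>carrier := H\<rparr>) G2" "inj_on \<theta> H" "\<not> carrier G2 \<subseteq> \<theta> ` H"
  shows "word_quotient G1 G2 {(h, \<theta> h) | h. h \<in> H} \<in> \<H> U d"
proof -
  interpret G1: group G1 by fact
  interpret G2: group G2 by fact
  define R where "R = {(h, \<theta> h) | h. h \<in> H}"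
  define A where "A = word_quotient G1 G2 R"
  interpret A: group A unfolding A_def by (rule group_word_quotient[OF G1(1) G2(1)])
  interpret H: subgroup H G1 using hcf by (simp add: highly_core_free_def)
  have H: "subgroup H G1" using hcf by (simp add: highly_core_free_def)
  let ?c = "word_class G1 G2 R"
  have W1: "[Inl g] \<in> words G1 G2" if "g \<in> carrier G1" for g using that by auto
  have W2: "[Inr k] \<in> words G1 G2" if "k \<in> carrier G2" for k using that by auto
  note carrier = carrier_word_quotient[OF G1(1) G2(1), of R, folded A_def]
    and mult = mult_word_quotient[OF G1(1) G2(1), of _ _ R, folded A_def]
    and one = one_word_quotient[OF G1(1) G2(1), of R, folded A_def]
    and eq_iff = word_class_eq_iff[OF G1(1) G2(1), of _ _ R]
  have c_in: "?c w \<in> carrier A" if "w \<in> words G1 G2" for w using that carrier by blast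
  define \<iota>1 where "\<iota>1 g = ?c [Inl g]" for g
  define \<iota>2 where "\<iota>2 k = ?c [Inr k]" for k
  have \<iota>1: "\<iota>1 \<in> hom G1 A"
  proof (rule homI)
    show "\<iota>1 g \<in> carrier A" if "g \<in> carrier G1" for g using c_in[OF W1[OF that]] by (simp add: \<iota>1_def)
    show "\<iota>1 (g \<otimes>\<^bsub>G1\<^esub> h) = \<iota>1 g \<otimes>\<^bsub>A\<^esub> \<iota>1 h" if "g \<in> carrier G1" "h \<in> carrier G1" for g h
      using word_class_eqI[OF G1(1) G2(1) word_cong.mult_left[OF that], of R] mult[OF W1 W1] that
      by (simp add: \<iota>1_def)
  qed
  have \<iota>2: "\<iota>2 \<in> hom G2 A"
  proof (rule homI)
    show "\<iota>2 k \<in> carrier A" if "k \<in> carrier G2" for k using c_in[OF W2[OF that]] by (simp add: \<iota>2_def)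
    show "\<iota>2 (k \<otimes>\<^bsub>G2\<^esub> l) = \<iota>2 k \<otimes>\<^bsub>A\<^esub> \<iota>2 l" if "k \<in> carrier G2" "l \<in> carrier G2" for k l
      using word_class_eqI[OF G1(1) G2(1) word_cong.mult_right[OF that], of R] mult[OF W2 W2] that
      by (simp add: \<iota>2_def)
  qed
  have \<theta>c: "\<theta> h \<in> carrier G2" if "h \<in> H" for h using \<theta>(1) that by (auto simp: hom_def)
  have \<iota>12: "\<iota>1 h = \<iota>2 (\<theta> h)" if "h \<in> H" for h
  proof -
    have "([Inl h], [Inr (\<theta> h)]) \<in> word_cong G1 G2 R"
      using that \<theta>c by (intro word_cong.identify) (auto simp: R_def)
    then show ?thesis unfolding \<iota>1_def \<iota>2_def using eq_iff[OF W1 W2] that \<theta>c by simp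
  qed
  have \<iota>1c: "\<iota>1 g \<in> carrier A" if "g \<in> carrier G1" for g using \<iota>1 that by (auto simp: hom_def)
  have \<iota>2c: "\<iota>2 g \<in> carrier A" if "g \<in> carrier G2" for g using \<iota>2 that by (auto simp: hom_def)
  have \<iota>1_one: "g = \<one>\<^bsub>G1\<^esub>" if g: "g \<in> carrier G1" "\<iota>1 g = \<one>\<^bsub>A\<^esub>" for g
  proof (rule word_cong_left_factor[OF S U G1(1,3) G2 hcf \<theta> g(1)])
    show "([Inl g], []) \<in> word_cong G1 G2 {(h, \<theta> h) | h. h \<in> H}"
      using eq_iff[OF W1[OF g(1)] lists.Nil] g(2) unfolding \<iota>1_def one R_def by blast
  qed
  interpret \<iota>1: group_hom G1 A \<iota>1
    using \<iota>1 G1(1) A.group_axioms by (simp add: group_hom_def group_hom_axioms_def)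
  have \<iota>1_inj: "inj_on \<iota>1 (carrier G1)" using \<iota>1.inj_on_one_iff \<iota>1_one by blast
  have cA: "countable (carrier A)"
    unfolding A_def using G1(3) G2(2)
    by (intro countable_word_quotient[OF G1(1) G2(1)] uncountable_infinite) (auto intro: countable_finite)
  have pact: "\<And>p. p \<in> carrier A \<Longrightarrow> \<iota>1 \<one>\<^bsub>G1\<^esub> \<otimes>\<^bsub>A\<^esub> p = p"
      "\<And>g p. g \<in> carrier G1 \<Longrightarrow> p \<in> carrier A \<Longrightarrow> \<iota>1 g \<otimes>\<^bsub>A\<^esub> p \<in> carrier A"
      "\<And>g h p. g \<in> carrier G1 \<Longrightarrow> h \<in> carrier G1 \<Longrightarrow> p \<in> carrier A \<Longrightarrow>
        \<iota>1 (g \<otimes>\<^bsub>G1\<^esub> h) \<otimes>\<^bsub>A\<^esub> p = \<iota>1 g \<otimes>\<^bsub>A\<^esub> (\<iota>1 h \<otimes>\<^bsub>A\<^esub> p)"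
      "\<And>g p. g \<in> carrier G1 \<Longrightarrow> p \<in> carrier A \<Longrightarrow> \<iota>1 g \<otimes>\<^bsub>A\<^esub> p = p \<Longrightarrow> g = \<one>\<^bsub>G1\<^esub>"
    using \<iota>1_one by (auto simp: A.m_assoc)
  obtain act j where act:
    "isometric_on G1 (carrier G1) U act d" "j \<in> carrier A \<rightarrow> U"
    "\<And>g p. p \<in> carrier A \<Longrightarrow> act g (j p) = j (\<iota>1 g \<otimes>\<^bsub>A\<^esub> p)"
    "\<And>g x. g \<in> carrier G1 \<Longrightarrow> x \<in> U \<Longrightarrow> act g x = x \<Longrightarrow> g = \<one>\<^bsub>G1\<^esub>"
    "\<And>x y. x \<in> U \<Longrightarrow> y \<in> U \<Longrightarrow> finite {g \<in> carrier G1. d (act g x) y < 1}"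
    "\<And>p q. p \<in> carrier A \<Longrightarrow> q \<in> carrier A \<Longrightarrow> p \<noteq> q \<Longrightarrow> d (j p) (j q) = 1"
    "\<And>x. x \<in> U \<Longrightarrow> finite {p \<in> carrier A. d x (j p) < 1}"
    "orbit_extension G1 S U act d"
    by (rule generic_action_on_Urysohn_space[OF S U G1(1,3) cA, where pact = "\<lambda>g p. \<iota>1 g \<otimes>\<^bsub>A\<^esub> p", OF pact])
      (assumption | rule that)+
  have cU: "countable U" using U by (simp add: S_Urysohn_space_def)
  have A_inf: "infinite (carrier A)"
    using G1(2) inj_on_finite[OF \<iota>1_inj] \<iota>1c by blast
  interpret urysohn_amalgam_orbit G1 G2 S U d act H \<theta> A \<iota>1 \<iota>2 j
    by unfold_locales
      (fact S cU S_Urysohn_space_S_metric_on[OF U] act G1 G2 hcf \<theta> A_inf \<iota>2 \<iota>12)+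
  \<comment> \<open>\<open>E F\<close> says that on some right translate of \<open>F\<close>, inside
    the copy of the amalgam, the second factor acts by left translation.\<close>
  define E where "E F Y b \<longleftrightarrow> (\<exists>t\<in>carrier A. \<forall>q\<in>F. j (q \<otimes>\<^bsub>A\<^esub> t) \<in> Y \<and>
      (\<forall>k\<in>carrier G2. b k (j (q \<otimes>\<^bsub>A\<^esub> t)) = j (\<iota>2 k \<otimes>\<^bsub>A\<^esub> (q \<otimes>\<^bsub>A\<^esub> t))))" for F Y b
  have E: "\<exists>Y' b'. partial_action Y' b' \<and> extends (Y, b) (Y', b') \<and> E F Y' b'"
    if "F \<in> {F. finite F \<and> F \<subseteq> carrier A}" "partial_action Y b" for F Y b
    using extend_faithful[OF that(2)] that(1) by (simp add: E_def)
  have cF: "countable {F. finite F \<and> F \<subseteq> carrier A}"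
    by (rule countable_Collect_finite_subset[OF cA])
  obtain b where b: "isometric_on G2 (carrier G2) U b d"
    and b_\<theta>: "\<And>h x. h \<in> H \<Longrightarrow> x \<in> U \<Longrightarrow> b (\<theta> h) x = act h x"
    and homog: "\<And>\<Phi>. finite \<Phi> \<Longrightarrow> \<Phi> \<subseteq> U \<times> U \<Longrightarrow>
      \<forall>(x, y)\<in>\<Phi>. \<forall>(x', y')\<in>\<Phi>. d x x' = d y y' \<Longrightarrow>
      \<exists>g1\<in>carrier G1. \<exists>g2\<in>carrier G1. \<exists>k\<in>carrier G2. \<forall>(x, y)\<in>\<Phi>. b k (act g1 x) = act g2 y"
    and faithful: "\<And>F. F \<in> {F. finite F \<and> F \<subseteq> carrier A} \<Longrightarrow>
      \<exists>Y b'. E F Y b' \<and> (\<forall>k\<in>carrier G2. \<forall>x\<in>Y. b k x = b' k x)"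
    by (rule generic_action[OF cF E]) (assumption | rule that)+
  have "word_quotient G1 G2 R \<in> \<H> U d"
  proof (rule word_quotient_in_homogeneous_groups[OF G1(1) G2(1) G1(3) countable_finite[OF G2(2)] act b])
    show "act g x = b k x" if "(g, k) \<in> R" "x \<in> U" for g k x using that b_\<theta> by (auto simp: R_def)
  next
    fix \<Phi> assume \<Phi>: "finite \<Phi>" "\<Phi> \<subseteq> U \<times> U"
      and iso: "\<And>x y x' y'. (x, y) \<in> \<Phi> \<Longrightarrow> (x', y') \<in> \<Phi> \<Longrightarrow> d x x' = d y y'"
    have "\<forall>(x, y)\<in>\<Phi>. \<forall>(x', y')\<in>\<Phi>. d x x' = d y y'" using iso by blast
    then obtain g1 g2 k where g: "g1 \<in> carrier G1" "g2 \<in> carrier G1" "k \<in> carrier G2"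
      and *: "\<And>x y. (x, y) \<in> \<Phi> \<Longrightarrow> b k (act g1 x) = act g2 y"
      using homog[OF \<Phi>] by blast
    show "\<exists>w\<in>words G1 G2. \<forall>(x, y)\<in>\<Phi>. word_act act b w x = y"
    proof (intro bexI ballI, clarify)
      fix x y assume xy: "(x, y) \<in> \<Phi>"
      then have "y \<in> U" using \<Phi> by blast
      then have "act (inv\<^bsub>G1\<^esub> g2) (act g2 y) = y" using action(3)[of y "inv\<^bsub>G1\<^esub> g2" g2] action(1) g by simp
      then show "word_act act b [Inl (inv\<^bsub>G1\<^esub> g2), Inr k, Inl g1] x = y" using *[OF xy] by simp
    qed (use g in auto)
  next
    fix w assume w: "w \<in> words G1 G2" and triv: "\<And>x. x \<in> U \<Longrightarrow> word_act act b w x = x"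
    \<comment> \<open>The letters of \<open>w\<close> act on \<open>j t\<close> from the right end,
      so the points met are given by the classes of the suffixes of \<open>w\<close>, multiplied by
      \<open>t\<close>. \<open>F\<close> collects these classes.\<close>
    define F where "F = (\<lambda>n. ?c (drop n w)) ` {..length w}"
    have dropW: "drop n w \<in> words G1 G2" for n using w by (auto dest: in_set_dropD)
    have "F \<in> {F. finite F \<and> F \<subseteq> carrier A}" using c_in[OF dropW] by (auto simp: F_def)
    from faithful[OF this] obtain Y b' where EF: "E F Y b'"
      and bb': "\<forall>k\<in>carrier G2. \<forall>x\<in>Y. b k x = b' k x"
      by (elim exE conjE) (rule that)
    from EF obtain t where t: "t \<in> carrier A" and
      b': "\<forall>q\<in>F. j (q \<otimes>\<^bsub>A\<^esub> t) \<in> Y \<and>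
        (\<forall>k\<in>carrier G2. b' k (j (q \<otimes>\<^bsub>A\<^esub> t)) = j (\<iota>2 k \<otimes>\<^bsub>A\<^esub> (q \<otimes>\<^bsub>A\<^esub> t)))"
      unfolding E_def by (elim bexE) (rule that)
    have bt: "b k (j (q \<otimes>\<^bsub>A\<^esub> t)) = j (\<iota>2 k \<otimes>\<^bsub>A\<^esub> (q \<otimes>\<^bsub>A\<^esub> t))" if "q \<in> F" "k \<in> carrier G2" for q k
      using b' bb' that by simp
    have orbit: "word_act act b v (j t) = j (?c v \<otimes>\<^bsub>A\<^esub> t)" if "u @ v = w" for u v
      using that
    proof (induction v arbitrary: u)
      case Nil
      then show ?case using t by (simp flip: one)
    next
      case (Cons l v)
      have IH: "word_act act b v (j t) = j (?c v \<otimes>\<^bsub>A\<^esub> t)" using Cons.IH[of "u @ [l]"] Cons.prems by simp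
      have "drop (Suc (length u)) w = v" "Suc (length u) \<le> length w" using Cons.prems by auto
      then have vF: "?c v \<in> F" unfolding F_def by (metis atMost_iff imageI)
      have vW: "v \<in> words G1 G2" and lW: "[l] \<in> words G1 G2" using w Cons.prems by auto
      note cv = c_in[OF vW]
      have lv: "?c (l # v) = ?c [l] \<otimes>\<^bsub>A\<^esub> ?c v" using mult[OF lW vW] by simp
      show ?case
      proof (cases l)
        case (Inl g)
        then have g: "g \<in> carrier G1" using lW by auto
        have "word_act act b (l # v) (j t) = j (\<iota>1 g \<otimes>\<^bsub>A\<^esub> (?c v \<otimes>\<^bsub>A\<^esub> t))"
          using Inl IH act_j[of "?c v \<otimes>\<^bsub>A\<^esub> t" g] cv t by simp
        then show ?thesis using lv \<iota>1c[OF g] cv t Inl by (simp add: A.m_assoc flip: \<iota>1_def)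
      next
        case (Inr k)
        then have k: "k \<in> carrier G2" using lW by auto
        have "word_act act b (l # v) (j t) = j (\<iota>2 k \<otimes>\<^bsub>A\<^esub> (?c v \<otimes>\<^bsub>A\<^esub> t))"
          using Inr IH bt[OF vF k] by simp
        then show ?thesis using lv \<iota>2c[OF k] cv t Inr by (simp add: A.m_assoc flip: \<iota>2_def)
      qed
    qed
    \<comment> \<open>On \<open>j t\<close> the word acts as left translation by its class, so
      fixing \<open>j t\<close> makes the class trivial.\<close>
    have "j t \<in> U" using j t by blast
    then have "j (?c w \<otimes>\<^bsub>A\<^esub> t) = j t" using orbit[of "[]" w] triv by simp
    then have "?c w \<otimes>\<^bsub>A\<^esub> t = t" using j_inj c_in[OF w] t by (simp add: inj_on_eq_iff)
    then have "?c w = ?c []" using c_in[OF w] t by (simp flip: one)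
    then show "(w, []) \<in> word_cong G1 G2 R" using eq_iff[OF w lists.Nil] by blast
  qed
  then show ?thesis by (simp add: R_def)
qed

text \<open>The free product is the amalgam over the trivial subgroup: both units are already
  congruent to the empty word, so identifying them adds no relation.\<close>

lemma word_cong_identify_one:
  assumes "group G1" "group G2"
  shows "word_cong G1 G2 {(\<one>\<^bsub>G1\<^esub>, \<one>\<^bsub>G2\<^esub>)} = word_cong G1 G2 {}"
proof (intro equalityI subrelI)
  fix u v assume "(u, v) \<in> word_cong G1 G2 {(\<one>\<^bsub>G1\<^esub>, \<one>\<^bsub>G2\<^esub>)}"
  then show "(u, v) \<in> word_cong G1 G2 {}"
  proof induction
    case (identify x y)
    then show ?case
      using word_cong.trans[OF word_cong.one_left word_cong.sym[OF word_cong.one_right]] by blast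
  qed (blast intro: word_cong.intros)+
next
  fix u v assume "(u, v) \<in> word_cong G1 G2 {}"
  then show "(u, v) \<in> word_cong G1 G2 {(\<one>\<^bsub>G1\<^esub>, \<one>\<^bsub>G2\<^esub>)}"
    by induction (blast intro: word_cong.intros)+
qed

text \<open>The common subgroup is replaced by its copy in the first factor, with
  \<open>\<theta>\<close> the transition map from this copy to the one in the second factor.\<close>

lemma amalgamated_free_product_in_homogeneous_groups:
  fixes G1 :: "('a, 'm) monoid_scheme" and G2 :: "('b, 'n) monoid_scheme"
    and K :: "('s, 'k) monoid_scheme"
  assumes S: "distance_set S" and U: "S_Urysohn_space S U d"
    and G1: "group G1" "infinite (carrier G1)" "countable (carrier G1)"
    and G2: "group G2" "finite (carrier G2)"
    and K: "common_subgroup K G1 G2 i1 i2"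
    and hcf: "highly_core_free (i1 ` carrier K) G1"
    and index: "card (rcosets\<^bsub>G2\<^esub> (i2 ` carrier K)) \<ge> 2"
  shows "amalgamated_free_product G1 G2 K i1 i2 \<in> \<H> U d"
proof -
  interpret G1: group G1 by fact
  interpret G2: group G2 by fact
  interpret K: group K using K by (simp add: common_subgroup_def)
  have i1: "i1 \<in> hom K G1" "inj_on i1 (carrier K)" and i2: "i2 \<in> hom K G2" "inj_on i2 (carrier K)"
    using K by (auto simp: common_subgroup_def mon_def)
  define \<theta> where "\<theta> = i2 \<circ> inv_into (carrier K) i1"
  have \<theta>: "\<theta> (i1 s) = i2 s" if "s \<in> carrier K" for s using i1(2) that by (simp add: \<theta>_def)
  have img: "\<theta> ` i1 ` carrier K = i2 ` carrier K" using \<theta> by (auto simp: image_image)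
  have "\<theta> \<in> hom (G1\<lparr>carrier := i1 ` carrier K\<rparr>) G2"
  proof (rule homI)
    fix x assume "x \<in> carrier (G1\<lparr>carrier := i1 ` carrier K\<rparr>)"
    then obtain s where s: "s \<in> carrier K" "x = i1 s" by auto
    then show "\<theta> x \<in> carrier G2" using \<theta> i2(1) by (auto simp: hom_def)
    fix y assume "y \<in> carrier (G1\<lparr>carrier := i1 ` carrier K\<rparr>)"
    then obtain t where t: "t \<in> carrier K" "y = i1 t" by auto
    have "i1 s \<otimes>\<^bsub>G1\<^esub> i1 t = i1 (s \<otimes>\<^bsub>K\<^esub> t)" using i1(1) s t by (simp add: hom_def)
    then show "\<theta> (x \<otimes>\<^bsub>G1\<lparr>carrier := i1 ` carrier K\<rparr>\<^esub> y) = \<theta> x \<otimes>\<^bsub>G2\<^esub> \<theta> y"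
      using \<theta> i2(1) s t by (simp add: hom_def)
  qed
  moreover have "inj_on \<theta> (i1 ` carrier K)"
    using \<theta> i2(2) by (auto simp: inj_on_def)
  \<comment> \<open>If \<open>\<theta>\<close> were onto, the second factor would be the only right
    coset, against the assumption on the index.\<close>
  moreover have "\<not> carrier G2 \<subseteq> \<theta> ` i1 ` carrier K"
  proof
    assume "carrier G2 \<subseteq> \<theta> ` i1 ` carrier K"
    then have "i2 ` carrier K = carrier G2" using img i2(1) by (auto simp: hom_def)
    then have "rcosets\<^bsub>G2\<^esub> (i2 ` carrier K) \<subseteq> {carrier G2}"
      using G2.coset_join2[OF _ G2.subgroup_self] by (auto simp: RCOSETS_def)
    then have "card (rcosets\<^bsub>G2\<^esub> (i2 ` carrier K)) \<le> 1"
      using card_mono[of "{carrier G2}"] by fastforce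
    then show False using index by simp
  qed
  ultimately have "word_quotient G1 G2 {(h, \<theta> h) | h. h \<in> i1 ` carrier K} \<in> \<H> U d"
    by (rule word_quotient_amalgam_in_homogeneous_groups[OF S U G1 G2 hcf])
  moreover have "{(h, \<theta> h) | h. h \<in> i1 ` carrier K} = {(i1 s, i2 s) | s. s \<in> carrier K}"
    using \<theta> by force
  ultimately show ?thesis by (simp add: amalgamated_free_product_def)
qed

theorem corollary4p6:
  fixes S :: "real set"
    and U :: "'u set" and d :: "'u \<Rightarrow> 'u \<Rightarrow> real"
    and \<Gamma>1 :: "'a monoid" and \<Gamma>2 :: "'b monoid"
  assumes "distance_set S"
    and "S_Urysohn_space S U d"
    and "group \<Gamma>1" and "infinite (carrier \<Gamma>1)" and "countable (carrier \<Gamma>1)"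
    and "group \<Gamma>2" and "finite (carrier \<Gamma>2)"
  shows "(\<forall>(\<Sigma> :: 's monoid) i1 i2.
            common_subgroup \<Sigma> \<Gamma>1 \<Gamma>2 i1 i2 \<and>
            highly_core_free (i1 ` carrier \<Sigma>) \<Gamma>1 \<and>
            card (rcosets\<^bsub>\<Gamma>2\<^esub> (i2 ` carrier \<Sigma>)) \<ge> 2 \<longrightarrow>
            amalgamated_free_product \<Gamma>1 \<Gamma>2 \<Sigma> i1 i2 \<in> \<H> U d)
       \<and> (carrier \<Gamma>2 \<noteq> {\<one>\<^bsub>\<Gamma>2\<^esub>} \<longrightarrow> free_product \<Gamma>1 \<Gamma>2 \<in> \<H> U d)
       \<and> (icc \<Gamma>1 \<longrightarrow>
          (\<forall>(\<Sigma> :: 's monoid) i1 i2.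
            common_subgroup \<Sigma> \<Gamma>1 \<Gamma>2 i1 i2 \<and>
            card (rcosets\<^bsub>\<Gamma>2\<^esub> (i2 ` carrier \<Sigma>)) \<ge> 2 \<longrightarrow>
            amalgamated_free_product \<Gamma>1 \<Gamma>2 \<Sigma> i1 i2 \<in> \<H> U d))"
proof (intro conjI impI allI; (elim conjE)?)
  note amalgam = amalgamated_free_product_in_homogeneous_groups[OF assms]
  interpret G1: group \<Gamma>1 by fact
  interpret G2: group \<Gamma>2 by fact
  show "amalgamated_free_product \<Gamma>1 \<Gamma>2 \<Sigma> i1 i2 \<in> \<H> U d"
    if "common_subgroup \<Sigma> \<Gamma>1 \<Gamma>2 i1 i2" "highly_core_free (i1 ` carrier \<Sigma>) \<Gamma>1"
      "card (rcosets\<^bsub>\<Gamma>2\<^esub> (i2 ` carrier \<Sigma>)) \<ge> 2" for \<Sigma> :: "'s monoid" and i1 i2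
    using amalgam that by blast
  show "free_product \<Gamma>1 \<Gamma>2 \<in> \<H> U d" if nt: "carrier \<Gamma>2 \<noteq> {\<one>\<^bsub>\<Gamma>2\<^esub>}"
  proof -
    \<comment> \<open>The condition on conjugacy classes is vacuous for the trivial
      subgroup.\<close>
    have G1_hcf: "highly_core_free {\<one>\<^bsub>\<Gamma>1\<^esub>} \<Gamma>1"
      by (rule highly_core_free_finite[OF assms(3,4) G1.triv_subgroup]) auto
    have "word_quotient \<Gamma>1 \<Gamma>2 {(h, (\<lambda>h. \<one>\<^bsub>\<Gamma>2\<^esub>) h) | h. h \<in> {\<one>\<^bsub>\<Gamma>1\<^esub>}} \<in> \<H> U d"
      using nt by (intro word_quotient_amalgam_in_homogeneous_groups[OF assms
          G1_hcf]) (auto simp: hom_def)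
    moreover have "{(h, (\<lambda>h. \<one>\<^bsub>\<Gamma>2\<^esub>) h) | h. h \<in> {\<one>\<^bsub>\<Gamma>1\<^esub>}} = {(\<one>\<^bsub>\<Gamma>1\<^esub>, \<one>\<^bsub>\<Gamma>2\<^esub>)}" by auto
    ultimately show ?thesis
      by (simp add: free_product_def word_quotient_def word_cong_identify_one[OF assms(3,6)])
  qed
  show "amalgamated_free_product \<Gamma>1 \<Gamma>2 \<Sigma> i1 i2 \<in> \<H> U d"
    if icc: "icc \<Gamma>1" and \<Sigma>: "common_subgroup \<Sigma> \<Gamma>1 \<Gamma>2 i1 i2"
      and index: "card (rcosets\<^bsub>\<Gamma>2\<^esub> (i2 ` carrier \<Sigma>)) \<ge> 2" for \<Sigma> :: "'s monoid" and i1 i2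
  proof -
    have i1: "group_hom \<Sigma> \<Gamma>1 i1" and i2: "i2 \<in> carrier \<Sigma> \<rightarrow> carrier \<Gamma>2" "inj_on i2 (carrier \<Sigma>)"
      using \<Sigma> assms(3) by (auto simp: common_subgroup_def mon_def hom_def group_hom_def group_hom_axioms_def)
    \<comment> \<open>\<open>\<Sigma>\<close> is finite because it embeds into the finite factor,
      and the nontrivial elements of its copy in \<open>\<Gamma>1\<close> have infinite conjugacy
      classes by \<open>icc\<close>.\<close>
    have "finite (carrier \<Sigma>)"
      using i2 assms(7) by (intro inj_on_finite[of i2 _ "carrier \<Gamma>2"]) auto
    moreover have sub: "subgroup (i1 ` carrier \<Sigma>) \<Gamma>1" using group_hom.img_is_subgroup[OF i1] by simp
    ultimately have "highly_core_free (i1 ` carrier \<Sigma>) \<Gamma>1"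
      using icc subgroup.subset[OF sub]
      by (intro highly_core_free_finite[OF assms(3,4) sub]) (auto simp: icc_def)
    then show ?thesis using amalgam \<Sigma> index by blast
  qed
qed

end
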